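(* Let $q$ be an odd prime power and let $F$ be an algebraic closure of $\mathbb{F}_2$. Let $H\cong \mathrm{PSL}(2,q)$, $I$, $E$, $F^I$, $F^E$, $\phi_{\mathbf{B}}$ and $\phi_{\mathbf{D}}$ be as in the context. Then, as $FH$-modules: (i) if $q\equiv 1\pmod 4$, then $\mathrm{Im}(\phi_{\mathbf{B}})=\mathrm{Im}(\phi_{\mathbf{D}})\oplus\bigoplus_{s=1}^{(q-1)/4}M_s$, where $M_1,\dots,M_{(q-1)/4}$ are pairwise non-isomorphic simple $FH$-modules of dimension $q-1$; (ii) if $q\equiv 3\pmod 4$, then $\mathrm{Im}(\phi_{\mathbf{B}})=\langle\mathbf{1}\rangle\oplus\mathrm{Im}(\phi_{\mathbf{D}})\oplus\bigoplus_{r=1}^{(q-3)/4}M_r$, where $M_1,\dots,M_{(q-3)/4}$ are pairwise non-isomorphic simple $FH$-modules of dimension $q+1$ and $\langle\mathbf{1}\rangle$ is the trivial $FH$-module spanned by the all-one vector of $F^E$.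
   Context: Points of $\mathrm{PG}(2,q)$ are written $(a_0,a_1,a_2)$ (nonzero vectors of $\mathbb{F}_q^3$ up to scalars), lines $[b_0,b_1,b_2]$, with incidence $a_0b_0+a_1b_1+a_2b_2=0$. Let $\mathcal{O}=\{(1,t,t^2):t\in\mathbb{F}_q\}\cup\{(0,0,1)\}$. A point not on $\mathcal{O}$ is internal if $a_1^2-a_0a_2$ is a non-square of $\mathbb{F}_q$ and external if it is a nonzero square; $I$ and $E$ denote the sets of internal and external points. A line is passant (resp. secant, tangent) if it meets $\mathcal{O}$ in $0$ (resp. $2$, $1$) points. The polarity $\perp$ sends the point $(x,y,z)$ to the line $[z,-2y,x]$. For $P\in I$, $N_{Pa,E}(P)$ is the set of external points lying on some passant line through $P$. For $A=\begin{pmatrix}a&b\\c&d\end{pmatrix}\in\mathrm{SL}(2,q)$ let $\tau(A)=\begin{pmatrix}a^2&ab&b^2\\2ac&ad+bc&2bd\\c^2&cd&d^2\end{pmatrix}$ and $H=\{\tau(A):A\in\mathrm{SL}(2,q)\}$; $H$ acts on points by $P\mapsto P^h=(a_0,a_1,a_2)h$ (row vector times matrix), and on lines by taking images of point sets; it preserves $I$ and $E$. $F^I$ (resp. $F^E$) is the $F$-vector space with basis $\{\mathcal{G}_P:P\in I\}$ (resp. $\{\chi_Q:Q\in E\}$), made into a (right) $FH$-permutation module by $\mathcal{G}_P\cdot h=\mathcal{G}_{P^h}$, $\chi_Q\cdot h=\chi_{Q^h}$. For $N\subseteq E$, $\chi_N=\sum_{Q\in N}\chi_Q$. The $F$-linear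 maps $\phi_{\mathbf{B}},\phi_{\mathbf{D}}:F^I\to F^E$ are defined by $\phi_{\mathbf{B}}(\mathcal{G}_P)=\chi_{E\cap P^\perp}$ (sum of the external points on the line $P^\perp$) and $\phi_{\mathbf{D}}(\mathcal{G}_P)=\chi_{N_{Pa,E}(P)}$. *)

theory Defs
  imports "HOL-Analysis.Analysis" "HOL-Library.Z2"
begin

text \<open>A field \<open>'f\<close> with an embedding \<open>\<iota>\<close> of \<open>'a\<close> is an algebraic closure of \<open>'a\<close>: being
  algebraically closed is the type class.\<close>

definition is_algebraic_closure :: "('a::field \<Rightarrow> 'f::alg_closed_field) \<Rightarrow> bool" where
  "is_algebraic_closure \<iota> \<longleftrightarrow>
     \<iota> 1 = 1 \<and> (\<forall>x y. \<iota> (x + y) = \<iota> x + \<iota> y) \<and> (\<forall>x y. \<iota> (x * y) = \<iota> x * \<iota> y) \<and>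
     (\<forall>z. \<exists>p. p \<noteq> 0 \<and> poly (map_poly \<iota> p) z = 0)"


subsection \<open>The projective plane and the conic\<close>

text \<open>The field \<open>\<bbbF>\<^sub>q\<close> is a type \<open>'k :: {field, finite}\<close> with \<open>q = CARD('k)\<close>. A point \<open>(a\<^sub>0,a\<^sub>1,a\<^sub>2)\<close> is
  the one-dimensional subspace spanned by \<open>vector [a\<^sub>0,a\<^sub>1,a\<^sub>2]\<close>, so that \<open>a\<^sub>0\<close>, \<open>a\<^sub>1\<close>, \<open>a\<^sub>2\<close> are the
  components \<open>$1\<close>, \<open>$2\<close>, \<open>$3\<close>. A line is a set of points; its coordinates \<open>[b\<^sub>0,b\<^sub>1,b\<^sub>2]\<close>, again
  defined up to scalars, are also given as a one-dimensional subspace.\<close>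

type_synonym 'k point = "('k, 3) vec set"

definition proj :: "'k::field ^ 3 \<Rightarrow> 'k point" where
  "proj v = vec.span {v}"

definition points :: "'k::field point set" where
  "points = {proj v | v. v \<noteq> 0}"

definition line :: "'k::field point \<Rightarrow> 'k point set" where
  "line B = {P \<in> points. \<forall>a\<in>P. \<forall>b\<in>B. a$1 * b$1 + a$2 * b$2 + a$3 * b$3 = 0}"

definition lines :: "'k::field point set set" where
  "lines = line ` points"

definition conic :: "'k::field point set" where
  "conic = {proj (vector [1, t, t^2]) | t. True} \<union> {proj (vector [0, 0, 1])}"

definition internal_points :: "'k::field point set" where
  "internal_points = {proj a | a. a \<noteq> 0 \<and> proj a \<notin> conic \<and> (\<nexists>c. c^2 = (a$2)^2 - a$1 * a$3)}"

definition external_points :: "'k::field point set" where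
  "external_points =
     {proj a | a. a \<noteq> 0 \<and> proj a \<notin> conic \<and> (\<exists>c. c \<noteq> 0 \<and> c^2 = (a$2)^2 - a$1 * a$3)}"

definition passant_lines :: "'k::field point set set" where
  "passant_lines = {l \<in> lines. card (l \<inter> conic) = 0}"

text \<open>The coordinates of the line are the image of the point under the linear map
  \<open>(x,y,z) \<mapsto> [z,-2y,x]\<close>.\<close>

definition perp :: "'k::field point \<Rightarrow> 'k point set" where
  "perp P = line ((\<lambda>v. vector [v$3, - 2 * v$2, v$1]) ` P)"

definition N_PaE :: "'k::field point \<Rightarrow> 'k point set" where
  "N_PaE P = {Q \<in> external_points. \<exists>l\<in>passant_lines. P \<in> l \<and> Q \<in> l}"


subsection \<open>The group\<close>

definition tau :: "'k::field ^ 2 ^ 2 \<Rightarrow> 'k ^ 3 ^ 3" where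
  "tau A = (let a = A$1$1; b = A$1$2; c = A$2$1; d = A$2$2 in
     vector [vector [a^2, a * b, b^2],
             vector [2 * a * c, a * d + b * c, 2 * b * d],
             vector [c^2, c * d, d^2]])"

definition H :: "('k::field ^ 3 ^ 3) set" where
  "H = tau ` {A. det A = 1}"

definition point_act :: "'k::field point \<Rightarrow> 'k ^ 3 ^ 3 \<Rightarrow> 'k point" where
  "point_act P h = (\<lambda>v. v v* h) ` P"


subsection \<open>Permutation modules\<close>

text \<open>For a set \<open>S\<close> of points, \<open>F\<^sup>S\<close> is realised inside the space of vectors over \<open>F\<close> indexed by
  the (finite) type of all subsets of \<open>'k ^ 3\<close>, as the span of the coordinate vectors at the elements
  of \<open>S\<close>. The coordinate vector at \<open>P\<close> is both \<open>\<G>\<^sub>P\<close> (for internal \<open>P\<close>) and \<open>\<chi>\<^sub>P\<close> (for external \<open>P\<close>).\<close>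

type_synonym ('f, 'k) pvec = "('f, 'k point) vec"

definition bvec :: "'k::{field,finite} point \<Rightarrow> ('f::field, 'k) pvec" where
  "bvec P = axis P 1"

definition perm_space :: "'k::{field,finite} point set \<Rightarrow> ('f::field, 'k) pvec set" where
  "perm_space S = vec.span (bvec ` S)"

definition chi :: "'k::{field,finite} point set \<Rightarrow> ('f::field, 'k) pvec" where
  "chi N = (\<Sum>Q\<in>N. bvec Q)"

text \<open>The linear map on the span of the \<open>bvec P\<close>, \<open>P \<in> S\<close>, that sends \<open>bvec P\<close> to \<open>g P\<close>.\<close>

definition lin_ext ::
  "'k::{field,finite} point set \<Rightarrow> ('k point \<Rightarrow> ('f::field, 'k) pvec) \<Rightarrow> ('f, 'k) pvec \<Rightarrow> ('f, 'k) pvec"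
where
  "lin_ext S g v = (\<Sum>P\<in>S. (v $ P) *s g P)"

definition module_act :: "('f::field, 'k::{field,finite}) pvec \<Rightarrow> 'k ^ 3 ^ 3 \<Rightarrow> ('f, 'k) pvec" where
  "module_act v h = lin_ext points (\<lambda>P. bvec (point_act P h)) v"

definition phi_B :: "('f::field, 'k::{field,finite}) pvec \<Rightarrow> ('f, 'k) pvec" where
  "phi_B = lin_ext internal_points (\<lambda>P. chi (external_points \<inter> perp P))"

definition phi_D :: "('f::field, 'k::{field,finite}) pvec \<Rightarrow> ('f, 'k) pvec" where
  "phi_D = lin_ext internal_points (\<lambda>P. chi (N_PaE P))"

definition Im_phi_B :: "('f::field, 'k::{field,finite}) pvec set" where
  "Im_phi_B = phi_B ` perm_space internal_points"

definition Im_phi_D :: "('f::field, 'k::{field,finite}) pvec set" where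
  "Im_phi_D = phi_D ` perm_space internal_points"


subsection \<open>\<open>FH\<close>-modules\<close>

text \<open>\<open>FH\<close>-submodules of the permutation module on all points; \<open>F\<^sup>I\<close> and \<open>F\<^sup>E\<close> are among them.\<close>

definition FH_module :: "('f::field, 'k::{field,finite}) pvec set \<Rightarrow> bool" where
  "FH_module V \<longleftrightarrow>
     V \<subseteq> perm_space points \<and> vec.subspace V \<and> (\<forall>h\<in>H. \<forall>v\<in>V. module_act v h \<in> V)"

definition FH_trivial :: "('f::field, 'k::{field,finite}) pvec set \<Rightarrow> bool" where
  "FH_trivial V \<longleftrightarrow> FH_module V \<and> vec.dim V = 1 \<and> (\<forall>h\<in>H. \<forall>v\<in>V. module_act v h = v)"

definition FH_simple :: "('f::field, 'k::{field,finite}) pvec set \<Rightarrow> bool" where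
  "FH_simple V \<longleftrightarrow>
     FH_module V \<and> V \<noteq> {0} \<and> (\<forall>W. FH_module W \<and> W \<subseteq> V \<longrightarrow> W = {0} \<or> W = V)"

definition FH_isomorphic ::
  "('f::field, 'k::{field,finite}) pvec set \<Rightarrow> ('f, 'k) pvec set \<Rightarrow> bool" where
  "FH_isomorphic V W \<longleftrightarrow>
     (\<exists>f. bij_betw f V W \<and>
          (\<forall>u\<in>V. \<forall>v\<in>V. f (u + v) = f u + f v) \<and>
          (\<forall>c. \<forall>v\<in>V. f (c *s v) = c *s f v) \<and>
          (\<forall>h\<in>H. \<forall>v\<in>V. f (module_act v h) = module_act (f v) h))"

text \<open>Internal direct sum of submodules \<open>U\<^sub>1, \<dots>, U\<^sub>n\<close>: every element of \<open>V\<close> is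
  \<open>u\<^sub>1 + \<dots> + u\<^sub>n\<close> for exactly one \<open>(u\<^sub>1, \<dots>, u\<^sub>n) \<in> U\<^sub>1 \<times> \<dots> \<times> U\<^sub>n\<close>.\<close>

definition FH_direct_sum ::
  "('f::field, 'k::{field,finite}) pvec set \<Rightarrow> ('f, 'k) pvec set list \<Rightarrow> bool" where
  "FH_direct_sum V Us \<longleftrightarrow>
     FH_module V \<and> (\<forall>U\<in>set Us. FH_module U) \<and> bij_betw sum_list (listset Us) V"

end

theory Submission
  imports Defs
begin

text \<open>
  A pair of points that are not on the conic has, up to the group, one invariant
  \<open>rr P Q = bf\<^sup>2 / (4 qf qf)\<close>: \<open>\<phi>\<^sub>B\<close> has the matrix \<open>[rr = 0]\<close> and \<open>\<phi>\<^sub>D\<close> the matrix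
  \<open>[rr - 1 is a square]\<close>. A character \<open>\<theta>\<close> of the group of norm-one elements \<open>a + e \<surd>(-nu)\<close>
  that is trivial at \<open>-1\<close> gives a matrix \<open>K\<^sub>\<theta>\<close> on the external points: at \<open>rr = a\<^sup>2\<close> it is the
  sum of the \<open>\<theta> (a, e)\<close>, and at non-squares it is \<open>0\<close>. The simple modules are the column
  spaces \<open>M\<^sub>\<theta>\<close> of \<open>K\<^sub>\<theta>\<close>, one for each pair \<open>\<theta>, \<theta>\<^sup>-\<^sup>1\<close> with \<open>\<theta> \<noteq> 1\<close>.

  In characteristic two, a sum over all intermediate points can be restricted to the fixed points
  of a reflection that fixes both end points. This evaluates the matrix products
  \<open>K\<^sub>\<theta> B = B\<^sub>\<theta>\<close>, \<open>K\<^sub>\<eta> B\<^sub>\<theta> = \<delta> B\<^sub>\<theta>\<close> and \<open>K\<^sub>\<theta> D = 0\<close>; moreover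
  \<open>\<Sum> B\<^sub>\<theta> = B + D\<close>, up to the all-one matrix if \<open>q\<close> is \<open>3\<close> modulo \<open>4\<close>. So the \<open>K\<^sub>\<theta>\<close> are
  orthogonal projections of the image of \<open>\<phi>\<^sub>B\<close> onto the \<open>M\<^sub>\<theta>\<close>, and the remaining part is the image
  of \<open>\<phi>\<^sub>D\<close>, plus the constants if \<open>q\<close> is \<open>3\<close> modulo \<open>4\<close>.

  The columns of \<open>K\<^sub>\<theta>\<close> at all external points are expressed by those at the points \<open>(0, 1, 2 b)\<close>
  of a tangent, up to vectors that the unipotent group fixes; this gives the dimensions. For a
  nontrivial character of the unipotent group the eigenspace in \<open>M\<^sub>\<theta>\<close> is therefore a line. The
  diagonal elements permute these lines in two orbits, which the element \<open>(0, 1; -1, 0)\<close> of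
  \<open>SL(2, q)\<close> connects; hence \<open>M\<^sub>\<theta>\<close> is simple.
\<close>

text \<open>The order of \<open>H\<close> is even, so in characteristic two there is no averaging
  over \<open>H\<close> and no complement comes for free: the projections have to be written down as
  matrices. Groups of odd order replace the averaging in two places. The unipotent group has order
  q, so \<open>psi\<close> separates its eigenspaces; and \<open>card Lam = 2 * n\<close> with n
  odd, so characters are orthogonal on the subgroup of order n.

  \<open>Lam\<close> treats both congruence classes at once: \<open>-nu\<close> is a square exactly
  if q is 3 modulo 4, so \<open>Lam\<close> has order q + 1 or q - 1, and its (n - 1) / 2 pairs of
  nontrivial characters give the (q - 1) / 4 or (q - 3) / 4 summands. In the second case the norm
  form has isotropic vectors, which raise the dimension from q - 1 to q + 1.

  All matrices are invariant under GL(2, q), and the reflections in the sums need this larger group.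
  A submodule is only known to be stable under \<open>H\<close>; simplicity therefore takes an extra
  step, a comparison with the twist by a diagonal element of non-square determinant.\<close>

section \<open>Sums and involutions in characteristic two\<close>

lemma char2_double:
  assumes "(1::'f::comm_ring_1) + 1 = 0"
  shows "x + x = (0::'f)"
  by (metis assms distrib_right mult_1 mult_zero_left)

lemma char2_diff:
  assumes "(1::'f::comm_ring_1) + 1 = 0"
  shows "x - y = x + (y::'f)"
  using char2_double[OF assms, of y] by (simp add: diff_eq_eq add.assoc)

lemma char2_of_nat:
  assumes "(1::'f::comm_ring_1) + 1 = 0"
  shows "(of_nat n :: 'f) = (if even n then 0 else 1)"
  using char2_double[OF assms] assms
  by (induction n) (auto simp: add.commute)

lemma char2_eq_iff_add:
  assumes "(1::'f::comm_ring_1) + 1 = 0"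
  shows "x = y \<longleftrightarrow> x + y = (0::'f)"
  using char2_diff[OF assms, of x y] by (metis eq_iff_diff_eq_0)

text \<open>The elements that \<open>i\<close> moves form pairs on which \<open>F\<close> is
  constant, and each pair adds up to zero. The induction removes one such pair at a time.\<close>

lemma sum_involution:
  fixes F :: "'a \<Rightarrow> 'f::comm_ring_1"
  assumes two: "(1::'f) + 1 = 0" and "finite S"
    and "\<And>x. x \<in> S \<Longrightarrow> i x \<in> S" "\<And>x. x \<in> S \<Longrightarrow> i (i x) = x" "\<And>x. x \<in> S \<Longrightarrow> F (i x) = F x"
  shows "sum F S = sum F {x \<in> S. i x = x}"
  using assms(2-)
proof (induction "card S" arbitrary: S rule: less_induct)
  case less
  show ?case
  proof (cases "\<exists>x\<in>S. i x \<noteq> x")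
    case False
    then have "{x \<in> S. i x = x} = S" by auto
    then show ?thesis by simp
  next
    case True
    then obtain x where x: "x \<in> S" "i x \<noteq> x" by auto
    let ?T = "S - {x, i x}"
    have ix: "i x \<in> S" using x less by auto
    have T: "finite ?T" using less.prems(1) by simp
    have "?T \<subset> S" using x(1) by blast
    then have T2: "card ?T < card S" using less.prems(1) by (rule psubset_card_mono[rotated])
    have "sum F ?T = sum F {y \<in> ?T. i y = y}"
    proof (rule less.hyps[OF T2 T])
      fix y assume y: "y \<in> ?T"
      then show "i y \<in> ?T" using less.prems(2,3) x by (metis Diff_iff empty_iff insert_iff)
      show "i (i y) = y" "F (i y) = F y" using y less.prems by auto
    qed
    also have "{y \<in> ?T. i y = y} = {y \<in> S. i y = y}" using x less.prems(3) by auto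
    finally have 1: "sum F ?T = sum F {y \<in> S. i y = y}" .
    have "sum F S = F x + sum F (S - {x})"
      using x(1) less.prems(1) by (rule sum.remove[rotated])
    also have "sum F (S - {x}) = F (i x) + sum F (S - {x} - {i x})"
      by (rule sum.remove) (use x ix less.prems(1) in auto)
    also have "S - {x} - {i x} = ?T" by auto
    also have "F x + (F (i x) + sum F ?T) = sum F ?T"
      using less.prems(4)[OF x(1)] char2_double[OF two, of "F x"] by (simp flip: add.assoc)
    finally show ?thesis using 1 by simp
  qed
qed

text \<open>The field \<open>bit\<close> has characteristic two, and a sum of ones in it is the
  parity of a cardinality.\<close>

lemma even_card_involution:
  assumes "finite S" "\<And>x. x \<in> S \<Longrightarrow> i x \<in> S" "\<And>x. x \<in> S \<Longrightarrow> i (i x) = x"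
  shows "even (card S) \<longleftrightarrow> even (card {x \<in> S. i x = x})"
proof -
  have "(\<Sum>x\<in>S. 1::bit) = (\<Sum>x\<in>{x \<in> S. i x = x}. 1)"
    by (rule sum_involution) (use assms in auto)
  then have "(of_nat (card S) :: bit) = of_nat (card {x \<in> S. i x = x})"
    unfolding sum_constant by (simp only: mult_1_right)
  then show ?thesis
    using char2_of_nat[where 'f = bit, of "card S"]
      char2_of_nat[where 'f = bit, of "card {x \<in> S. i x = x}"] by (auto split: if_splits)
qed

text \<open>If 2 were 0, translation by 1 would be an involution of the field without fixed
  points.\<close>

lemma odd_card_two_neq_0:
  assumes "odd CARD('k::{field,finite})"
  shows "(2::'k) \<noteq> 0"
proof
  assume "(2::'k) = 0"
  then have two: "(1::'k) + 1 = 0" by simp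
  have "even (card (UNIV :: 'k set)) \<longleftrightarrow> even (card {x \<in> (UNIV::'k set). x + 1 = x})"
    by (rule even_card_involution) (use two in \<open>auto simp: add.assoc\<close>)
  then show False using assms by simp
qed

subsection \<open>Squares in a finite field of odd order\<close>

definition is_sq :: "'k::field \<Rightarrow> bool" where
  "is_sq x \<longleftrightarrow> (\<exists>c. x = c^2)"

lemma is_sq_0 [simp]: "is_sq 0" and is_sq_1 [simp]: "is_sq 1" and is_sq_power2 [simp]: "is_sq (x^2)"
  unfolding is_sq_def by (rule exI[of _ 0], simp, rule exI[of _ 1], simp, blast)

lemma is_sq_mult: "is_sq x \<Longrightarrow> is_sq y \<Longrightarrow> is_sq (x * y)"
  unfolding is_sq_def by (metis power_mult_distrib)

lemma is_sq_mult_iff: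
  assumes "is_sq x" "x \<noteq> 0"
  shows "is_sq (x * y) \<longleftrightarrow> is_sq y"
proof
  assume "is_sq (x * y)"
  with assms obtain c d where cd: "x = c^2" "x * y = d^2" by (auto simp: is_sq_def)
  then have "y = (d / c)^2" using assms by (simp add: power_divide field_simps)
  then show "is_sq y" unfolding is_sq_def by blast
qed (use assms is_sq_mult in auto)

lemma is_sq_power2_mult_iff [simp]:
  assumes "c \<noteq> 0"
  shows "is_sq (c^2 * x) \<longleftrightarrow> is_sq x"
  using is_sq_mult_iff[of "c^2" x] assms by simp

lemma is_sq_inverse [simp]: "is_sq (inverse x) \<longleftrightarrow> is_sq x"
  unfolding is_sq_def by (metis inverse_inverse_eq power_inverse)

lemma is_sq_divide: "is_sq (x / y) \<longleftrightarrow> is_sq (x * y)" for x y :: "'k::field"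
proof (cases "y = 0")
  case False
  have "x * y = y^2 * (x / y)" using False by (simp add: power2_eq_square)
  then show ?thesis using False is_sq_power2_mult_iff[of y "x / y"] by argo
qed simp

context
  assumes odd: "odd CARD('k::{field,finite})"
begin

lemma card_sq_nonzero: "2 * card {x::'k. is_sq x \<and> x \<noteq> 0} = CARD('k) - 1"
proof -
  have two: "(2::'k) \<noteq> 0" by (rule odd_card_two_neq_0[OF odd])
  have neg: "x \<noteq> - x" if "x \<noteq> 0" for x :: 'k using that two by (metis add_eq_0_iff mult_2 mult_eq_0_iff)
  let ?S = "{x::'k. is_sq x \<and> x \<noteq> 0}"
  have U: "(\<Union>y\<in>?S. {x. x^2 = y}) = UNIV - {0::'k}" by auto
  have "card (\<Union>y\<in>?S. {x. x^2 = y}) = (\<Sum>y\<in>?S. card {x. x^2 = y})"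
    by (rule card_UN_disjoint) auto
  also have "\<dots> = (\<Sum>y\<in>?S. 2)"
  proof (rule sum.cong[OF refl])
    fix y assume "y \<in> ?S"
    then obtain c where c: "y = c^2" "c \<noteq> 0" by (auto simp: is_sq_def)
    then have "{x. x^2 = y} = {c, - c}" by (auto simp: power2_eq_iff)
    then show "card {x. x^2 = y} = 2" using neg[OF c(2)] by simp
  qed
  finally show ?thesis unfolding U by (simp add: card_Diff_singleton)
qed

lemma card_nonsq: "2 * card {x::'k. \<not> is_sq x} = CARD('k) - 1"
proof -
  let ?S = "{x::'k. is_sq x \<and> x \<noteq> 0}" and ?N = "{x::'k. \<not> is_sq x}"
  have "card (?S \<union> ?N) = card ?S + card ?N" by (rule card_Un_disjoint) auto
  moreover have "?S \<union> ?N = UNIV - {0}" by auto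
  ultimately show ?thesis using card_sq_nonzero by (simp add: card_Diff_singleton)
qed

text \<open>Multiplication by the non-square \<open>x\<close> maps the nonzero squares into the
  non-squares. Both sets have the same size, so it is onto, and \<open>y = x * z\<close> for a
  square \<open>z\<close>.\<close>

lemma nonsq_mult_nonsq:
  assumes "\<not> is_sq x" "\<not> is_sq (y::'k)"
  shows "is_sq (x * y)"
proof -
  let ?S = "{x::'k. is_sq x \<and> x \<noteq> 0}" and ?N = "{x::'k. \<not> is_sq x}"
  have x: "x \<noteq> 0" using assms by auto
  have "(*) x ` ?S \<subseteq> ?N"
    using assms(1) is_sq_mult_iff[of _ x] by (auto simp: mult.commute)
  moreover have "card ((*) x ` ?S) = card ?N"
    using card_sq_nonzero card_nonsq x by (subst card_image) (auto simp: inj_on_def)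
  ultimately have "(*) x ` ?S = ?N" by (intro card_subset_eq) auto
  then obtain z where "y = x * z" "is_sq z" using assms(2) by blast
  then have "x * y = x^2 * z" by (simp add: power2_eq_square)
  then show ?thesis using \<open>is_sq z\<close> x by simp
qed

lemma nonsq_mult_iff:
  assumes "\<not> is_sq x"
  shows "is_sq (x * y) \<longleftrightarrow> y = 0 \<or> \<not> is_sq (y::'k)"
  using nonsq_mult_nonsq[OF assms] is_sq_mult_iff[of y x] assms mult.commute[of y x] by auto

lemma ex_nonsq: "\<exists>x::'k. \<not> is_sq x"
proof -
  have "CARD('k) \<ge> 2" using card_mono[of UNIV "{0::'k, 1}"] by simp
  then have "2 * card {x::'k. \<not> is_sq x} \<noteq> 0" using odd unfolding card_nonsq by simp
  then have "{x::'k. \<not> is_sq x} \<noteq> {}" by force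
  then show ?thesis by blast
qed

text \<open>Inversion pairs off the nonzero squares except for 1 and, if it is a square, -1. So -1
  is a square exactly if the number (q - 1) / 2 of nonzero squares is even.\<close>

lemma is_sq_neg_1: "is_sq (-1::'k) \<longleftrightarrow> CARD('k) mod 4 = 1"
proof -
  have two: "(2::'k) \<noteq> 0" by (rule odd_card_two_neq_0[OF odd])
  then have n1: "(-1::'k) \<noteq> 1" by (metis add.inverse_inverse add_eq_0_iff one_add_one)
  let ?S = "{x::'k. is_sq x \<and> x \<noteq> 0}"
  have "even (card ?S) \<longleftrightarrow> even (card {x \<in> ?S. inverse x = x})"
    by (rule even_card_involution) auto
  also have "{x \<in> ?S. inverse x = x} = (if is_sq (-1::'k) then {1, -1} else {1})"
  proof -
    have "inverse x = x \<longleftrightarrow> x = 1 \<or> x = -1" if "x \<noteq> 0" for x :: 'k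
    proof -
      have "inverse x = x \<longleftrightarrow> x * x = 1"
      proof
        assume "x * x = 1" then show "inverse x = x" by (rule inverse_unique)
      next
        assume "inverse x = x" then show "x * x = 1" using right_inverse[OF that] by simp
      qed
      also have "\<dots> \<longleftrightarrow> x^2 = 1^2" by (simp add: power2_eq_square)
      finally have "inverse x = x \<longleftrightarrow> x^2 = 1^2" .
      then show ?thesis by (simp only: power2_eq_iff)
    qed
    then have "{x \<in> ?S. inverse x = x} = {x. is_sq x \<and> (x = 1 \<or> x = - 1)}"
      using zero_neq_one by (metis (lifting) Collect_cong add.inverse_neutral neg_equal_iff_equal mem_Collect_eq)
    also have "\<dots> = (if is_sq (-1::'k) then {1, -1} else {1})" by auto
    finally show ?thesis .
  qed
  also have "even (card \<dots>) \<longleftrightarrow> is_sq (-1::'k)" using n1 n1[symmetric] by auto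
  finally have "even (card ?S) \<longleftrightarrow> is_sq (-1::'k)" .
  moreover have "even c \<longleftrightarrow> n mod 4 = 1" if "2 * c = n - 1" "odd n" for c n :: nat
    using that by presburger
  ultimately show ?thesis using card_sq_nonzero odd by metis
qed

end

subsection \<open>The quadratic form of the conic\<close>

definition qf :: "'k::field ^ 3 \<Rightarrow> 'k" where
  "qf v = (v$2)^2 - v$1 * v$3"

definition bf :: "'k::field ^ 3 \<Rightarrow> 'k ^ 3 \<Rightarrow> 'k" where
  "bf v w = 2 * v$2 * w$2 - v$1 * w$3 - v$3 * w$1"

text \<open>The discriminant of \<open>span {v, w}\<close> is \<open>4 qf v qf w (rv v w - 1)\<close>; being invariant under
  scaling of \<open>v\<close> and \<open>w\<close>, \<open>rv\<close> descends to points.\<close>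

definition rv :: "'k::field ^ 3 \<Rightarrow> 'k ^ 3 \<Rightarrow> 'k" where
  "rv v w = (bf v w)^2 / (4 * qf v * qf w)"

lemma proj_mem: "v \<in> proj v" for v :: "'k::field ^ 3"
  unfolding proj_def by (rule vec.span_base) simp

lemma proj_eq: "proj v = {c *s v | c. True}" for v :: "'k::field ^ 3"
  unfolding proj_def vec.span_singleton by auto

lemma proj_scale [simp]: "c \<noteq> 0 \<Longrightarrow> proj (c *s v) = proj v" for v :: "'k::field ^ 3"
  unfolding proj_eq
proof (intro set_eqI iffI)
  fix x assume c: "c \<noteq> 0" "x \<in> {d *s v | d. True}"
  then obtain d where "x = d *s v" by auto
  then have "x = (d / c) *s (c *s v)" using c by (simp add: vector_smult_assoc)
  then show "x \<in> {d *s (c *s v) | d. True}" by blast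
qed (auto simp: vector_smult_assoc)

lemma proj_eqD:
  fixes v w :: "'k::field ^ 3"
  assumes "proj v = proj w" "v \<noteq> 0"
  obtains c where "c \<noteq> 0" "v = c *s w"
proof -
  have "v \<in> proj w" using proj_mem[of v] assms by simp
  then obtain c where "v = c *s w" by (auto simp: proj_eq)
  moreover have "c \<noteq> 0" using assms calculation by auto
  ultimately show ?thesis using that by blast
qed

definition rep :: "'k::field point \<Rightarrow> 'k ^ 3" where
  "rep P = (SOME v. v \<noteq> 0 \<and> P = proj v)"

definition rr :: "'k::field point \<Rightarrow> 'k point \<Rightarrow> 'k" where
  "rr P Q = rv (rep P) (rep Q)"

lemma rep_proj:
  fixes v :: "'k::field ^ 3"
  assumes "v \<noteq> 0"
  obtains c where "c \<noteq> 0" "rep (proj v) = c *s v"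
proof -
  have "rep (proj v) \<noteq> 0 \<and> proj v = proj (rep (proj v))"
    unfolding rep_def by (rule someI[of _ v]) (use assms in simp)
  then show ?thesis using proj_eqD[of "rep (proj v)" v] that by metis
qed

lemma qf_0 [simp]: "qf 0 = 0"
  by (simp add: qf_def)

lemma qf_scale: "qf (c *s v) = c^2 * qf v"
  by (simp add: qf_def power2_eq_square algebra_simps)

lemma bf_scale: "bf (c *s v) (d *s w) = c * d * bf v w"
  by (simp add: bf_def algebra_simps)

lemma rv_scale: "c \<noteq> 0 \<Longrightarrow> d \<noteq> 0 \<Longrightarrow> rv (c *s v) (d *s w) = rv v w"
proof -
  assume "c \<noteq> 0" "d \<noteq> 0"
  moreover have "(bf (c *s v) (d *s w))^2 = (c * d)^2 * (bf v w)^2"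
    by (simp add: bf_scale power_mult_distrib)
  moreover have "4 * qf (c *s v) * qf (d *s w) = (c * d)^2 * (4 * qf v * qf w)"
    by (simp add: qf_scale power_mult_distrib algebra_simps)
  ultimately show ?thesis unfolding rv_def by (metis mult_divide_mult_cancel_left mult_eq_0_iff power_not_zero)
qed

lemma rr_proj [simp]: "v \<noteq> 0 \<Longrightarrow> w \<noteq> 0 \<Longrightarrow> rr (proj v) (proj w) = rv v w"
  unfolding rr_def by (metis rep_proj rv_scale)

lemma bf_commute: "bf v w = bf w v"
  by (simp add: bf_def algebra_simps)

lemma rr_commute: "rr P Q = rr Q P"
  by (simp add: rr_def rv_def bf_commute[of "rep P"] mult_ac)

lemma qf_conic:
  fixes v :: "'k::field ^ 3"
  assumes "v \<noteq> 0" "proj v \<in> conic"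
  shows "qf v = 0"
proof -
  have "qf (vector [1, t, t^2]) = 0" "qf (vector [0, 0, 1]) = 0" for t :: 'k
    by (simp_all add: qf_def vector_3)
  with assms(2) have "\<exists>w. proj v = proj w \<and> qf w = 0"
    unfolding conic_def by blast
  then obtain w where "proj v = proj w" "qf w = 0" by blast
  then show ?thesis using proj_eqD[OF _ assms(1)] qf_scale by (metis mult_zero_right)
qed

lemma external_points_eq: "external_points = {proj v | v. qf v \<noteq> 0 \<and> is_sq (qf v)}"
proof -
  have eq: "v \<noteq> 0 \<and> proj v \<notin> conic \<and> (\<exists>c. c \<noteq> 0 \<and> c^2 = (v$2)^2 - v$1 * v$3) \<longleftrightarrow> qf v \<noteq> 0 \<and> is_sq (qf v)"
    for v :: "'k::field ^ 3"
  proof -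
    have eq: "v \<noteq> 0 \<and> proj v \<notin> conic" if "qf v \<noteq> 0" using that qf_conic[of v] qf_0 by metis
    moreover have "(\<exists>c. c \<noteq> 0 \<and> c^2 = qf v) \<longleftrightarrow> qf v \<noteq> 0 \<and> is_sq (qf v)"
      unfolding is_sq_def by (metis power2_eq_iff zero_power2 power_zero_numeral zero_eq_power2)
    ultimately show ?thesis unfolding qf_def by blast
  qed
  show ?thesis unfolding external_points_def by (simp only: eq)
qed

lemma internal_points_eq: "internal_points = {proj v | v. \<not> is_sq (qf v)}"
proof -
  have eq: "v \<noteq> 0 \<and> proj v \<notin> conic \<and> (\<nexists>c. c^2 = (v$2)^2 - v$1 * v$3) \<longleftrightarrow> \<not> is_sq (qf v)"
    for v :: "'k::field ^ 3"
  proof -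
    have eq: "v \<noteq> 0 \<and> proj v \<notin> conic" if "qf v \<noteq> 0" using that qf_conic[of v] qf_0 by metis
    moreover have "(\<nexists>c. c^2 = qf v) \<longleftrightarrow> \<not> is_sq (qf v)" unfolding is_sq_def by metis
    moreover have "qf v \<noteq> 0" if "\<not> is_sq (qf v)" using that by auto
    ultimately show ?thesis unfolding qf_def by blast
  qed
  show ?thesis unfolding internal_points_def by (simp only: eq)
qed

lemma external_proj_iff [simp]: "proj v \<in> external_points \<longleftrightarrow> qf v \<noteq> 0 \<and> is_sq (qf v)"
proof
  assume "proj v \<in> external_points"
  then obtain w where w: "proj v = proj w" "qf w \<noteq> 0" "is_sq (qf w)" by (auto simp: external_points_eq)
  then have "w \<noteq> 0" by (auto simp: qf_def)
  with w(1) obtain c where "c \<noteq> 0" "w = c *s v" using proj_eqD by metis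
  then show "qf v \<noteq> 0 \<and> is_sq (qf v)" using w by (auto simp: qf_scale)
qed (auto simp: external_points_eq)

lemma internal_proj_iff [simp]: "proj v \<in> internal_points \<longleftrightarrow> \<not> is_sq (qf v)"
proof
  assume "proj v \<in> internal_points"
  then obtain w where w: "proj v = proj w" "\<not> is_sq (qf w)" by (auto simp: internal_points_eq)
  then have "w \<noteq> 0" by (auto simp: qf_def)
  with w(1) obtain c where "c \<noteq> 0" "w = c *s v" using proj_eqD by metis
  then show "\<not> is_sq (qf v)" using w by (auto simp: qf_scale)
qed (auto simp: internal_points_eq)

lemma points_proj_iff [simp]: "proj v \<in> points \<longleftrightarrow> v \<noteq> 0" for v :: "'k::field ^ 3"
proof
  assume "proj v \<in> points"
  then obtain w :: "'k ^ 3" where w: "proj v = proj w" "w \<noteq> 0" by (auto simp: points_def)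
  then have "w \<in> proj v" using proj_mem by simp
  then show "v \<noteq> 0" using w by (auto simp: proj_eq)
qed (auto simp: points_def)

lemma external_subset: "external_points \<subseteq> points"
  by (auto simp: external_points_def points_def)

lemma internal_subset: "internal_points \<subseteq> points"
  by (auto simp: internal_points_def points_def)

subsection \<open>Perpendicularity and passants in terms of the invariant\<close>

lemma line_proj: "line (proj b) = {P \<in> points. \<forall>a\<in>P. a$1 * b$1 + a$2 * b$2 + a$3 * b$3 = 0}"
  for b :: "'k::field ^ 3"
proof -
  have "a$1 * (c * b$1) + a$2 * (c * b$2) + a$3 * (c * b$3) = c * (a$1 * b$1 + a$2 * b$2 + a$3 * b$3)"
    for a b :: "'k ^ 3" and c by (simp add: algebra_simps)
  then have "(\<forall>b'\<in>proj b. a$1 * b'$1 + a$2 * b'$2 + a$3 * b'$3 = 0) \<longleftrightarrow>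
      a$1 * b$1 + a$2 * b$2 + a$3 * b$3 = 0" for a :: "'k ^ 3"
    using proj_mem[of b] by (auto simp: proj_eq)
  then show ?thesis unfolding line_def by simp
qed

lemma proj_in_line [simp]:
  "v \<noteq> 0 \<Longrightarrow> proj v \<in> line (proj b) \<longleftrightarrow> v$1 * b$1 + v$2 * b$2 + v$3 * b$3 = 0"
  for b :: "'k::field ^ 3"
proof -
  have "(c * a$1) * b$1 + (c * a$2) * b$2 + (c * a$3) * b$3 = c * (a$1 * b$1 + a$2 * b$2 + a$3 * b$3)"
    for a b :: "'k ^ 3" and c by (simp add: algebra_simps)
  then have "(\<forall>a\<in>proj v. a$1 * b$1 + a$2 * b$2 + a$3 * b$3 = 0) \<longleftrightarrow> v$1 * b$1 + v$2 * b$2 + v$3 * b$3 = 0"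
    using proj_mem[of v] by (auto simp: proj_eq)
  then show "v \<noteq> 0 \<Longrightarrow> ?thesis" by (simp add: line_proj)
qed

lemma perp_proj: "perp (proj v) = line (proj (vector [v$3, - 2 * v$2, v$1]))" for v :: "'k::field ^ 3"
proof -
  have "(\<lambda>v. vector [v$3, - 2 * v$2, v$1]) ` proj v = proj (vector [v$3, - 2 * v$2, v$1] :: 'k ^ 3)"
  proof -
    have "(\<lambda>v. vector [v$3, - 2 * v$2, v$1]) (c *s v) = c *s (vector [v$3, - 2 * v$2, v$1] :: 'k ^ 3)" for c
      by (simp add: vec_eq_iff forall_3 vector_3)
    moreover have "proj w = range (\<lambda>c. c *s w)" for w :: "'k ^ 3" by (auto simp: proj_eq)
    ultimately show ?thesis by (simp add: image_image)
  qed
  then show ?thesis by (simp add: perp_def)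
qed

lemma proj_in_perp: "v \<noteq> 0 \<Longrightarrow> proj v \<in> perp (proj w) \<longleftrightarrow> bf v w = 0" for w :: "'k::field ^ 3"
proof -
  have "v$1 * w$3 + v$2 * (- 2 * w$2) + v$3 * w$1 = - bf v w"
    by (simp add: bf_def algebra_simps)
  then show "v \<noteq> 0 \<Longrightarrow> ?thesis" unfolding perp_proj by (simp add: vector_3)
qed

definition cross :: "'k::field ^ 3 \<Rightarrow> 'k ^ 3 \<Rightarrow> 'k ^ 3" where
  "cross v w = vector [v$2 * w$3 - v$3 * w$2, v$3 * w$1 - v$1 * w$3, v$1 * w$2 - v$2 * w$1]"

lemma odd_card_four_neq_0:
  assumes "odd CARD('k::{field,finite})"
  shows "(4::'k) \<noteq> 0"
proof -
  have "(4::'k) = 2 * 2" by simp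
  then show ?thesis using odd_card_two_neq_0[OF assms] by (metis mult_eq_0_iff)
qed

text \<open>The left side is the form of the dual conic, which tells secants from passants; the
  right side is minus the Gram determinant of the two points. This makes the type of a joining line
  computable from its points.\<close>

lemma discr_cross:
  "((cross v w)$2)^2 - 4 * (cross v w)$1 * (cross v w)$3 = (bf v w)^2 - 4 * qf v * qf w"
  by (simp add: cross_def vector_3 bf_def qf_def power2_eq_square algebra_simps)

text \<open>The point with parameter \<open>t\<close> lies on the line if \<open>t\<close> is a root
  of the quadratic with coefficients \<open>b$3\<close>, \<open>b$2\<close>, \<open>b$1\<close>, and
  the expression is its discriminant. If \<open>b$3 = 0\<close>, the line contains (0, 0, 1) and the
  discriminant is a square.\<close>

lemma line_conic_empty_iff:
  assumes odd: "odd CARD('k::{field,finite})" and b: "b \<noteq> (0::'k ^ 3)"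
  shows "line (proj b) \<inter> conic = {} \<longleftrightarrow> \<not> is_sq ((b$2)^2 - 4 * b$1 * b$3)"
proof -
  have two: "(2::'k) \<noteq> 0" by (rule odd_card_two_neq_0[OF odd])
  have n0: "vector [1, t, t^2] \<noteq> (0 :: 'k ^ 3)" "vector [0, 0, 1] \<noteq> (0 :: 'k ^ 3)" for t
    by (auto simp: vec_eq_iff forall_3)
  have "line (proj b) \<inter> conic = {} \<longleftrightarrow> b$3 \<noteq> 0 \<and> (\<forall>t. b$1 + t * b$2 + t^2 * b$3 \<noteq> 0)"
  proof -
    have "line (proj b) \<inter> conic = {} \<longleftrightarrow> (\<forall>t. proj (vector [1, t, t^2]) \<notin> line (proj b)) \<and> proj (vector [0, 0, 1]) \<notin> line (proj b)"
      unfolding conic_def by blast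
    also have "\<dots> \<longleftrightarrow> (\<forall>t. b$1 + t * b$2 + t^2 * b$3 \<noteq> 0) \<and> b$3 \<noteq> 0"
      using n0 by (simp add: vector_3)
    finally show ?thesis by blast
  qed
  also have "\<dots> \<longleftrightarrow> \<not> is_sq ((b$2)^2 - 4 * b$1 * b$3)"
  proof (cases "b$3 = 0")
    case False
    have id: "4 * b$3 * (b$1 + t * b$2 + t^2 * b$3) = (2 * b$3 * t + b$2)^2 - ((b$2)^2 - 4 * b$1 * b$3)" for t
      by (simp add: power2_eq_square algebra_simps)
    have four: "(4::'k) \<noteq> 0" using odd_card_four_neq_0[OF odd] .
    have eq: "b$1 + t * b$2 + t^2 * b$3 = 0 \<longleftrightarrow> (b$2)^2 - 4 * b$1 * b$3 = (2 * b$3 * t + b$2)^2" for t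
      using id[of t] False four by (metis eq_iff_diff_eq_0 mult_eq_0_iff)
    have "(\<exists>t. (b$2)^2 - 4 * b$1 * b$3 = (2 * b$3 * t + b$2)^2) \<longleftrightarrow> is_sq ((b$2)^2 - 4 * b$1 * b$3)"
    proof
      assume "is_sq ((b$2)^2 - 4 * b$1 * b$3)"
      then obtain c where c: "(b$2)^2 - 4 * b$1 * b$3 = c^2" by (auto simp: is_sq_def)
      have "2 * b$3 * ((c - b$2) / (2 * b$3)) + b$2 = c" using False two by simp
      then show "\<exists>t. (b$2)^2 - 4 * b$1 * b$3 = (2 * b$3 * t + b$2)^2" using c by metis
    qed (auto simp: is_sq_def)
    then show ?thesis using eq False by auto
  qed auto
  finally show ?thesis .
qed

lemma cross_self_orth: "v$1 * (cross v w)$1 + v$2 * (cross v w)$2 + v$3 * (cross v w)$3 = 0"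
  "w$1 * (cross v w)$1 + w$2 * (cross v w)$2 + w$3 * (cross v w)$3 = 0"
  by (simp_all add: cross_def vector_3 algebra_simps)

lemma orth_imp_cross:
  fixes b v w :: "'k::field ^ 3"
  assumes "cross v w \<noteq> 0" "b \<noteq> 0"
    and 1: "v$1 * b$1 + v$2 * b$2 + v$3 * b$3 = 0" and 2: "w$1 * b$1 + w$2 * b$2 + w$3 * b$3 = 0"
  obtains c where "c \<noteq> 0" "b = c *s cross v w"
proof -
  let ?n = "cross v w"
  have 12: "b$1 * ?n$2 = b$2 * ?n$1" and 13: "b$1 * ?n$3 = b$3 * ?n$1" and 23: "b$2 * ?n$3 = b$3 * ?n$2"
    unfolding cross_def vector_3 using 1 2 by algebra+
  obtain i where i: "?n $ i \<noteq> 0" using assms(1) by (auto simp: vec_eq_iff)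
  have "b $ j * ?n $ i = b $ i * ?n $ j" for j
    using 12 13 23 exhaust_3[of i] exhaust_3[of j] by auto
  then have "b = (b $ i / ?n $ i) *s ?n" using i by (simp add: vec_eq_iff field_simps)
  then show ?thesis using that assms(2) by (metis vector_smult_lzero)
qed

lemma mem_N_PaE_iff:
  fixes v w :: "'k::{field,finite} ^ 3"
  assumes odd: "odd CARD('k)" and v: "qf v \<noteq> 0" "is_sq (qf v)" and w: "\<not> is_sq (qf w)"
  shows "proj v \<in> N_PaE (proj w) \<longleftrightarrow> \<not> is_sq ((bf v w)^2 - 4 * qf v * qf w)"
proof -
  have two: "(2::'k) \<noteq> 0" by (rule odd_card_two_neq_0[OF odd])
  have [simp]: "v \<noteq> 0" "w \<noteq> 0" using v w by (auto simp: qf_def)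
  \<comment> \<open>A non-square cannot equal the square \<open>(bf v w)^2\<close>. So the
    discriminant is nonzero, the two points are distinct, and they have just one joining
    line.\<close>
  have "\<not> is_sq (2^2 * (qf v * qf w))"
    using is_sq_mult_iff[OF v(2) v(1), of "qf w"] w is_sq_power2_mult_iff[OF two, of "qf v * qf w"] by blast
  moreover have "2^2 * (qf v * qf w) = 4 * qf v * qf w" by simp
  ultimately have "(bf v w)^2 - 4 * qf v * qf w \<noteq> 0"
    using is_sq_power2[of "bf v w"] by (metis eq_iff_diff_eq_0)
  then have n: "cross v w \<noteq> 0" using discr_cross[of v w] by auto
  have lines: "l \<in> passant_lines \<longleftrightarrow> (\<exists>b::'k ^ 3. b \<noteq> 0 \<and> l = line (proj b) \<and> \<not> is_sq ((b$2)^2 - 4 * b$1 * b$3))"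
    for l :: "'k point set"
    unfolding passant_lines_def lines_def points_def using line_conic_empty_iff[OF odd] by auto
  have "proj v \<in> N_PaE (proj w) \<longleftrightarrow> (\<exists>b::'k ^ 3. b \<noteq> 0 \<and> \<not> is_sq ((b$2)^2 - 4 * b$1 * b$3) \<and>
      v$1 * b$1 + v$2 * b$2 + v$3 * b$3 = 0 \<and> w$1 * b$1 + w$2 * b$2 + w$3 * b$3 = 0)"
  proof -
    have "proj v \<in> N_PaE (proj w) \<longleftrightarrow> (\<exists>l\<in>passant_lines. proj w \<in> l \<and> proj v \<in> l)"
      unfolding N_PaE_def using v by simp
    also have "\<dots> \<longleftrightarrow> (\<exists>b::'k ^ 3. b \<noteq> 0 \<and> \<not> is_sq ((b$2)^2 - 4 * b$1 * b$3) \<and>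
        proj w \<in> line (proj b) \<and> proj v \<in> line (proj b))"
      unfolding Bex_def lines by blast
    finally show ?thesis by (simp add: conj_commute)
  qed
  also have "\<dots> \<longleftrightarrow> \<not> is_sq (((cross v w)$2)^2 - 4 * (cross v w)$1 * (cross v w)$3)"
  proof (intro iffI; (elim exE conjE)?)
    fix b :: "'k ^ 3"
    assume b: "b \<noteq> 0" "\<not> is_sq ((b$2)^2 - 4 * b$1 * b$3)"
      "v$1 * b$1 + v$2 * b$2 + v$3 * b$3 = 0" "w$1 * b$1 + w$2 * b$2 + w$3 * b$3 = 0"
    obtain c where c: "c \<noteq> 0" "b = c *s cross v w" using orth_imp_cross[OF n b(1,3,4)] .
    have "(b$2)^2 - 4 * b$1 * b$3 = c^2 * (((cross v w)$2)^2 - 4 * (cross v w)$1 * (cross v w)$3)"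
      unfolding c(2) by (simp add: power2_eq_square algebra_simps)
    then show "\<not> is_sq (((cross v w)$2)^2 - 4 * (cross v w)$1 * (cross v w)$3)" using b(2) c(1)
      by (metis is_sq_power2_mult_iff)
  qed (intro exI[of _ "cross v w"] conjI n cross_self_orth)
  finally show ?thesis unfolding discr_cross .
qed

lemma bf_eq_0_iff_rv:
  assumes odd: "odd CARD('k::{field,finite})" and "qf v \<noteq> 0" "qf w \<noteq> (0::'k)"
  shows "bf v w = 0 \<longleftrightarrow> rv v w = 0"
proof -
  have "(4::'k) \<noteq> 0" by (rule odd_card_four_neq_0[OF odd])
  then show ?thesis using assms by (simp add: rv_def)
qed

lemma mem_perp_iff:
  assumes odd: "odd CARD('k::{field,finite})" and "Q \<in> external_points" "P \<in> (internal_points :: 'k point set)"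
  shows "Q \<in> perp P \<longleftrightarrow> rr Q P = 0"
proof -
  obtain v where v: "Q = proj v" "qf v \<noteq> 0" using assms(2) by (auto simp: external_points_eq)
  obtain w where w: "P = proj w" "\<not> is_sq (qf w)" using assms(3) by (auto simp: internal_points_eq)
  then have 1: "qf w \<noteq> 0" by auto
  then have "v \<noteq> 0" "w \<noteq> 0" using v by (auto simp: qf_def)
  then show ?thesis using bf_eq_0_iff_rv[OF odd v(2) 1] v(1) w(1) proj_in_perp[of v w] by simp
qed

text \<open>\<open>rr Q P - 1\<close> is the discriminant divided by the non-square
  \<open>4 * qf v * qf w\<close>, and such a factor exchanges squares and non-squares.\<close>

lemma mem_N_PaE_iff_rr:
  assumes odd: "odd CARD('k::{field,finite})" and "Q \<in> external_points" "P \<in> (internal_points :: 'k point set)"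
  shows "Q \<in> N_PaE P \<longleftrightarrow> is_sq (rr Q P - 1)"
proof -
  obtain v where v: "Q = proj v" "qf v \<noteq> 0" "is_sq (qf v)" using assms(2) by (auto simp: external_points_eq)
  obtain w where w: "P = proj w" "\<not> is_sq (qf w)" using assms(3) by (auto simp: internal_points_eq)
  then have 1: "qf w \<noteq> 0" by auto
  then have [simp]: "v \<noteq> 0" "w \<noteq> 0" using v by (auto simp: qf_def)
  have two: "(2::'k) \<noteq> 0" by (rule odd_card_two_neq_0[OF odd])
  have four: "(4::'k) \<noteq> 0" by (rule odd_card_four_neq_0[OF odd])
  have ns: "\<not> is_sq (2^2 * (qf v * qf w))"
    using is_sq_mult_iff[OF v(3) v(2), of "qf w"] w is_sq_power2_mult_iff[OF two, of "qf v * qf w"] by blast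
  have r: "(bf v w)^2 = 2^2 * (qf v * qf w) * rv v w"
    using v(2) 1 four by (simp add: rv_def)
  then have "(bf v w)^2 - 4 * qf v * qf w = 2^2 * (qf v * qf w) * (rv v w - 1)"
    by (simp add: right_diff_distrib)
  moreover have "rv v w \<noteq> 1" using r ns by (metis is_sq_power2 mult_1_right)
  ultimately have "is_sq ((bf v w)^2 - 4 * qf v * qf w) \<longleftrightarrow> \<not> is_sq (rv v w - 1)"
    using nonsq_mult_iff[OF odd ns, of "rv v w - 1"] by simp
  then show ?thesis using mem_N_PaE_iff[OF odd v(2,3) w(2)] v w by simp
qed

subsection \<open>The action of the group\<close>

definition mat2 :: "'k::zero \<Rightarrow> 'k \<Rightarrow> 'k \<Rightarrow> 'k \<Rightarrow> 'k ^ 2 ^ 2" where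
  "mat2 a b c d = vector [vector [a, b], vector [c, d]]"

lemma mat2_nth [simp]:
  "mat2 a b c d $ 1 $ 1 = a" "mat2 a b c d $ 1 $ 2 = b" "mat2 a b c d $ 2 $ 1 = c" "mat2 a b c d $ 2 $ 2 = d"
  by (simp_all add: mat2_def vector_2)

lemma det_mat2 [simp]: "det (mat2 a b c d) = a * d - b * (c::'k::field)"
  by (simp add: det_2)

lemma tau_nth:
  "(v v* tau A)$1 = v$1 * (A$1$1)^2 + 2 * v$2 * A$1$1 * A$2$1 + v$3 * (A$2$1)^2"
  "(v v* tau A)$2 = v$1 * A$1$1 * A$1$2 + v$2 * (A$1$1 * A$2$2 + A$1$2 * A$2$1) + v$3 * A$2$1 * A$2$2"
  "(v v* tau A)$3 = v$1 * (A$1$2)^2 + 2 * v$2 * A$1$2 * A$2$2 + v$3 * (A$2$2)^2"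
  for v :: "'k::field ^ 3"
  by (simp_all add: tau_def vector_matrix_mult_def sum_3 vector_3 Let_def algebra_simps)

lemma tau_mat2:
  "vector [x, y, z] v* tau (mat2 a b c d) = vector [x * a^2 + 2 * y * a * c + z * c^2,
     x * a * b + y * (a * d + b * c) + z * c * d, x * b^2 + 2 * y * b * d + z * (d::'k::field)^2]"
  by (simp add: vec_eq_iff forall_3 tau_nth vector_3)

lemma tau_mult: "tau A ** tau B = tau (A ** B)" for A B :: "'k::field ^ 2 ^ 2"
  by (simp add: vec_eq_iff forall_3 tau_def matrix_matrix_mult_def sum_2 sum_3 vector_3 Let_def
      power2_eq_square algebra_simps)

lemma tau_1: "tau (mat 1) = (mat 1 :: 'k::field ^ 3 ^ 3)"
  by (simp add: vec_eq_iff forall_3 tau_def mat_def vector_3 Let_def)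

text \<open>\<open>tau A\<close> is the substitution action of \<open>A\<close> on the binary forms
  \<open>x X^2 + 2 y X Y + z Y^2\<close>, and \<open>qf\<close> is a quarter of their discriminant.
  Any nonzero determinant gives a similitude, which is enough for \<open>rr\<close> to be
  invariant.\<close>

lemma qf_tau: "qf (v v* tau A) = (det A)^2 * qf v" for v :: "'k::field ^ 3"
  unfolding qf_def tau_nth det_2 by (simp add: power2_eq_square algebra_simps)

lemma bf_tau: "bf (v v* tau A) (w v* tau A) = (det A)^2 * bf v w" for v :: "'k::field ^ 3"
  unfolding bf_def tau_nth det_2 by (simp add: power2_eq_square algebra_simps)

lemma rv_tau: "det A \<noteq> 0 \<Longrightarrow> rv (v v* tau A) (w v* tau A) = rv v w" for v :: "'k::field ^ 3"
proof -
  assume "det A \<noteq> 0"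
  moreover have "4 * qf (v v* tau A) * qf (w v* tau A) = ((det A)^2)^2 * (4 * qf v * qf w)"
    by (simp add: qf_tau power2_eq_square mult_ac)
  moreover have "(bf (v v* tau A) (w v* tau A))^2 = ((det A)^2)^2 * (bf v w)^2"
    by (simp add: bf_tau power_mult_distrib)
  ultimately show ?thesis unfolding rv_def by (metis mult_divide_mult_cancel_left power_not_zero)
qed

lemma point_act_proj [simp]: "point_act (proj v) h = proj (v v* h)" for v :: "'k::field ^ 3"
proof -
  have "(c *s v) v* h = c *s (v v* h)" for c
    by (simp add: vec_eq_iff vector_matrix_mult_def sum_distrib_left mult_ac)
  moreover have "proj w = range (\<lambda>c. c *s w)" for w :: "'k ^ 3" by (auto simp: proj_eq)
  ultimately show ?thesis by (simp add: point_act_def image_image)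
qed

lemma vector_matrix_mult_tau_assoc: "v v* tau A v* tau B = v v* tau (A ** B)" for v :: "'k::field ^ 3"
  unfolding tau_mult[symmetric] by (simp add: vector_matrix_mul_assoc)

lemma point_act_tau_tau: "point_act (point_act P (tau A)) (tau B) = point_act P (tau (A ** B))"
  for P :: "'k::field point"
  by (simp add: point_act_def image_image vector_matrix_mult_tau_assoc)

lemma point_act_id: "point_act P (mat 1) = P" for P :: "'k::field point"
  by (simp add: point_act_def)

lemma tau_inverse:
  fixes A :: "'k::field ^ 2 ^ 2"
  assumes "det A \<noteq> 0"
  obtains B where "A ** B = mat 1" "B ** A = mat 1" "det B = 1 / det A"
proof -
  have "invertible A" using assms by (simp add: invertible_det_nz)
  then obtain B where B: "A ** B = mat 1" "B ** A = mat 1" by (auto simp: invertible_def)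
  have "det A * det B = 1" using B by (metis det_I det_mul)
  then have "det B = 1 / det A" using assms by (metis nonzero_mult_div_cancel_left)
  then show ?thesis using that B by blast
qed

lemma tau_neq_0: "det A \<noteq> 0 \<Longrightarrow> v \<noteq> 0 \<Longrightarrow> v v* tau A \<noteq> 0" for v :: "'k::field ^ 3"
proof
  assume "det A \<noteq> 0" "v \<noteq> 0" "v v* tau A = 0"
  then obtain B where "A ** B = mat 1" using tau_inverse by blast
  then have "v v* tau A v* tau B = v" by (simp add: vector_matrix_mult_tau_assoc tau_1)
  then show False using \<open>v \<noteq> 0\<close> \<open>v v* tau A = 0\<close> by simp
qed

lemma pointsE:
  assumes "P \<in> (points :: 'k::field point set)"
  obtains v where "v \<noteq> 0" "P = proj v"
  using assms by (auto simp: points_def)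

lemma rr_act [simp]:
  assumes "det A \<noteq> 0" "P \<in> points" "Q \<in> points"
  shows "rr (point_act P (tau A)) (point_act Q (tau A)) = rr P Q"
  using assms by (auto elim!: pointsE simp: tau_neq_0 rv_tau)

lemma point_act_mem [simp]:
  assumes A: "det A \<noteq> 0" and P: "P \<in> (points :: 'k::field point set)"
  shows "point_act P (tau A) \<in> points"
    "point_act P (tau A) \<in> external_points \<longleftrightarrow> P \<in> external_points"
    "point_act P (tau A) \<in> internal_points \<longleftrightarrow> P \<in> internal_points"
  using P A by (auto elim!: pointsE simp: tau_neq_0 qf_tau)

lemma point_act_inverse:
  fixes A :: "'k::field ^ 2 ^ 2"
  assumes "det A \<noteq> 0"
  obtains B where "det B = 1 / det A" "\<And>P. point_act (point_act P (tau A)) (tau B) = P"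
    "\<And>P. point_act (point_act P (tau B)) (tau A) = P"
proof -
  obtain B where "A ** B = mat 1" "B ** A = mat 1" "det B = 1 / det A" using tau_inverse[OF assms] .
  then show ?thesis using that[of B] by (simp add: point_act_tau_tau tau_1 point_act_id)
qed

lemma point_act_inj: "det A \<noteq> 0 \<Longrightarrow> point_act P (tau A) = point_act Q (tau A) \<longleftrightarrow> P = Q"
  for P :: "'k::field point"
  by (metis point_act_inverse)

lemma bij_betw_point_act:
  fixes A :: "'k::field ^ 2 ^ 2"
  assumes "det A \<noteq> 0"
  shows "bij_betw (\<lambda>P. point_act P (tau A)) points points"
    "bij_betw (\<lambda>P. point_act P (tau A)) external_points external_points"
    "bij_betw (\<lambda>P. point_act P (tau A)) internal_points internal_points"
proof -
  obtain B where B: "det B = 1 / det A" "\<And>P. point_act (point_act P (tau A)) (tau B) = P"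
    "\<And>P. point_act (point_act P (tau B)) (tau A) = P" using point_act_inverse[OF assms] by blast
  have B0: "det B \<noteq> 0" using B(1) assms by simp
  show "bij_betw (\<lambda>P. point_act P (tau A)) points points"
    by (rule bij_betwI[where g = "\<lambda>P. point_act P (tau B)"]) (use B(2,3) B0 assms in auto)
  show "bij_betw (\<lambda>P. point_act P (tau A)) external_points external_points"
    by (rule bij_betwI[where g = "\<lambda>P. point_act P (tau B)"])
      (use B(2,3) B0 assms external_subset in auto)
  show "bij_betw (\<lambda>P. point_act P (tau A)) internal_points internal_points"
    by (rule bij_betwI[where g = "\<lambda>P. point_act P (tau B)"])
      (use B(2,3) B0 assms internal_subset in auto)
qed

lemma H_tauE:
  assumes "h \<in> (H :: ('k::field ^ 3 ^ 3) set)"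
  obtains A where "h = tau A" "det A = 1"
  using assms by (auto simp: H_def)

lemma tau_in_H [simp]: "det A = 1 \<Longrightarrow> tau A \<in> H"
  by (auto simp: H_def)

subsection \<open>Permutation modules\<close>

lemma bvec_nth [simp]: "bvec P $ R = (if R = P then 1 else 0)"
  by (auto simp: bvec_def axis_def)

lemma chi_nth [simp]: "chi N $ R = (if R \<in> N then 1 else 0)" for N :: "'k::{field,finite} point set"
  by (simp add: chi_def sum_component)

lemma lin_ext_nth: "lin_ext S g v $ R = (\<Sum>P\<in>S. v $ P * g P $ R)"
  by (simp add: lin_ext_def sum_component)

lemma lin_ext_add: "lin_ext S g (u + v) = lin_ext S g u + lin_ext S g v"
  by (simp add: vec_eq_iff lin_ext_nth distrib_right sum.distrib)

lemma lin_ext_scale: "lin_ext S g (c *s v) = c *s lin_ext S g v"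
  by (simp add: vec_eq_iff lin_ext_nth sum_distrib_left mult_ac)

lemma lin_ext_0 [simp]: "lin_ext S g 0 = 0"
  by (simp add: vec_eq_iff lin_ext_nth)

lemma lin_ext_sum: "lin_ext S g (\<Sum>i\<in>A. f i) = (\<Sum>i\<in>A. lin_ext S g (f i))"
  by (induction A rule: infinite_finite_induct) (simp_all add: lin_ext_add)

lemma lin_ext_bvec: "P \<in> S \<Longrightarrow> lin_ext S g (bvec P) = g P"
  for g :: "'k::{field,finite} point \<Rightarrow> ('f::field, 'k) pvec"
proof -
  assume "P \<in> S"
  moreover have "bvec P $ R * c = (if R = P then c else 0)" for R :: "'k point" and c :: 'f by simp
  ultimately show ?thesis by (simp add: vec_eq_iff lin_ext_nth del: bvec_nth)
qed

lemma perm_space_iff: "v \<in> perm_space S \<longleftrightarrow> (\<forall>R. R \<notin> S \<longrightarrow> v $ R = 0)"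
  for S :: "'k::{field,finite} point set"
proof
  show "\<forall>R. R \<notin> S \<longrightarrow> v $ R = 0" if "v \<in> perm_space S"
    using that unfolding perm_space_def
    by (induction rule: vec.span_induct_alt) (auto split: if_splits)
next
  assume "\<forall>R. R \<notin> S \<longrightarrow> v $ R = 0"
  then have "v = (\<Sum>P\<in>S. v $ P *s bvec P)"
    by (auto simp: vec_eq_iff sum_component if_distrib cong: if_cong)
  also have "\<dots> \<in> perm_space S"
    unfolding perm_space_def by (intro vec.span_sum vec.span_scale vec.span_base) auto
  finally show "v \<in> perm_space S" .
qed

lemma lin_ext_image:
  fixes g :: "'k::{field,finite} point \<Rightarrow> ('f::field, 'k) pvec"
  shows "lin_ext S g ` perm_space S = vec.span (g ` S)"
proof
  show "lin_ext S g ` perm_space S \<subseteq> vec.span (g ` S)"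
    unfolding lin_ext_def by (intro image_subsetI vec.span_sum vec.span_scale vec.span_base) simp
  have "vec.subspace (lin_ext S g ` perm_space S)"
    unfolding vec.subspace_def
  proof (safe, goal_cases)
    case 1
    have "lin_ext S g 0 = 0" "0 \<in> perm_space S" by (simp_all add: perm_space_iff)
    then show ?case by (metis image_eqI)
  next
    case (2 _ x _ y)
    then show ?case
      by (intro image_eqI[of _ _ "x + y"]) (auto simp: perm_space_iff lin_ext_add)
  next
    case (3 c _ x)
    then show ?case
      by (intro image_eqI[of _ _ "c *s x"]) (auto simp: perm_space_iff lin_ext_scale)
  qed
  moreover have "g ` S \<subseteq> lin_ext S g ` perm_space S"
  proof
    fix x assume "x \<in> g ` S"
    then obtain P where "P \<in> S" "x = g P" by auto
    then show "x \<in> lin_ext S g ` perm_space S"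
      by (intro image_eqI[of _ _ "bvec P"]) (auto simp: lin_ext_bvec perm_space_iff)
  qed
  ultimately show "vec.span (g ` S) \<subseteq> lin_ext S g ` perm_space S"
    by (rule vec.span_minimal[rotated])
qed

lemma module_act_add: "module_act (u + v) h = module_act u h + module_act v h"
  and module_act_scale: "module_act (c *s v) h = c *s module_act v h"
  and module_act_0 [simp]: "module_act 0 h = 0"
  and module_act_sum: "module_act (\<Sum>i\<in>A. f i) h = (\<Sum>i\<in>A. module_act (f i) h)"
  by (simp_all add: module_act_def lin_ext_add lin_ext_scale lin_ext_sum)

lemma module_act_nth:
  fixes v :: "('f::field, 'k::{field,finite}) pvec"
  assumes A: "det A \<noteq> 0" and P: "P \<in> points"
  shows "module_act v (tau A) $ (point_act P (tau A)) = v $ P"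
proof -
  have "module_act v (tau A) $ (point_act P (tau A)) = (\<Sum>R\<in>points. if R = P then v $ R else 0)"
    unfolding module_act_def lin_ext_nth using point_act_inj[OF A]
    by (intro sum.cong) auto
  then show ?thesis using P by simp
qed

lemma module_act_nth_notin:
  fixes v :: "('f::field, 'k::{field,finite}) pvec"
  assumes A: "det A \<noteq> 0" and R: "R \<notin> points"
  shows "module_act v (tau A) $ R = 0"
  unfolding module_act_def lin_ext_nth using point_act_mem(1)[OF A] R
  by (intro sum.neutral) auto

lemma module_act_eqI:
  fixes u v :: "('f::field, 'k::{field,finite}) pvec"
  assumes A: "det A \<noteq> 0" and "\<And>P. P \<in> points \<Longrightarrow> u $ (point_act P (tau A)) = v $ P"
    and "\<And>R. R \<notin> points \<Longrightarrow> u $ R = 0"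
  shows "module_act v (tau A) = u"
  unfolding vec_eq_iff
proof
  fix R
  show "module_act v (tau A) $ R = u $ R"
  proof (cases "R \<in> points")
    case True
    then obtain P where "P \<in> points" "R = point_act P (tau A)"
      using bij_betw_point_act(1)[OF A] by (auto simp: bij_betw_def)
    then show ?thesis using module_act_nth[OF A] assms(2) by simp
  qed (use module_act_nth_notin[OF A] assms(3) in simp)
qed

lemma module_act_tau_tau:
  fixes v :: "('f::field, 'k::{field,finite}) pvec"
  assumes "det A \<noteq> 0" "det B \<noteq> 0"
  shows "module_act (module_act v (tau A)) (tau B) = module_act v (tau (A ** B))"
proof -
  have AB: "det (A ** B) \<noteq> 0" using assms by (simp add: det_mul)
  show ?thesis
    by (rule module_act_eqI[symmetric, OF AB])
      (use assms in \<open>simp_all add: module_act_nth module_act_nth_notin flip: point_act_tau_tau\<close>)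
qed

definition kcol :: "('k::{field,finite} point \<Rightarrow> 'k point \<Rightarrow> 'f::field) \<Rightarrow> 'k point \<Rightarrow> ('f, 'k) pvec" where
  "kcol k P = (\<chi> R. if R \<in> external_points then k R P else 0)"

lemma kcol_nth [simp]: "kcol k P $ R = (if R \<in> external_points then k R P else 0)"
  by (simp add: kcol_def)

lemma module_act_kcol:
  assumes A: "det A \<noteq> 0"
    and k: "\<And>R. R \<in> external_points \<Longrightarrow> k (point_act R (tau A)) (point_act P (tau A)) = k R P"
  shows "module_act (kcol k P) (tau A) = kcol k (point_act P (tau A))"
  by (rule module_act_eqI[OF A]) (use A k external_subset in auto)

lemma kcol_in_perm_space: "kcol k P \<in> perm_space points"
  using external_subset by (auto simp: perm_space_iff)

lemma FH_module_span:
  fixes g :: "'k::{field,finite} point \<Rightarrow> ('f::field, 'k) pvec"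
  assumes "\<And>P. P \<in> S \<Longrightarrow> g P \<in> perm_space points"
    and "\<And>P h. P \<in> S \<Longrightarrow> h \<in> H \<Longrightarrow> module_act (g P) h \<in> vec.span (g ` S)"
  shows "FH_module (vec.span (g ` S))"
proof -
  have "module_act v h \<in> vec.span (g ` S)" if "h \<in> H" "v \<in> vec.span (g ` S)" for h v
    using that(2)
  proof (induction rule: vec.span_induct_alt)
    case (step c x y)
    then show ?case using assms(2) that(1)
      by (auto simp: module_act_add module_act_scale intro!: vec.span_add vec.span_scale)
  qed (simp add: vec.span_zero)
  moreover have "vec.span (g ` S) \<subseteq> perm_space points"
    by (rule vec.span_minimal) (use assms(1) in \<open>auto simp: perm_space_def vec.subspace_span\<close>)
  ultimately show ?thesis by (simp add: FH_module_def vec.subspace_span)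
qed

text \<open>\<open>ty\<close> makes the coefficient field \<open>'f\<close> a parameter. The
  non-square \<open>nu\<close> stays arbitrary until q is 3 modulo 4, where the choice -1 makes the
  norm form split visibly.\<close>

locale conic_char2 =
  fixes nu :: "'k::{field,finite}" and ty :: "'f::field itself"
  assumes odd: "odd CARD('k)" and nonsq: "\<not> is_sq nu" and char2: "(1::'f) + 1 = 0"
begin

lemma two [simp]: "(2::'k) \<noteq> 0" by (rule odd_card_two_neq_0[OF odd])

lemma four [simp]: "(4::'k) \<noteq> 0" by (rule odd_card_four_neq_0[OF odd])

lemma nu_neq_0 [simp]: "nu \<noteq> 0" using nonsq by auto

lemma dbl [simp]: "x + x = (0::'f)" by (rule char2_double[OF char2])

lemma dbl_left [simp]: "x + (x + y) = (y::'f)" by (simp flip: add.assoc)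

lemma neg_char2 [simp]: "- x = (x::'f)" using dbl[of x] by (metis add_eq_0_iff)

lemma neg_eq_self_iff [simp]: "- x = x \<longleftrightarrow> x = (0::'k)"
proof -
  have "- x = x \<longleftrightarrow> 2 * x = 0" by (metis add_eq_0_iff mult_2)
  then show ?thesis by simp
qed

subsection \<open>Coordinates\<close>

text \<open>The tangents at two points of the conic meet in \<open>pinf b\<close> if these points have the parameters
  \<open>\<infinity>\<close> and \<open>b\<close>, and in \<open>pf b (b\<^sup>2 - m\<^sup>2)\<close> if they have the parameters \<open>b + m\<close> and \<open>b - m\<close>.\<close>

definition pinf :: "'k \<Rightarrow> 'k point" where
  "pinf b = proj (vector [0, 1, 2 * b])"

definition pf :: "'k \<Rightarrow> 'k \<Rightarrow> 'k point" where
  "pf b k = proj (vector [1, b, k])"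

lemma vec3_neq_0 [simp]: "vector [1, b, k] \<noteq> (0 :: 'k ^ 3)" "vector [0, 1, k] \<noteq> (0 :: 'k ^ 3)"
  by (auto simp: vec_eq_iff forall_3 vector_3)

lemma qf_vec3 [simp]: "qf (vector [x, y, z]) = y^2 - x * (z::'k)"
  by (simp add: qf_def vector_3)

lemma pinf_ext [simp]: "pinf b \<in> external_points" and pinf_points [simp]: "pinf b \<in> points"
  and pf_ext_iff [simp]: "pf b k \<in> external_points \<longleftrightarrow> b^2 \<noteq> k \<and> is_sq (b^2 - k)"
  and pf_int_iff [simp]: "pf b k \<in> internal_points \<longleftrightarrow> \<not> is_sq (b^2 - k)"
  and pf_points [simp]: "pf b k \<in> points"
  by (simp_all add: pinf_def pf_def)

lemma pf_eq_iff [simp]: "pf b k = pf b' k' \<longleftrightarrow> b = b' \<and> k = k'"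
proof
  assume "pf b k = pf b' k'"
  then obtain c where "vector [1, b, k] = c *s (vector [1, b', k'] :: 'k ^ 3)"
    unfolding pf_def using proj_eqD vec3_neq_0 by metis
  then show "b = b' \<and> k = k'" by (auto simp: vec_eq_iff forall_3 vector_3)
qed simp

lemma pinf_eq_iff [simp]: "pinf b = pinf b' \<longleftrightarrow> b = b'"
proof
  assume "pinf b = pinf b'"
  then obtain c where "vector [0, 1, 2 * b] = c *s (vector [0, 1, 2 * b'] :: 'k ^ 3)"
    unfolding pinf_def using proj_eqD vec3_neq_0 by metis
  then show "b = b'" by (auto simp: vec_eq_iff forall_3 vector_3)
qed simp

lemma pinf_neq_pf [simp]: "pinf b \<noteq> pf b' k'" and pf_neq_pinf [simp]: "pf b' k' \<noteq> pinf b"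
proof -
  show "pinf b \<noteq> pf b' k'"
  proof
    assume "pinf b = pf b' k'"
    then obtain c where "c \<noteq> 0" "vector [0, 1, 2 * b] = c *s (vector [1, b', k'] :: 'k ^ 3)"
      unfolding pinf_def pf_def using proj_eqD vec3_neq_0 by metis
    then show False by (auto simp: vec_eq_iff forall_3 vector_3)
  qed
  then show "pf b' k' \<noteq> pinf b" by metis
qed

lemma proj_coords:
  fixes v :: "'k ^ 3"
  assumes "v$1 \<noteq> 0"
  shows "proj v = pf (v$2 / v$1) (v$3 / v$1)" "qf v = (v$1)^2 * ((v$2 / v$1)^2 - v$3 / v$1)"
proof -
  have "v = v$1 *s vector [1, v$2 / v$1, v$3 / v$1]"
    using assms by (simp add: vec_eq_iff forall_3 vector_3)
  then show "proj v = pf (v$2 / v$1) (v$3 / v$1)" unfolding pf_def by (metis assms proj_scale)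
  show "qf v = (v$1)^2 * ((v$2 / v$1)^2 - v$3 / v$1)"
    using assms by (simp add: qf_def field_simps power2_eq_square)
qed

lemma internal_cases:
  assumes "P \<in> internal_points"
  obtains p h where "P = pf p h" "\<not> is_sq (p^2 - h)"
proof -
  obtain v where v: "P = proj v" "\<not> is_sq (qf v)" using assms by (auto simp: internal_points_eq)
  have "v$1 \<noteq> 0" using v(2) by (auto simp: qf_def)
  then show ?thesis using proj_coords[of v] v that assms by (metis pf_int_iff)
qed

lemma external_cases:
  assumes "P \<in> external_points"
  obtains b where "P = pinf b" | b m where "m \<noteq> 0" "P = pf b (b^2 - m^2)"
proof -
  obtain v where v: "P = proj v" "qf v \<noteq> 0" "is_sq (qf v)" using assms by (auto simp: external_points_eq)
  show ?thesis
  proof (cases "v$1 = 0")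
    case True
    then have v2: "v$2 \<noteq> 0" using v(2) by (auto simp: qf_def)
    have "v = v$2 *s vector [0, 1, 2 * (v$3 / (2 * v$2))]"
      using True v2 by (simp add: vec_eq_iff forall_3 vector_3)
    then have "P = pinf (v$3 / (2 * v$2))" unfolding pinf_def v(1) by (metis v2 proj_scale)
    then show ?thesis using that by blast
  next
    case False
    define b k where "b = v$2 / v$1" and "k = v$3 / v$1"
    have P: "P = pf b k" using proj_coords[OF False] v(1) by (simp add: b_def k_def)
    then obtain m where "b^2 - k = m^2" "b^2 \<noteq> k" using assms by (auto simp: is_sq_def)
    then have "m \<noteq> 0" "k = b^2 - m^2" by (auto simp: algebra_simps)
    then show ?thesis using that P by blast
  qed
qed

lemma rr_pinf_pinf [simp]: "rr (pinf b) (pinf b') = 1"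
  by (simp add: pinf_def rv_def bf_def vector_3)

lemma rr_pinf_pf [simp]: "rr (pinf b) (pf b' k) = (b' - b)^2 / (b'^2 - k)"
proof -
  have "rr (pinf b) (pf b' k) = (2 * (b' - b))^2 / (4 * (b'^2 - k))"
    by (simp add: pinf_def pf_def rv_def bf_def vector_3 algebra_simps)
  also have "\<dots> = (4 * (b' - b)^2) / (4 * (b'^2 - k))" unfolding power_mult_distrib by simp
  also have "\<dots> = (b' - b)^2 / (b'^2 - k)" by (rule mult_divide_mult_cancel_left[OF four])
  finally show ?thesis .
qed

lemma rr_pf_pinf [simp]: "rr (pf b' k) (pinf b) = (b' - b)^2 / (b'^2 - k)"
  by (subst rr_commute) simp

lemma rr_pf_pf: "rr (pf b k) (pf b' k') = (2 * b * b' - k - k')^2 / (4 * (b^2 - k) * (b'^2 - k'))"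
  by (simp add: pf_def rv_def bf_def vector_3 algebra_simps)

lemma act_unip_pinf: "point_act (pinf b) (tau (mat2 1 t 0 1)) = pinf (b + t)"
  by (simp add: pinf_def tau_mat2 algebra_simps)

lemma act_unip_pf: "point_act (pf b k) (tau (mat2 1 t 0 1)) = pf (b + t) (k + 2 * b * t + t^2)"
  by (simp add: pf_def tau_mat2 algebra_simps)

lemma act_scale_pinf:
  assumes "l \<noteq> 0"
  shows "point_act (pinf b) (tau (mat2 1 0 0 l)) = pinf (l * b)"
proof -
  have "vector [0, l, 2 * b * l^2] = l *s (vector [0, 1, 2 * (l * b)] :: 'k ^ 3)"
    by (simp add: vec_eq_iff forall_3 vector_3 power2_eq_square)
  then show ?thesis using assms by (simp add: pinf_def tau_mat2)
qed

lemma act_scale_pf: "point_act (pf b k) (tau (mat2 1 0 0 l)) = pf (l * b) (l^2 * k)"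
  by (simp add: pf_def tau_mat2 mult_ac)

lemma act_torus_pinf:
  assumes "a \<noteq> 0"
  shows "point_act (pinf b) (tau (mat2 a 0 0 (1 / a))) = pinf (b / a^2)"
  using assms by (simp add: pinf_def tau_mat2 power_divide)

lemma act_weyl_pinf_0: "point_act (pinf 0) (tau (mat2 0 1 (- 1) 0)) = pinf 0"
proof -
  have "vector [0, - 1, 0] = (- 1) *s (vector [0, 1, 0] :: 'k ^ 3)"
    by (simp add: vec_eq_iff forall_3 vector_3)
  then have "proj (vector [0, - 1, 0]) = proj (vector [0, 1, 0] :: 'k ^ 3)"
    by (metis add.inverse_neutral neg_equal_iff_equal proj_scale zero_neq_one)
  then show ?thesis by (simp add: pinf_def tau_mat2)
qed

lemma act_weyl_pf:
  assumes "k \<noteq> 0"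
  shows "point_act (pf b k) (tau (mat2 0 1 (- 1) 0)) = pf (- b / k) (1 / k)"
proof -
  have "vector [k, - b, 1] = k *s (vector [1, - b / k, 1 / k] :: 'k ^ 3)"
    using assms by (simp add: vec_eq_iff forall_3 vector_3)
  then show ?thesis using assms by (simp add: pf_def tau_mat2)
qed

lemma external_transitive:
  assumes "Q \<in> external_points"
  obtains A :: "'k ^ 2 ^ 2" where "det A = 1" "Q = point_act (pinf 0) (tau A)"
  using assms
proof (cases rule: external_cases)
  case (1 b)
  then show ?thesis using that[of "mat2 1 b 0 1"] act_unip_pinf[of 0 b] by simp
next
  case (2 b m)
  \<comment> \<open>\<open>pinf 0\<close> belongs to the tangents with parameters infinity and 0. On
    parameters, \<open>?A\<close> sends infinity to \<open>b + m\<close> and 0 to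
    \<open>b - m\<close>; the factor 1 / (2 m) makes the determinant 1.\<close>
  let ?A = "mat2 1 (b - m) (1 / (2 * m)) ((b + m) / (2 * m))"
  have "det ?A = (2 * m) / (2 * m)" unfolding det_mat2 by (simp add: diff_divide_distrib[symmetric] del: mult_divide_mult_cancel_left_if)
  then have "det ?A = 1" using 2 by simp
  moreover have "vector [2 * 1 * (1 / (2 * m)), 1 * ((b + m) / (2 * m)) + (b - m) * (1 / (2 * m)),
      2 * (b - m) * ((b + m) / (2 * m))] = (1 / m) *s (vector [1, b, b^2 - m^2] :: 'k ^ 3)"
    using 2(1) by (simp add: vec_eq_iff forall_3 vector_3 field_simps power2_eq_square)
  then have "point_act (pinf 0) (tau ?A) = Q"
    using 2 by (simp add: pinf_def pf_def tau_mat2)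
  ultimately show ?thesis using that by metis
qed

subsection \<open>The reflection that fixes \<open>pinf 0\<close> and an internal point\<close>

lemma act_refl_pinf:
  assumes "h \<noteq> 0"
  shows "point_act (pinf b) (tau (mat2 0 h 1 0)) = (if b = 0 then pinf 0 else pf (h / (2 * b)) 0)"
proof (cases "b = 0")
  case True
  have "vector [0, h, 0] = h *s (vector [0, 1, 0] :: 'k ^ 3)"
    by (simp add: vec_eq_iff forall_3 vector_3)
  then show ?thesis using True assms by (simp add: pinf_def tau_mat2)
next
  case False
  have "vector [2 * b, h, 0] = (2 * b) *s (vector [1, h / (2 * b), 0] :: 'k ^ 3)"
    using False by (simp add: vec_eq_iff forall_3 vector_3)
  then have "proj (vector [2 * b, h, 0]) = proj (vector [1, h / (2 * b), 0] :: 'k ^ 3)"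
    using False by (metis mult_eq_0_iff proj_scale two)
  then show ?thesis using False assms by (simp add: pinf_def pf_def tau_mat2)
qed

lemma act_refl_pf:
  assumes "k \<noteq> 0"
  shows "point_act (pf b k) (tau (mat2 0 h 1 0)) = pf (h * b / k) (h^2 / k)"
proof -
  have "vector [k, h * b, h^2] = k *s (vector [1, h * b / k, h^2 / k] :: 'k ^ 3)"
    using assms by (simp add: vec_eq_iff forall_3 vector_3)
  then show ?thesis using assms by (simp add: pf_def tau_mat2 mult_ac)
qed

lemma act_refl_pf_0: "h \<noteq> 0 \<Longrightarrow> point_act (pf b 0) (tau (mat2 0 h 1 0)) \<noteq> pf b 0"
proof
  assume h: "h \<noteq> 0" and "point_act (pf b 0) (tau (mat2 0 h 1 0)) = pf b 0"
  then have "proj (vector [1, b, 0]) = proj (vector [0, b * h, h^2] :: 'k ^ 3)"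
    by (simp add: pf_def tau_mat2)
  then obtain c where "vector [1, b, 0] = c *s (vector [0, b * h, h^2] :: 'k ^ 3)"
    using proj_eqD vec3_neq_0 by metis
  then show False by (simp add: vec_eq_iff forall_3 vector_3)
qed

lemma act_refl_refl:
  assumes "h \<noteq> 0" "P \<in> points"
  shows "point_act (point_act P (tau (mat2 0 h 1 0))) (tau (mat2 0 h 1 0)) = P"
proof -
  obtain v where v: "P = proj v" using assms pointsE by blast
  have "v v* tau (mat2 0 h 1 0) v* tau (mat2 0 h 1 0) = h^2 *s v"
    by (simp add: vec_eq_iff forall_3 tau_nth power2_eq_square)
  then show ?thesis using v assms by simp
qed

text \<open>The matrix acts on the parameters of the conic by t to h / t. Its fixed points are the
  axis, which consists of the \<open>pf b h\<close> and \<open>pinf 0\<close>, and the centre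
  \<open>pf 0 (- h)\<close>. As \<open>F\<close> vanishes at \<open>pinf 0\<close> and at the
  centre, only the external points \<open>pf b h\<close> remain.\<close>

lemma sum_refl:
  fixes F :: "'k point \<Rightarrow> 'f"
  assumes h: "h \<noteq> 0"
    and inv: "\<And>Q. Q \<in> external_points \<Longrightarrow> F (point_act Q (tau (mat2 0 h 1 0))) = F Q"
    and 0: "F (pinf 0) = 0" "F (pf 0 (- h)) = 0"
  shows "sum F external_points = (\<Sum>b | is_sq (b^2 - h) \<and> b^2 \<noteq> h. F (pf b h))"
proof -
  let ?s = "\<lambda>Q. point_act Q (tau (mat2 0 h 1 0))"
  let ?B = "{b. is_sq (b^2 - h) \<and> b^2 \<noteq> h}"
  have d: "det (mat2 0 h 1 0) \<noteq> 0" using h by simp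
  have ext: "Q \<in> points" if "Q \<in> external_points" for Q :: "'k point" using that external_subset by blast
  have "sum F external_points = sum F {Q \<in> external_points. ?s Q = Q}"
    by (rule sum_involution[OF char2]) (use d h ext act_refl_refl inv in auto)
  also have "\<dots> = sum F ((\<lambda>b. pf b h) ` ?B)"
  proof (rule sum.mono_neutral_right)
    show "(\<lambda>b. pf b h) ` ?B \<subseteq> {Q \<in> external_points. ?s Q = Q}"
      using h by (auto simp: act_refl_pf power2_eq_square)
    show "\<forall>Q\<in>{Q \<in> external_points. ?s Q = Q} - (\<lambda>b. pf b h) ` ?B. F Q = 0"
    proof safe
      fix Q assume Q: "Q \<in> external_points" "?s Q = Q" "Q \<notin> (\<lambda>b. pf b h) ` ?B"
      from Q(1) show "F Q = 0"
      proof (cases rule: external_cases)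
        case (1 b)
        then have "b = 0" using Q(2) act_refl_pinf[OF h, of b] by (cases "b = 0") simp_all
        then show ?thesis using 1 0 by simp
      next
        case (2 b m)
        define k where "k = b^2 - m^2"
        have Qk: "Q = pf b k" using 2 k_def by simp
        have k0: "k \<noteq> 0" using act_refl_pf_0[OF h] Q(2) Qk by metis
        have "h * b = k * b" "h^2 = k^2"
          using Q(2) k0 unfolding Qk act_refl_pf[OF k0] pf_eq_iff
          by (auto simp: divide_eq_eq power2_eq_square mult.commute)
        moreover have "k \<noteq> h" using Q(1,3) Qk by auto
        ultimately have "b = 0" "k = - h" by (auto simp: power2_eq_iff)
        then show ?thesis using 0 Qk by simp
      qed
    qed
  qed simp
  also have "\<dots> = (\<Sum>b\<in>?B. F (pf b h))"
    by (rule sum.reindex_cong[where l = "\<lambda>b. pf b h"]) (auto simp: inj_on_def)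
  finally show ?thesis .
qed

subsection \<open>The norm-one group and the kernels attached to its characters\<close>

text \<open>The elements \<open>a + e \<surd>(-nu)\<close> of norm one.\<close>

definition Lam :: "('k \<times> 'k) set" where
  "Lam = {(a, e). a^2 + nu * e^2 = 1}"

fun lmul :: "'k \<times> 'k \<Rightarrow> 'k \<times> 'k \<Rightarrow> 'k \<times> 'k" where
  "lmul (a, e) (a', e') = (a * a' - nu * e * e', a * e' + a' * e)"

fun lcnj :: "'k \<times> 'k \<Rightarrow> 'k \<times> 'k" where
  "lcnj (a, e) = (a, - e)"

definition is_char :: "('k \<times> 'k \<Rightarrow> 'f) \<Rightarrow> bool" where
  "is_char \<theta> \<longleftrightarrow> (\<forall>u\<in>Lam. \<forall>v\<in>Lam. \<theta> (lmul u v) = \<theta> u * \<theta> v) \<and> \<theta> (1, 0) = 1 \<and> \<theta> (- 1, 0) = 1"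

lemma lmul_commute: "lmul u v = lmul v u"
  by (cases u; cases v) (simp add: algebra_simps)

lemma lmul_assoc: "lmul (lmul u v) w = lmul u (lmul v w)"
  by (cases u; cases v; cases w) (simp add: algebra_simps)

lemma lmul_1 [simp]: "lmul (1, 0) u = u" "lmul u (1, 0) = u"
  by (cases u; simp)+

lemma lmul_m1: "lmul (- 1, 0) u = - u" "lmul u (- 1, 0) = - u"
  by (cases u; simp)+

lemma lcnj_lcnj [simp]: "lcnj (lcnj u) = u"
  by (cases u) simp

lemma lcnj_lmul: "lcnj (lmul u v) = lmul (lcnj u) (lcnj v)"
  by (cases u; cases v) simp

lemma Lam_mult [simp]: "u \<in> Lam \<Longrightarrow> v \<in> Lam \<Longrightarrow> lmul u v \<in> Lam"
proof (cases u; cases v)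
  fix a e a' e' assume "u \<in> Lam" "v \<in> Lam" "u = (a, e)" "v = (a', e')"
  moreover have "(a * a' - nu * e * e')^2 + nu * (a * e' + a' * e)^2 = (a^2 + nu * e^2) * (a'^2 + nu * e'^2)"
    by (simp add: power2_eq_square algebra_simps)
  ultimately show ?thesis by (simp add: Lam_def)
qed

lemma Lam_1 [simp]: "(1, 0) \<in> Lam" "(- 1, 0) \<in> Lam"
  by (simp_all add: Lam_def)

lemma Lam_cnj [simp]: "lcnj u \<in> Lam \<longleftrightarrow> u \<in> Lam"
  by (cases u) (simp add: Lam_def)

lemma Lam_minus [simp]: "- u \<in> Lam \<longleftrightarrow> u \<in> Lam"
  by (cases u) (simp add: Lam_def)

lemma lmul_cnj: "u \<in> Lam \<Longrightarrow> lmul u (lcnj u) = (1, 0)" "u \<in> Lam \<Longrightarrow> lmul (lcnj u) u = (1, 0)"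
  by (cases u; simp add: Lam_def power2_eq_square algebra_simps)+

lemma char_mult: "is_char \<theta> \<Longrightarrow> u \<in> Lam \<Longrightarrow> v \<in> Lam \<Longrightarrow> \<theta> (lmul u v) = \<theta> u * \<theta> v"
  and char_1: "is_char \<theta> \<Longrightarrow> \<theta> (1, 0) = 1" "is_char \<theta> \<Longrightarrow> \<theta> (- 1, 0) = 1"
  by (auto simp: is_char_def)

lemma char_minus: "is_char \<theta> \<Longrightarrow> u \<in> Lam \<Longrightarrow> \<theta> (- u) = \<theta> u"
  by (metis Lam_1(2) char_1(2) char_mult lmul_m1(1) mult_1)

lemma char_cnj: "is_char \<theta> \<Longrightarrow> u \<in> Lam \<Longrightarrow> \<theta> u * \<theta> (lcnj u) = 1"
  by (metis Lam_cnj char_1(1) char_mult lmul_cnj(1))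

text \<open>For \<open>e \<noteq> 0\<close> this is the trace
  \<open>\<theta> u + \<theta> (lcnj u)\<close>. At \<open>a = 1\<close> and \<open>a = - 1\<close>
  the sum has a single term, so it is 1 for a character, whereas the trace is 0 there. For this
  reason \<open>Bt\<close> sets its value at \<open>rr Q P = 0\<close> to 0 by hand.\<close>

definition trS :: "('k \<times> 'k \<Rightarrow> 'f) \<Rightarrow> 'k \<Rightarrow> 'f" where
  "trS \<theta> a = (\<Sum>e | (a, e) \<in> Lam. \<theta> (a, e))"

lemma trS_nonzero:
  assumes "(a, e) \<in> Lam" "e \<noteq> 0"
  shows "trS \<theta> a = \<theta> (a, e) + \<theta> (a, - e)"
proof -
  have "{e'. (a, e') \<in> Lam} = {e, - e}"
  proof -
    have "(a, e') \<in> Lam \<longleftrightarrow> e'^2 = e^2" for e'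
    proof -
      have "(a, e') \<in> Lam \<longleftrightarrow> a^2 + nu * e'^2 = a^2 + nu * e^2" using assms(1) by (simp add: Lam_def)
      then show ?thesis by simp
    qed
    then show ?thesis by (auto simp: power2_eq_iff)
  qed
  moreover have "e \<noteq> - e" using assms neg_eq_self_iff by metis
  ultimately show ?thesis by (simp add: trS_def)
qed

lemma trS_none: "(\<And>e. (a, e) \<notin> Lam) \<Longrightarrow> trS \<theta> a = 0"
  by (simp add: trS_def)

lemma zero_notin_Lam [simp]: "(0, e) \<notin> Lam"
proof
  assume "(0, e) \<in> Lam"
  then have "nu * e^2 = 1" by (simp add: Lam_def)
  moreover from this have "e \<noteq> 0" by auto
  ultimately have "nu = (1 / e)^2" by (simp add: power_divide eq_divide_eq)
  then show False using nonsq by simp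
qed

lemma trS_0 [simp]: "trS \<theta> 0 = 0"
  by (simp add: trS_none)

lemma trS_1: "is_char \<theta> \<Longrightarrow> trS \<theta> 1 = 1"
proof -
  assume "is_char \<theta>"
  moreover have "{e. (1, e) \<in> Lam} = {0}" by (auto simp: Lam_def)
  ultimately show ?thesis by (simp add: trS_def char_1)
qed

lemma trS_minus: "is_char \<theta> \<Longrightarrow> trS \<theta> (- a) = trS \<theta> a"
proof -
  assume c: "is_char \<theta>"
  have L: "(- a, e) \<in> Lam \<longleftrightarrow> (a, e) \<in> Lam" for e by (simp add: Lam_def)
  have "trS \<theta> (- a) = (\<Sum>e | (a, e) \<in> Lam. \<theta> (a, - e))"
    unfolding trS_def L using char_minus[OF c, of "(- a, _)"] L
    by (intro sum.cong) (auto simp: Lam_def)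
  also have "\<dots> = trS \<theta> a"
    unfolding trS_def by (rule sum.reindex_bij_witness[of _ uminus uminus]) (auto simp: Lam_def)
  finally show ?thesis .
qed

text \<open>The choice of the root does not matter: \<open>trS \<theta> (- a) = trS \<theta> a\<close> because
  \<open>\<theta> (- 1) = 1\<close>.\<close>

definition kern :: "('k \<times> 'k \<Rightarrow> 'f) \<Rightarrow> 'k \<Rightarrow> 'f" where
  "kern \<theta> r = (if is_sq r then trS \<theta> (SOME a. r = a^2) else 0)"

lemma kern_power2: "is_char \<theta> \<Longrightarrow> kern \<theta> (a^2) = trS \<theta> a"
proof -
  assume c: "is_char \<theta>"
  have "a^2 = (SOME b. a^2 = b^2)^2" by (rule someI[of _ a]) simp
  then have "(SOME b. a^2 = b^2) = a \<or> (SOME b. a^2 = b^2) = - a" by (metis power2_eq_iff)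
  then show ?thesis using trS_minus[OF c] by (auto simp: kern_def)
qed

lemma kern_nonsq: "\<not> is_sq r \<Longrightarrow> kern \<theta> r = 0"
  by (simp add: kern_def)

lemma kern_0 [simp]: "is_char \<theta> \<Longrightarrow> kern \<theta> 0 = 0"
  using kern_power2[of \<theta> 0] by simp

lemma kern_1: "is_char \<theta> \<Longrightarrow> kern \<theta> 1 = 1"
  using kern_power2[of \<theta> 1] trS_1 by simp

lemma kern_sq_compl:
  assumes "is_char \<theta>" "is_sq (1 - r)" "r \<noteq> 1"
  shows "kern \<theta> r = 0"
proof (cases "is_sq r")
  case True
  then obtain a where a: "r = a^2" by (auto simp: is_sq_def)
  have "(a, e) \<notin> Lam" for e
  proof
    assume "(a, e) \<in> Lam"
    then have "1 - r = e^2 * nu" using a by (auto simp: Lam_def algebra_simps)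
    moreover from this have "e \<noteq> 0" using assms(3) by auto
    ultimately show False using assms(2) nonsq by simp
  qed
  then show ?thesis using assms(1) a by (simp add: kern_power2 trS_none)
qed (rule kern_nonsq)

text \<open>Distinct external points on a common tangent have \<open>rr = 1\<close>, just as equal
  ones do, but only the former get the kernel value 1. With a zero diagonal the term at
  \<open>pinf 0\<close> drops out of \<open>sum_refl\<close>, and the values of a column at
  \<open>pinf c\<close> along the tangent of the \<open>pinf b\<close> add up to q - 1, which is
  0.\<close>

definition Kk :: "('k \<times> 'k \<Rightarrow> 'f) \<Rightarrow> 'k point \<Rightarrow> 'k point \<Rightarrow> 'f" where
  "Kk \<theta> P Q = (if P = Q then 0 else kern \<theta> (rr P Q))"

text \<open>\<open>Bk\<close> and \<open>Dk\<close> are the matrices of \<open>phi_B\<close> and \<open>phi_D\<close>; \<open>Bt \<theta>\<close> is the component of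
  \<open>Bk\<close> at \<open>\<theta>\<close>.\<close>

definition Bk :: "'k point \<Rightarrow> 'k point \<Rightarrow> 'f" where
  "Bk Q P = (if rr Q P = 0 then 1 else 0)"

definition Dk :: "'k point \<Rightarrow> 'k point \<Rightarrow> 'f" where
  "Dk Q P = (if is_sq (rr Q P - 1) then 1 else 0)"

definition Bt :: "('k \<times> 'k \<Rightarrow> 'f) \<Rightarrow> 'k point \<Rightarrow> 'k point \<Rightarrow> 'f" where
  "Bt \<theta> Q P = (if rr Q P = 0 then 0 else kern \<theta> (1 - rr Q P))"

definition invariant :: "('k point \<Rightarrow> 'k point \<Rightarrow> 'f) \<Rightarrow> bool" where
  "invariant k \<longleftrightarrow> (\<forall>A P Q. det A \<noteq> 0 \<longrightarrow> P \<in> points \<longrightarrow> Q \<in> points \<longrightarrow>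
     k (point_act P (tau A)) (point_act Q (tau A)) = k P Q)"

lemma invariantD:
  "invariant k \<Longrightarrow> det A \<noteq> 0 \<Longrightarrow> P \<in> points \<Longrightarrow> Q \<in> points \<Longrightarrow>
     k (point_act P (tau A)) (point_act Q (tau A)) = k P Q"
  by (simp add: invariant_def)

lemma invariant_kernels [simp]: "invariant (Kk \<theta>)" "invariant Bk" "invariant Dk" "invariant (Bt \<theta>)"
  by (simp_all add: invariant_def Kk_def Bk_def Dk_def Bt_def point_act_inj)

lemma Kk_commute: "Kk \<theta> P Q = Kk \<theta> Q P"
  by (simp add: Kk_def rr_commute[of P])

section \<open>Products of the kernels with the two incidence matrices\<close>

text \<open>\<open>H\<close> is transitive on the external points, so an identity of invariant
  matrices has to be checked in the row of \<open>pinf 0\<close> only.\<close>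

lemma invariant_sum_eqI:
  assumes inv: "invariant k" "invariant g" "invariant r"
    and S: "S = external_points \<or> S = internal_points"
    and at0: "\<And>P. P \<in> internal_points \<Longrightarrow> (\<Sum>R\<in>S. k (pinf 0) R * g R P) = r (pinf 0) P"
    and Q: "Q \<in> external_points" and P: "P \<in> internal_points"
  shows "(\<Sum>R\<in>S. k Q R * g R P) = r Q P"
proof -
  obtain A :: "'k ^ 2 ^ 2" where A: "det A = 1" "Q = point_act (pinf 0) (tau A)"
    using external_transitive[OF Q] by blast
  then have A0: "det A \<noteq> 0" by simp
  obtain B where B: "det B = 1 / det A" "\<And>P. point_act (point_act P (tau A)) (tau B) = P"
    "\<And>P. point_act (point_act P (tau B)) (tau A) = P" using point_act_inverse[OF A0] by blast
  define P0 where "P0 = point_act P (tau B)"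
  have Pp: "P \<in> points" using P internal_subset by blast
  have P0: "P0 \<in> internal_points" "P0 \<in> points" "P = point_act P0 (tau A)"
    using A B P Pp by (simp_all add: P0_def)
  have Sp: "S \<subseteq> points" using S external_subset internal_subset by blast
  have bij: "bij_betw (\<lambda>R. point_act R (tau A)) S S" using S bij_betw_point_act[OF A0] by blast
  have "(\<Sum>R\<in>S. k Q R * g R P) = (\<Sum>R\<in>S. k Q (point_act R (tau A)) * g (point_act R (tau A)) P)"
    by (rule sum.reindex_bij_betw[OF bij, symmetric])
  also have "\<dots> = (\<Sum>R\<in>S. k (pinf 0) R * g R P0)"
    using Sp P0 A(2) inv A0 by (intro sum.cong) (auto simp: invariantD subset_iff)
  also have "\<dots> = r (pinf 0) P0" using at0 P0 by simp
  also have "\<dots> = r Q P" using invariantD[OF inv(3) A0, of "pinf 0" P0] P0 A(2) by simp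
  finally show ?thesis .
qed

lemma act_refl_internal:
  assumes "h \<noteq> 0"
  shows "point_act (pf p h) (tau (mat2 0 h 1 0)) = pf p h"
  using assms by (simp add: act_refl_pf power2_eq_square)

lemma internal_coord_neq_0: "\<not> is_sq (p^2 - h) \<Longrightarrow> h \<noteq> 0"
  by auto

lemma sum_kernel_refl:
  assumes k: "invariant k" "k (pinf 0) (pinf 0) = 0" "k (pinf 0) (pf 0 (- h)) = 0"
    and g: "invariant g" and h: "h \<noteq> 0"
  shows "(\<Sum>R\<in>external_points. k (pinf 0) R * g R (pf p h)) =
    (\<Sum>b | is_sq (b^2 - h) \<and> b^2 \<noteq> h. k (pinf 0) (pf b h) * g (pf b h) (pf p h))"
proof (rule sum_refl[OF h])
  fix R assume "R \<in> (external_points :: 'k point set)"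
  then have R: "R \<in> points" using external_subset by blast
  have d: "det (mat2 0 h 1 0) \<noteq> 0" using h by simp
  have "k (pinf 0) (point_act R (tau (mat2 0 h 1 0))) = k (pinf 0) R"
    using invariantD[OF k(1) d, of "pinf 0" R] R by (simp add: act_refl_pinf h)
  moreover have "g (point_act R (tau (mat2 0 h 1 0))) (pf p h) = g R (pf p h)"
    using invariantD[OF g d, of R "pf p h"] R by (simp add: act_refl_internal h)
  ultimately show "k (pinf 0) (point_act R (tau (mat2 0 h 1 0))) * g (point_act R (tau (mat2 0 h 1 0))) (pf p h)
      = k (pinf 0) R * g R (pf p h)" by simp
qed (use k in auto)

lemma Kk_pinf_0_pf: "Kk \<theta> (pinf 0) (pf b k) = kern \<theta> (b^2 / (b^2 - k))"
  by (simp add: Kk_def)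

lemma rr_same_h: "rr (pf b h) (pf p h) = (b * p - h)^2 / ((b^2 - h) * (p^2 - h))"
proof -
  have "rr (pf b h) (pf p h) = (4 * (b * p - h)^2) / (4 * ((b^2 - h) * (p^2 - h)))"
    unfolding rr_pf_pf by (simp add: power2_eq_square algebra_simps)
  also have "\<dots> = (b * p - h)^2 / ((b^2 - h) * (p^2 - h))" by (rule mult_divide_mult_cancel_left[OF four])
  finally show ?thesis .
qed

lemma one_minus_rr_pinf_0: "p^2 \<noteq> h \<Longrightarrow> 1 - rr (pinf 0) (pf p h) = - h / (p^2 - h)"
  by (simp add: field_simps)

lemma kern_nonsq_arg:
  assumes "is_char \<theta>" "is_sq (- h)" "\<not> is_sq (p^2 - h)"
  shows "kern \<theta> (- h / (p^2 - h)) = 0"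
proof -
  have "- h \<noteq> 0" using internal_coord_neq_0[OF assms(3)] by simp
  then have "\<not> is_sq (- h / (p^2 - h))" unfolding is_sq_divide
    using is_sq_mult_iff[OF assms(2)] assms(3) by blast
  then show ?thesis by (rule kern_nonsq)
qed

text \<open>Two points \<open>pf b h\<close> and \<open>pf p h\<close> of the axis are orthogonal
  exactly if \<open>b * p = h\<close>, so a single summand survives. For \<open>p = 0\<close> there
  is none, and then \<open>rr (pinf 0) P = 0\<close> as well.\<close>

lemma Kk_Bk:
  assumes c: "is_char \<theta>" and Q: "Q \<in> external_points" and P: "P \<in> internal_points"
  shows "(\<Sum>R\<in>external_points. Kk \<theta> Q R * Bk R P) = Bt \<theta> Q P"
proof (rule invariant_sum_eqI[OF _ _ _ _ _ Q P])
  fix P assume "P \<in> (internal_points :: 'k point set)"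
  then obtain p h where P: "P = pf p h" "\<not> is_sq (p^2 - h)" by (rule internal_cases)
  have h: "h \<noteq> 0" by (rule internal_coord_neq_0[OF P(2)])
  have ph: "p^2 \<noteq> h" using P(2) by auto
  let ?B = "{b. is_sq (b^2 - h) \<and> b^2 \<noteq> h}"
  have "(\<Sum>R\<in>external_points. Kk \<theta> (pinf 0) R * Bk R P) =
      (\<Sum>b\<in>?B. Kk \<theta> (pinf 0) (pf b h) * Bk (pf b h) (pf p h))"
    unfolding P(1) by (rule sum_kernel_refl) (use h c in \<open>simp_all add: Kk_pinf_0_pf, simp add: Kk_def\<close>)
  also have "\<dots> = (\<Sum>b\<in>?B. if b * p = h then kern \<theta> (b^2 / (b^2 - h)) else 0)"
    using ph by (intro sum.cong) (auto simp: Kk_pinf_0_pf Bk_def rr_same_h)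
  also have "\<dots> = Bt \<theta> (pinf 0) P"
  proof (cases "p = 0")
    case True
    then show ?thesis using h P by (simp add: Bt_def)
  next
    case False
    let ?b = "h / p" and ?s = "p^2 - h"
    have s0: "?s \<noteq> 0" using ph by simp
    have bh: "?b^2 - h = (- h * ?s) / p^2" using False
      by (simp add: field_simps power2_eq_square)
    then have bh0: "?b^2 - h \<noteq> 0" using False h s0 by simp
    have "(\<Sum>b\<in>?B. if b * p = h then kern \<theta> (b^2 / (b^2 - h)) else 0) =
        (\<Sum>b\<in>?B. if b = ?b then kern \<theta> (b^2 / (b^2 - h)) else 0)"
      using False by (intro sum.cong) (auto simp: eq_divide_eq)
    also have "\<dots> = (if is_sq (?b^2 - h) then kern \<theta> (?b^2 / (?b^2 - h)) else 0)"
      using bh0 by simp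
    also have "?b^2 / (?b^2 - h) = - h / ?s"
      unfolding bh using False h s0 by (simp add: field_simps power2_eq_square)
    \<comment> \<open>The surviving point is external exactly if the argument of the kernel is a
      square; if it is not, both sides are 0.\<close>
    also have "is_sq (?b^2 - h) \<longleftrightarrow> is_sq (- h / ?s)"
      unfolding bh is_sq_divide using is_sq_power2_mult_iff[OF False, of "- h * ?s"] by (simp add: mult.commute)
    also have "(if is_sq (- h / ?s) then kern \<theta> (- h / ?s) else 0) = kern \<theta> (- h / ?s)"
      by (simp add: kern_nonsq)
    also have "\<dots> = Bt \<theta> (pinf 0) P"
      unfolding P(1) Bt_def one_minus_rr_pinf_0[OF ph] using False s0 by simp
    finally show ?thesis .
  qed
  finally show "(\<Sum>R\<in>external_points. Kk \<theta> (pinf 0) R * Bk R P) = Bt \<theta> (pinf 0) P" .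
qed simp_all

text \<open>All \<open>pf b h\<close> lie on one line with \<open>P\<close>, the axis, so
  \<open>Dk\<close> is constant in the remaining sum: it tells whether the axis is passant, that is,
  whether \<open>h\<close> is a non-square. The kernel values are even in \<open>b\<close> and
  cancel, except at \<open>b = 0\<close>, where \<open>kern \<theta> 0 = 0\<close>.\<close>

lemma Kk_Dk:
  assumes c: "is_char \<theta>" and Q: "Q \<in> external_points" and P: "P \<in> internal_points"
  shows "(\<Sum>R\<in>external_points. Kk \<theta> Q R * Dk R P) = 0"
proof (rule invariant_sum_eqI[where r = "\<lambda>Q P. 0", OF _ _ _ _ _ Q P])
  fix P assume "P \<in> (internal_points :: 'k point set)"
  then obtain p h where P: "P = pf p h" "\<not> is_sq (p^2 - h)" by (rule internal_cases)
  have h: "h \<noteq> 0" by (rule internal_coord_neq_0[OF P(2)])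
  have ph: "p^2 - h \<noteq> 0" using P(2) by auto
  let ?B = "{b. is_sq (b^2 - h) \<and> b^2 \<noteq> h}"
  have D: "Dk (pf b h) (pf p h) = (if is_sq h then 0 else 1)" if "b \<in> ?B" for b
  proof -
    have b: "is_sq (b^2 - h)" "b^2 - h \<noteq> 0" using that by auto
    have bp: "b - p \<noteq> 0" using b(1) P(2) by auto
    have frac: "x / y - 1 = (x - y) / y" if "y \<noteq> 0" for x y :: 'k
      using that by (simp add: diff_divide_distrib)
    have "(b * p - h)^2 - (b^2 - h) * (p^2 - h) = (b - p)^2 * h"
      by (simp add: power2_eq_square algebra_simps)
    then have "rr (pf b h) (pf p h) - 1 = (b - p)^2 * h / ((b^2 - h) * (p^2 - h))"
      unfolding rr_same_h using frac[of "(b^2 - h) * (p^2 - h)"] b(2) ph by simp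
    then have "is_sq (rr (pf b h) (pf p h) - 1) \<longleftrightarrow> is_sq ((b - p)^2 * (h * ((b^2 - h) * (p^2 - h))))"
      by (simp only: is_sq_divide mult.assoc)
    also have "\<dots> \<longleftrightarrow> is_sq ((b^2 - h) * ((p^2 - h) * h))"
      unfolding is_sq_power2_mult_iff[OF bp] by (simp add: mult_ac)
    also have "\<dots> \<longleftrightarrow> \<not> is_sq h"
      unfolding is_sq_mult_iff[OF b] nonsq_mult_iff[OF odd P(2)] using h by simp
    finally show ?thesis by (simp add: Dk_def)
  qed
  have "(\<Sum>R\<in>external_points. Kk \<theta> (pinf 0) R * Dk R P) =
      (\<Sum>b\<in>?B. Kk \<theta> (pinf 0) (pf b h) * Dk (pf b h) (pf p h))"
    unfolding P(1) by (rule sum_kernel_refl) (use h c in \<open>simp_all add: Kk_pinf_0_pf, simp add: Kk_def\<close>)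
  also have "\<dots> = (\<Sum>b\<in>?B. kern \<theta> (b^2 / (b^2 - h))) * (if is_sq h then 0 else 1)"
    unfolding sum_distrib_right using D by (intro sum.cong) (auto simp: Kk_pinf_0_pf)
  also have "(\<Sum>b\<in>?B. kern \<theta> (b^2 / (b^2 - h))) = (\<Sum>b | b \<in> ?B \<and> - b = b. kern \<theta> (b^2 / (b^2 - h)))"
    by (rule sum_involution[OF char2]) auto
  also have "\<dots> = 0"
    using c by (intro sum.neutral) auto
  finally show "(\<Sum>R\<in>external_points. Kk \<theta> (pinf 0) R * Dk R P) = 0" by simp
qed (auto simp: invariant_def[of "\<lambda>Q P. 0"])

lemma sum_Bk_pinf_0:
  "(\<Sum>R\<in>internal_points. Bk (pinf 0) R * F R) = (\<Sum>k | \<not> is_sq (- k). F (pf 0 k))"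
proof -
  have "(\<Sum>R\<in>internal_points. Bk (pinf 0) R * F R) = (\<Sum>R\<in>pf 0 ` {k. \<not> is_sq (- k)}. Bk (pinf 0) R * F R)"
  proof (rule sum.mono_neutral_right)
    show "\<forall>R\<in>internal_points - pf 0 ` {k. \<not> is_sq (- k)}. Bk (pinf 0) R * F R = 0"
    proof
      fix R assume R: "R \<in> internal_points - pf 0 ` {k. \<not> is_sq (- k)}"
      then have "R \<in> internal_points" by simp
      then obtain b k where bk: "R = pf b k" "\<not> is_sq (b^2 - k)" by (rule internal_cases)
      then have "b \<noteq> 0" using R by auto
      moreover have "b^2 - k \<noteq> 0" using bk(2) by auto
      ultimately show "Bk (pinf 0) R * F R = 0" using bk(1) by (simp add: Bk_def)
    qed
  qed auto
  also have "\<dots> = (\<Sum>k | \<not> is_sq (- k). F (pf 0 k))"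
    by (rule sum.reindex_cong[where l = "pf 0"]) (auto simp: inj_on_def Bk_def)
  finally show ?thesis .
qed

text \<open>This second factorisation exhibits the columns of \<open>Bt \<theta>\<close> as
  combinations of columns of \<open>Bk\<close>, hence as elements of the image of
  \<open>phi_B\<close>. The sum runs over the internal points of the polar of \<open>pinf 0\<close>,
  on which the reflection acts by k to \<open>h^2 / k\<close>; of its fixed points \<open>h\<close>
  and \<open>- h\<close>, the kernel vanishes at the second.\<close>

lemma Bk_Kk:
  assumes c: "is_char \<theta>" and Q: "Q \<in> external_points" and P: "P \<in> internal_points"
  shows "(\<Sum>R\<in>internal_points. Bk Q R * Kk \<theta> R P) = Bt \<theta> Q P"
proof (rule invariant_sum_eqI[OF _ _ _ _ _ Q P])
  fix P assume "P \<in> (internal_points :: 'k point set)"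
  then obtain p h where P: "P = pf p h" "\<not> is_sq (p^2 - h)" by (rule internal_cases)
  have h: "h \<noteq> 0" by (rule internal_coord_neq_0[OF P(2)])
  have ph: "p^2 \<noteq> h" "p^2 - h \<noteq> 0" using P(2) by auto
  have h4: "4 * h \<noteq> 0" using h by simp
  let ?K = "{k. \<not> is_sq (- k)}" and ?F = "\<lambda>k. Kk \<theta> (pf 0 k) P"
  have inv: "?F (h^2 / k) = ?F k" if "k \<in> ?K" for k
  proof -
    have k: "k \<noteq> 0" using that by auto
    have d: "det (mat2 0 h 1 0) \<noteq> 0" using h by simp
    show ?thesis
      using invariantD[OF invariant_kernels(1)[of \<theta>] d, of "pf 0 k" P]
      unfolding P(1) act_refl_pf[OF k] act_refl_internal[OF h] by simp
  qed
  have mem: "h^2 / k \<in> ?K" if "k \<in> ?K" for k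
  proof -
    have "- (h^2 / k) = h^2 * inverse (- k)" by (simp add: divide_inverse)
    then show ?thesis using that h is_sq_power2_mult_iff[OF h, of "inverse (- k)"] by (simp del: inverse_minus_eq)
  qed
  have "(\<Sum>R\<in>internal_points. Bk (pinf 0) R * Kk \<theta> R P) = (\<Sum>k\<in>?K. ?F k)" by (rule sum_Bk_pinf_0)
  also have "\<dots> = (\<Sum>k | k \<in> ?K \<and> h^2 / k = k. ?F k)"
  proof (rule sum_involution[OF char2])
    show "h^2 / (h^2 / k) = k" if "k \<in> ?K" for k using that h by auto
  qed (use inv mem in auto)
  also have "\<dots> = (\<Sum>k | k = h \<and> \<not> is_sq (- h). ?F k)"
  proof (rule sum.mono_neutral_right)
    show "{k. k = h \<and> \<not> is_sq (- h)} \<subseteq> {k \<in> ?K. h^2 / k = k}"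
      using h by (auto simp: power2_eq_square)
    show "\<forall>k\<in>{k \<in> ?K. h^2 / k = k} - {k. k = h \<and> \<not> is_sq (- h)}. ?F k = 0"
    proof
      fix k assume k: "k \<in> {k \<in> ?K. h^2 / k = k} - {k. k = h \<and> \<not> is_sq (- h)}"
      then have "k \<noteq> 0" by auto
      then have "h^2 = k^2" using k by (auto simp: divide_eq_eq power2_eq_square)
      then have "k = - h" using k by (auto simp: power2_eq_iff)
      then show "?F k = 0" unfolding P(1) Kk_def rr_pf_pf using c by simp
    qed
  qed simp
  also have "\<dots> = Bt \<theta> (pinf 0) P"
  proof (cases "is_sq (- h)")
    case True
    then show ?thesis
      using kern_nonsq_arg[OF c True P(2)] by (simp add: Bt_def P(1) one_minus_rr_pinf_0[OF ph(1), simplified])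
  next
    case False
    have "rr (pf 0 h) (pf p h) = (4 * h * h) / (4 * h * (- (p^2 - h)))"
      unfolding rr_pf_pf by (simp add: power2_eq_square algebra_simps)
    also have "\<dots> = h / (- (p^2 - h))" by (rule mult_divide_mult_cancel_left[OF h4])
    also have "\<dots> = - h / (p^2 - h)" by (metis minus_divide_left minus_divide_right)
    finally have r: "rr (pf 0 h) (pf p h) = - h / (p^2 - h)" .
    have "(\<Sum>k | k = h \<and> \<not> is_sq (- h). ?F k) = ?F h" using False by simp
    also have "\<dots> = (if p = 0 then 0 else kern \<theta> (- h / (p^2 - h)))"
      unfolding P(1) Kk_def r by auto
    also have "\<dots> = Bt \<theta> (pinf 0) P"
      unfolding Bt_def P(1) one_minus_rr_pinf_0[OF ph(1)] using ph by simp
    finally show ?thesis .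
  qed
  finally show "(\<Sum>R\<in>internal_points. Bk (pinf 0) R * Kk \<theta> R P) = Bt \<theta> (pinf 0) P" .
qed simp_all

text \<open>The polar of an external point has (q - 1) / 2 internal points, an odd number if q is 3
  modulo 4. So all columns of \<open>Bk\<close> add up to the all-one vector.\<close>

lemma sum_Bk_internal:
  assumes q: "CARD('k) mod 4 = 3" and Q: "Q \<in> external_points"
  shows "(\<Sum>R\<in>internal_points. Bk Q R) = 1"
proof -
  obtain A :: "'k ^ 2 ^ 2" where A: "det A = 1" "Q = point_act (pinf 0) (tau A)"
    using external_transitive[OF Q] by blast
  then have A0: "det A \<noteq> 0" by simp
  have "(\<Sum>R\<in>internal_points. Bk Q R) = (\<Sum>R\<in>internal_points. Bk Q (point_act R (tau A)))"
    by (rule sum.reindex_bij_betw[OF bij_betw_point_act(3)[OF A0], symmetric])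
  also have "\<dots> = (\<Sum>R\<in>internal_points. Bk (pinf 0) R * 1)"
    using A0 A(2) invariantD[OF invariant_kernels(2)] internal_subset by (intro sum.cong) auto
  also have "\<dots> = of_nat (card {k::'k. \<not> is_sq (- k)})"
    unfolding sum_Bk_pinf_0 by simp
  also have "card {k::'k. \<not> is_sq (- k)} = card {k::'k. \<not> is_sq k}"
    by (rule bij_betw_same_card[of uminus]) (auto intro!: bij_betwI[where g = uminus])
  also have "odd \<dots>" using card_nonsq[OF odd] q by presburger
  then have "of_nat (card {k::'k. \<not> is_sq k}) = (1::'f)" using char2_of_nat[OF char2] by simp
  finally show ?thesis .
qed

section \<open>The subgroup of odd order and the orthogonality of characters\<close>

lemma lcnj_Pair: "lcnj u = (fst u, - snd u)"
  by (cases u) simp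

lemma Lam_iff: "u \<in> Lam \<longleftrightarrow> (fst u)^2 + nu * (snd u)^2 = 1"
  by (cases u) (simp add: Lam_def)

lemma is_char_mult: "is_char \<theta> \<Longrightarrow> is_char \<theta>' \<Longrightarrow> is_char (\<lambda>u. \<theta> u * \<theta>' u)"
  by (simp add: is_char_def)

lemma is_char_cnj: "is_char \<theta> \<Longrightarrow> is_char (\<lambda>u. \<theta> (lcnj u))"
  by (auto simp: is_char_def lcnj_lmul)

definition tr :: "('k \<times> 'k \<Rightarrow> 'f) \<Rightarrow> 'k \<times> 'k \<Rightarrow> 'f" where
  "tr \<theta> u = \<theta> u + \<theta> (lcnj u)"

lemma tr_real [simp]: "tr \<theta> (a, 0) = 0"
  by (simp add: tr_def)

lemma trS_eq_tr: "u \<in> Lam \<Longrightarrow> snd u \<noteq> 0 \<Longrightarrow> trS \<theta> (fst u) = tr \<theta> u"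
  by (cases u) (simp add: trS_nonzero tr_def)

lemma kern_eq_tr:
  assumes "is_char \<theta>" "u \<in> Lam" "1 - r = (fst u)^2"
  shows "(if r = 0 then 0 else kern \<theta> (1 - r)) = tr \<theta> u"
proof -
  have "r = nu * (snd u)^2" using assms(2,3) unfolding Lam_iff by algebra
  then have "r = 0 \<longleftrightarrow> snd u = 0" by simp
  moreover have "tr \<theta> u = 0" if "snd u = 0" using that by (cases u) simp
  ultimately show ?thesis using assms by (auto simp: kern_power2 trS_eq_tr)
qed

text \<open>The subgroup of index 2, a complement of the elements 1 and -1 in \<open>Lam\<close>.
  Characters agree at \<open>u\<close> and \<open>- u\<close>, so over all of \<open>Lam\<close>
  each value would be counted twice and every character sum would be 0; over \<open>L\<close> the
  trivial character has the sum \<open>card L\<close>, which is 1.\<close>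

definition odd_part :: "('k \<times> 'k) set \<Rightarrow> bool" where
  "odd_part L \<longleftrightarrow> L \<subseteq> Lam \<and> (1, 0) \<in> L \<and> (- 1, 0) \<notin> L \<and> odd (card L) \<and>
     (\<forall>u\<in>L. lcnj u \<in> L) \<and> (\<forall>u\<in>L. \<forall>v\<in>L. lmul u v \<in> L) \<and> (\<forall>u\<in>Lam. u \<in> L \<or> - u \<in> L)"

lemma odd_part_Lam: "odd_part L \<Longrightarrow> u \<in> L \<Longrightarrow> u \<in> Lam"
  by (auto simp: odd_part_def)

lemma odd_part_sum_lmul:
  assumes L: "odd_part L" and v: "v \<in> L"
  shows "(\<Sum>u\<in>L. F (lmul v u)) = sum F L"
proof -
  have vL: "v \<in> Lam" "lcnj v \<in> L" using assms by (auto simp: odd_part_def)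
  have "lmul v (lmul (lcnj v) u) = u" "lmul (lcnj v) (lmul v u) = u" for u
    using lmul_cnj[OF vL(1)] by (simp_all flip: lmul_assoc)
  then show ?thesis
    using L v vL by (intro sum.reindex_bij_witness[of _ "lmul (lcnj v)" "lmul v"]) (auto simp: odd_part_def)
qed

lemma odd_part_sum_lcnj:
  assumes L: "odd_part L"
  shows "(\<Sum>u\<in>L. F (lcnj u)) = sum F L"
  using L by (intro sum.reindex_bij_witness[of _ lcnj lcnj]) (auto simp: odd_part_def)

lemma char_sum:
  assumes L: "odd_part L" and c: "is_char \<theta>"
  shows "sum \<theta> L = (if \<forall>u\<in>Lam. \<theta> u = 1 then 1 else 0)"
proof (cases "\<forall>u\<in>Lam. \<theta> u = 1")
  case True
  then have "sum \<theta> L = of_nat (card L)" using L by (subst sum.cong[of L L _ "\<lambda>_. 1"]) (auto simp: odd_part_def)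
  then show ?thesis using True L by (auto simp: char2_of_nat[OF char2] odd_part_def)
next
  case False
  then obtain v0 where "v0 \<in> Lam" "\<theta> v0 \<noteq> 1" by blast
  then obtain v where v: "v \<in> L" "\<theta> v \<noteq> 1" using L char_minus[OF c] unfolding odd_part_def by metis
  have "sum \<theta> L = (\<Sum>u\<in>L. \<theta> (lmul v u))" by (rule odd_part_sum_lmul[OF L v(1), symmetric])
  also have "\<dots> = \<theta> v * sum \<theta> L"
    unfolding sum_distrib_left using odd_part_Lam[OF L] v(1) char_mult[OF c] by (intro sum.cong) auto
  finally have "(\<theta> v - 1) * sum \<theta> L = 0" by (simp add: left_diff_distrib)
  then have "sum \<theta> L = 0" using v(2) by simp
  then show ?thesis using False by auto
qed

text \<open>The product of the two traces expands into four character sums over \<open>L\<close>;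
  conjugation permutes \<open>L\<close> and makes them equal in pairs.\<close>

lemma sum_tr_tr:
  assumes L: "odd_part L" and c: "is_char \<theta>" "is_char \<theta>'" and u0: "u0 \<in> Lam"
  shows "(\<Sum>u\<in>L. tr \<theta>' u * tr \<theta> (lmul u u0)) =
    ((\<Sum>u\<in>L. \<theta>' u * \<theta> u) + (\<Sum>u\<in>L. \<theta>' u * \<theta> (lcnj u))) * tr \<theta> u0"
proof -
  let ?A = "\<Sum>u\<in>L. \<theta>' u * \<theta> u" and ?B = "\<Sum>u\<in>L. \<theta>' u * \<theta> (lcnj u)"
  have A: "(\<Sum>u\<in>L. \<theta>' (lcnj u) * \<theta> (lcnj u)) = ?A"
    by (rule odd_part_sum_lcnj[OF L, of "\<lambda>u. \<theta>' u * \<theta> u"])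
  have B: "(\<Sum>u\<in>L. \<theta>' (lcnj u) * \<theta> u) = ?B"
    using odd_part_sum_lcnj[OF L, of "\<lambda>u. \<theta>' u * \<theta> (lcnj u)"] by simp
  have "(\<Sum>u\<in>L. tr \<theta>' u * tr \<theta> (lmul u u0)) =
      (\<Sum>u\<in>L. (\<theta>' u * \<theta> u) * \<theta> u0 + (\<theta>' u * \<theta> (lcnj u)) * \<theta> (lcnj u0)
        + ((\<theta>' (lcnj u) * \<theta> u) * \<theta> u0 + (\<theta>' (lcnj u) * \<theta> (lcnj u)) * \<theta> (lcnj u0)))"
    using odd_part_Lam[OF L] u0 c by (intro sum.cong) (simp_all add: tr_def lcnj_lmul char_mult algebra_simps)
  also have "\<dots> = (?A * \<theta> u0 + ?B * \<theta> (lcnj u0)) + (?B * \<theta> u0 + ?A * \<theta> (lcnj u0))"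
    unfolding sum.distrib sum_distrib_right[symmetric] A B ..
  finally show ?thesis by (simp add: tr_def algebra_simps)
qed

lemma odd_part_snd_neq_0:
  assumes L: "odd_part L" and u: "u \<in> L - {(1, 0)}"
  shows "snd u \<noteq> 0"
proof
  assume s: "snd u = 0"
  have "u \<in> Lam" using u odd_part_Lam[OF L] by simp
  then have "(fst u)^2 = 1" using s by (simp add: Lam_iff)
  then have "fst u = 1 \<or> fst u = - 1" by (simp add: power2_eq_1_iff)
  then show False using s u L by (cases u) (auto simp: odd_part_def)
qed

lemma odd_part_param:
  assumes L: "odd_part L" and h: "- h = nu * eta^2" and u: "u \<in> L - {(1, 0)}"
  shows "(fst u * eta / snd u)^2 - h = (eta / snd u)^2"
proof -
  have n: "(fst u)^2 + nu * (snd u)^2 = 1" using u odd_part_Lam[OF L] by (simp add: Lam_iff)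
  have "(fst u * eta / snd u)^2 - h = (fst u * eta / snd u)^2 + nu * eta^2" using h by simp
  also have "\<dots> = ((fst u)^2 + nu * (snd u)^2) * (eta / snd u)^2"
    using odd_part_snd_neq_0[OF L u] by (simp add: power_divide power_mult_distrib field_simps)
  finally show ?thesis using n by simp
qed

lemma nonsq_cases:
  assumes "\<not> is_sq x"
  obtains t where "x = nu * t^2" "t \<noteq> 0"
proof -
  obtain c where c: "nu * x = c^2" using nonsq_mult_nonsq[OF odd nonsq assms] by (auto simp: is_sq_def)
  then have "x = nu * (c / nu)^2" by (simp add: power_divide power2_eq_square field_simps)
  moreover from this have "c / nu \<noteq> 0" using assms by auto
  ultimately show ?thesis using that by blast
qed

text \<open>If \<open>b^2 - h = m^2\<close>, then \<open>b^2 + nu * eta^2 = m^2\<close>, so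
  \<open>(b / m, eta / m)\<close> has norm one. The sign of \<open>m\<close> is free, and exactly
  one choice lands in \<open>L\<close>. The excluded element (1, 0) would correspond to the point
  \<open>pinf 0\<close> of the axis.\<close>

lemma odd_part_reindex:
  assumes L: "odd_part L" and h: "- h = nu * eta^2" "eta \<noteq> 0"
  shows "bij_betw (\<lambda>u. fst u * eta / snd u) (L - {(1, 0)}) {b. is_sq (b^2 - h) \<and> b^2 \<noteq> h}"
proof -
  note snd0 = odd_part_snd_neq_0[OF L] and img = odd_part_param[OF L h(1)]
  show ?thesis
    unfolding bij_betw_def
  proof (intro conjI inj_onI set_eqI iffI)
    fix u v assume u: "u \<in> L - {(1, 0)}" and v: "v \<in> L - {(1, 0)}"
      and "fst u * eta / snd u = fst v * eta / snd v"
    then have "fst u * snd v = fst v * snd u" using snd0[OF u] snd0[OF v] h(2)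
      by (simp add: frac_eq_eq)
    then have "snd (lmul u (lcnj v)) = 0" by (cases u; cases v) (simp add: algebra_simps)
    moreover have w: "lmul u (lcnj v) \<in> L" using L u v by (auto simp: odd_part_def)
    ultimately have "lmul u (lcnj v) = (1, 0)"
    proof -
      assume s: "snd (lmul u (lcnj v)) = 0"
      show ?thesis
      proof (rule ccontr)
        assume "lmul u (lcnj v) \<noteq> (1, 0)"
        then show False using snd0[of "lmul u (lcnj v)"] w s by auto
      qed
    qed
    then have "lmul (lmul u (lcnj v)) v = v" by simp
    then show "u = v" using lmul_cnj(2)[of v] v odd_part_Lam[OF L] unfolding lmul_assoc by simp
  next
    fix b assume "b \<in> (\<lambda>u. fst u * eta / snd u) ` (L - {(1, 0)})"
    then obtain u where u: "u \<in> L - {(1, 0)}" "b = fst u * eta / snd u" by blast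
    have "b^2 - h = (eta / snd u)^2" unfolding u(2) by (rule img[OF u(1)])
    moreover have "(eta / snd u)^2 \<noteq> 0" using snd0[OF u(1)] h(2) by simp
    ultimately show "b \<in> {b. is_sq (b^2 - h) \<and> b^2 \<noteq> h}" by auto
  next
    fix b assume b: "b \<in> {b. is_sq (b^2 - h) \<and> b^2 \<noteq> h}"
    then obtain m where m: "b^2 - h = m^2" by (auto simp: is_sq_def)
    then have m0: "m \<noteq> 0" using b by auto
    let ?u = "(b / m, eta / m)"
    have "b^2 + nu * eta^2 = m^2" unfolding h(1)[symmetric] m[symmetric] by simp
    then have "?u \<in> Lam" using m0 by (simp add: Lam_def power_divide flip: add_divide_distrib)
    moreover have "b = fst ?u * eta / snd ?u" "b = fst (- ?u) * eta / snd (- ?u)" using m0 h by simp_all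
    moreover have "?u \<noteq> (1, 0)" "- ?u \<noteq> (1, 0)" using m0 h by auto
    ultimately show "b \<in> (\<lambda>u. fst u * eta / snd u) ` (L - {(1, 0)})"
      using L unfolding odd_part_def by blast
  qed
qed

text \<open>If \<open>- h\<close> is a square, the kernel vanishes on the external points of the
  axis. Otherwise these points are parametrised by \<open>L\<close>, where \<open>Kk\<close> becomes
  the trace of \<open>\<theta>'\<close> at \<open>u\<close> and \<open>Bt\<close> that of
  \<open>\<theta>\<close> at \<open>lmul u u0\<close>, with \<open>u0\<close> encoding
  \<open>P\<close>. The matrix product is thus a convolution of traces.\<close>

lemma Kk_Bt:
  assumes L: "odd_part L" and c: "is_char \<theta>" "is_char \<theta>'"
    and Q: "Q \<in> external_points" and P: "P \<in> internal_points"
  shows "(\<Sum>R\<in>external_points. Kk \<theta>' Q R * Bt \<theta> R P) =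
    ((\<Sum>u\<in>L. \<theta>' u * \<theta> u) + (\<Sum>u\<in>L. \<theta>' u * \<theta> (lcnj u))) * Bt \<theta> Q P"
proof (rule invariant_sum_eqI[where r = "\<lambda>Q P. _ * Bt \<theta> Q P", OF _ _ _ _ _ Q P])
  fix P assume "P \<in> (internal_points :: 'k point set)"
  then obtain p h where P: "P = pf p h" "\<not> is_sq (p^2 - h)" by (rule internal_cases)
  have h: "h \<noteq> 0" by (rule internal_coord_neq_0[OF P(2)])
  have ph: "p^2 \<noteq> h" "p^2 - h \<noteq> 0" using P(2) by auto
  let ?B = "{b. is_sq (b^2 - h) \<and> b^2 \<noteq> h}"
  let ?c = "(\<Sum>u\<in>L. \<theta>' u * \<theta> u) + (\<Sum>u\<in>L. \<theta>' u * \<theta> (lcnj u))"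
  have "(\<Sum>R\<in>external_points. Kk \<theta>' (pinf 0) R * Bt \<theta> R P) =
      (\<Sum>b\<in>?B. Kk \<theta>' (pinf 0) (pf b h) * Bt \<theta> (pf b h) (pf p h))"
    unfolding P(1) by (rule sum_kernel_refl) (use h c in \<open>simp_all add: Kk_pinf_0_pf, simp add: Kk_def\<close>)
  also have "\<dots> = (\<Sum>b\<in>?B. kern \<theta>' (b^2 / (b^2 - h)) * Bt \<theta> (pf b h) (pf p h))"
    by (simp add: Kk_pinf_0_pf)
  also have "\<dots> = ?c * Bt \<theta> (pinf 0) P"
  proof (cases "is_sq (- h)")
    case True
    have "kern \<theta>' (b^2 / (b^2 - h)) = 0" if "b \<in> ?B" for b
    proof (rule kern_sq_compl[OF c(2)])
      have b: "is_sq (b^2 - h)" "b^2 - h \<noteq> 0" using that by auto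
      have "1 - b^2 / (b^2 - h) = - h / (b^2 - h)"
      proof -
        have "1 - b^2 / (b^2 - h) = (b^2 - h) / (b^2 - h) - b^2 / (b^2 - h)" using b(2) by simp
        also have "\<dots> = - h / (b^2 - h)" by (simp only: diff_divide_distrib[symmetric]) simp
        finally show ?thesis .
      qed
      moreover have "is_sq (- h / (b^2 - h))" unfolding is_sq_divide using True b(1) is_sq_mult by blast
      ultimately show "is_sq (1 - b^2 / (b^2 - h))" by simp
      show "b^2 / (b^2 - h) \<noteq> 1" using b(2) h by (simp add: divide_eq_eq)
    qed
    then have "(\<Sum>b\<in>?B. kern \<theta>' (b^2 / (b^2 - h)) * Bt \<theta> (pf b h) (pf p h)) = 0"
      by (intro sum.neutral) simp
    moreover have "Bt \<theta> (pinf 0) P = 0"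
      unfolding Bt_def P(1) one_minus_rr_pinf_0[OF ph(1)] using kern_nonsq_arg[OF c(1) True P(2)] by simp
    ultimately show ?thesis by simp
  next
    case False
    obtain eta where eta: "- h = nu * eta^2" "eta \<noteq> 0" using nonsq_cases[OF False] .
    obtain t where t: "p^2 - h = nu * t^2" "t \<noteq> 0" using nonsq_cases[OF P(2)] .
    \<comment> \<open>The first coordinate is forced by
      \<open>1 - rr (pinf 0) P = (eta / t)^2\<close>. The second makes the norm 1, with the sign for
      which \<open>fst (lmul u u0)\<close> equals \<open>snd u * (b - p) / t\<close> below.\<close>
    define u0 where "u0 = (eta / t, p / (nu * t))"
    have "nu * eta^2 + p^2 = nu * t^2" unfolding eta(1)[symmetric] t(1)[symmetric] by simp
    moreover have "(eta / t)^2 + nu * (p / (nu * t))^2 = (nu * eta^2 + p^2) / (nu * t^2)"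
      using t(2) by (simp add: power_divide power_mult_distrib field_simps power2_eq_square)
    ultimately have u0: "u0 \<in> Lam" using t(2) by (simp add: u0_def Lam_iff)
    have "1 - rr (pinf 0) (pf p h) = (fst u0)^2"
      unfolding one_minus_rr_pinf_0[OF ph(1)] t(1) eta(1) u0_def by (simp add: power_divide)
    then have B0: "Bt \<theta> (pinf 0) P = tr \<theta> u0"
      unfolding P(1) Bt_def by (rule kern_eq_tr[OF c(1) u0])
    have summand: "kern \<theta>' (b^2 / (b^2 - h)) * Bt \<theta> (pf b h) (pf p h) = tr \<theta>' u * tr \<theta> (lmul u u0)"
      if u: "u \<in> L - {(1, 0)}" and b: "b = fst u * eta / snd u" for u b
    proof -
      have uL: "u \<in> Lam" using u odd_part_Lam[OF L] by simp
      have s0: "snd u \<noteq> 0" by (rule odd_part_snd_neq_0[OF L u])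
      have bh: "b^2 - h = (eta / snd u)^2" unfolding b by (rule odd_part_param[OF L eta(1) u])
      have bh0: "b^2 - h \<noteq> 0" unfolding bh using eta s0 by simp
      have "b^2 / (b^2 - h) = (fst u)^2" unfolding bh using b eta(2) s0 by (simp add: power_divide power_mult_distrib)
      then have k: "kern \<theta>' (b^2 / (b^2 - h)) = tr \<theta>' u" using c(2) uL s0 by (simp add: kern_power2 trS_eq_tr)
      have frac: "1 - x / y = (y - x) / y" if "y \<noteq> 0" for x y :: 'k
        using that by (simp add: diff_divide_distrib)
      have "(b^2 - h) * (p^2 - h) - (b * p - h)^2 = (- h) * (b - p)^2"
        by (simp add: power2_eq_square algebra_simps)
      then have "1 - rr (pf b h) (pf p h) = (- h) * (b - p)^2 / ((b^2 - h) * (p^2 - h))"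
        unfolding rr_same_h using frac[of "(b^2 - h) * (p^2 - h)"] bh0 ph(2) by simp
      also have "\<dots> = (snd u * (b - p) / t)^2"
        unfolding eta(1) bh t(1) using eta(2) s0 t(2) by (simp add: power_divide power_mult_distrib)
      also have "snd u * (b - p) = fst u * eta - snd u * p"
        unfolding b using s0 by (simp add: algebra_simps)
      also have "(fst u * eta - snd u * p) / t = fst (lmul u u0)"
        using t(2) by (cases u) (simp add: u0_def diff_divide_distrib)
      finally have "1 - rr (pf b h) (pf p h) = (fst (lmul u u0))^2" .
      then have "Bt \<theta> (pf b h) (pf p h) = tr \<theta> (lmul u u0)"
        unfolding Bt_def using kern_eq_tr[OF c(1) Lam_mult[OF uL u0]] by blast
      then show ?thesis using k by simp
    qed
    have "(\<Sum>b\<in>?B. kern \<theta>' (b^2 / (b^2 - h)) * Bt \<theta> (pf b h) (pf p h)) =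
        (\<Sum>u\<in>L - {(1, 0)}. tr \<theta>' u * tr \<theta> (lmul u u0))"
      unfolding sum.reindex_bij_betw[OF odd_part_reindex[OF L eta], symmetric]
      using summand by (intro sum.cong) auto
    also have "\<dots> = (\<Sum>u\<in>L. tr \<theta>' u * tr \<theta> (lmul u u0))"
      by (rule sum.mono_neutral_left) auto
    also have "\<dots> = ?c * Bt \<theta> (pinf 0) P" unfolding B0 by (rule sum_tr_tr[OF L c u0])
    finally show ?thesis .
  qed
  finally show "(\<Sum>R\<in>external_points. Kk \<theta>' (pinf 0) R * Bt \<theta> R P) = ?c * Bt \<theta> (pinf 0) P" .
qed (use invariant_kernels(4)[of \<theta>] in \<open>auto simp: invariant_def[of "\<lambda>Q P. _ * Bt \<theta> Q P"] invariantD\<close>)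

lemma rr_ext_int:
  assumes "Q \<in> external_points" "P \<in> internal_points" "rr Q P \<noteq> (0::'k)"
  shows "\<not> is_sq (rr Q P)"
proof -
  obtain v where v: "Q = proj v" "qf v \<noteq> 0" "is_sq (qf v)" using assms(1) by (auto simp: external_points_eq)
  obtain w where w: "P = proj w" "\<not> is_sq (qf w)" using assms(2) by (auto simp: internal_points_eq)
  have [simp]: "v \<noteq> 0" "w \<noteq> 0" using v w by auto
  have r: "rr Q P = (bf v w)^2 / (2^2 * (qf v * qf w))" using v(1) w(1) by (simp add: rv_def mult.assoc)
  have b: "bf v w \<noteq> 0" using assms(3) r by auto
  have "is_sq (rr Q P) \<longleftrightarrow> is_sq ((bf v w)^2 * (2^2 * (qf v * qf w)))" unfolding r is_sq_divide ..
  also have "\<dots> \<longleftrightarrow> is_sq (qf w)"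
    unfolding is_sq_power2_mult_iff[OF b] is_sq_power2_mult_iff[OF two] is_sq_mult_iff[OF v(3,2)] ..
  finally show ?thesis using w(2) by simp
qed

text \<open>Away from \<open>rr Q P = 0\<close> the traces add up to 1 exactly where
  \<open>1 - rr Q P\<close> is a square, whereas \<open>Dk\<close> tests \<open>rr Q P - 1\<close>.
  If -1 is not a square, the two conditions are complementary, and this is where the all-one matrix
  comes from.\<close>

lemma sum_Bt:
  fixes \<theta> :: "'i \<Rightarrow> 'k \<times> 'k \<Rightarrow> 'f"
  assumes c: "\<And>i. i \<in> J \<Longrightarrow> is_char (\<theta> i)"
    and sum: "\<And>u. u \<in> Lam \<Longrightarrow> snd u \<noteq> 0 \<Longrightarrow> (\<Sum>i\<in>J. tr (\<theta> i) u) = 1"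
    and Q: "Q \<in> external_points" and P: "P \<in> internal_points"
  shows "(\<Sum>i\<in>J. Bt (\<theta> i) Q P) = Bk Q P + Dk Q P + (if CARD('k) mod 4 = 1 then 0 else 1)"
proof (cases "rr Q P = 0")
  case True
  then show ?thesis using is_sq_neg_1[OF odd] by (simp add: Bt_def Bk_def Dk_def)
next
  case False
  have ns: "\<not> is_sq (rr Q P)" by (rule rr_ext_int[OF Q P False])
  then have r1: "rr Q P - 1 \<noteq> 0" "rr Q P \<noteq> 1" by auto
  obtain e where e: "rr Q P = nu * e^2" "e \<noteq> 0" using nonsq_cases[OF ns] .
  have "(\<Sum>i\<in>J. Bt (\<theta> i) Q P) = (if is_sq (1 - rr Q P) then 1 else 0)"
  proof (cases "is_sq (1 - rr Q P)")
    case True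
    then obtain a where a: "1 - rr Q P = a^2" by (auto simp: is_sq_def)
    have u: "(a, e) \<in> Lam" using a e(1) unfolding Lam_iff by (simp flip: a)
    have "(\<Sum>i\<in>J. Bt (\<theta> i) Q P) = (\<Sum>i\<in>J. tr (\<theta> i) (a, e))"
      using kern_eq_tr[OF c u, of _ "rr Q P"] a by (intro sum.cong) (auto simp: Bt_def)
    then show ?thesis using sum[OF u] e(2) True by simp
  qed (simp add: Bt_def False kern_nonsq)
  also have "is_sq (1 - rr Q P) \<longleftrightarrow> (if CARD('k) mod 4 = 1 then is_sq (rr Q P - 1) else \<not> is_sq (rr Q P - 1))"
  proof -
    have eq: "1 - rr Q P = (- 1) * (rr Q P - 1)" by simp
    show ?thesis
      unfolding eq using is_sq_mult_iff[of "- 1" "rr Q P - 1"] nonsq_mult_iff[OF odd, of "- 1" "rr Q P - 1"]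
        is_sq_neg_1[OF odd] r1 by auto
  qed
  finally show ?thesis using False by (simp add: Bk_def Dk_def)
qed

text \<open>\<open>Dk (pinf b) P\<close> is symmetric under b to 2 p - b. At the fixed point
  \<open>b = p\<close> it tests whether -1 is a square, which fails here. This later separates the
  image of \<open>phi_D\<close> from the constants.\<close>

lemma sum_Dk_pinf:
  assumes q: "CARD('k) mod 4 = 3" and P: "P \<in> internal_points"
  shows "(\<Sum>b\<in>UNIV. Dk (pinf b) P) = 0"
proof -
  obtain p h where P: "P = pf p h" "\<not> is_sq (p^2 - h)" using P by (rule internal_cases)
  have "(p - (2 * p - b))^2 = (p - b)^2" for b by (simp add: power2_eq_square algebra_simps)
  then have inv: "Dk (pinf (2 * p - b)) P = Dk (pinf b) P" for b by (simp add: P Dk_def)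
  have "(\<Sum>b\<in>UNIV. Dk (pinf b) P) = (\<Sum>b | b \<in> UNIV \<and> 2 * p - b = b. Dk (pinf b) P)"
    by (rule sum_involution[OF char2]) (use inv in auto)
  also have "{b. b \<in> UNIV \<and> 2 * p - b = b} = {p}"
  proof -
    have "2 * p - b = b \<longleftrightarrow> 2 * (p - b) = 0" for b :: 'k by (auto simp: algebra_simps)
    then show ?thesis by auto
  qed
  also have "(\<Sum>b\<in>{p}. Dk (pinf b) P) = 0"
    using is_sq_neg_1[OF odd] q by (simp add: P Dk_def)
  finally show ?thesis .
qed

lemma char_sum_Lam:
  assumes "is_char \<theta>"
  shows "sum \<theta> Lam = 0"
proof -
  have "sum \<theta> Lam = sum \<theta> {u \<in> Lam. - u = u}"
    by (rule sum_involution[OF char2]) (use char_minus[OF assms] in auto)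
  also have "{u \<in> Lam. - u = u} = {}"
    by (auto simp: Lam_def)
  finally show ?thesis by simp
qed

lemma sum_trS: "is_char \<theta> \<Longrightarrow> (\<Sum>a\<in>UNIV. trS \<theta> a) = 0"
proof -
  have "(\<Sum>a\<in>UNIV. trS \<theta> a) = (\<Sum>(a, e)\<in>(SIGMA a:UNIV. {e. (a, e) \<in> Lam}). \<theta> (a, e))"
    unfolding trS_def by (rule sum.Sigma) auto
  also have "(SIGMA a:UNIV. {e. (a, e) \<in> Lam}) = Lam" by auto
  finally show "is_char \<theta> \<Longrightarrow> ?thesis" using char_sum_Lam[of \<theta>] by simp
qed

subsection \<open>The multiplication formula\<close>

lemma card_Lam_even: "(of_nat (card Lam) :: 'f) = 0"
  using char_sum_Lam[of "\<lambda>_. 1"] by (simp add: is_char_def)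

text \<open>Modulo two, only the real element contributes to the number of elements of given norm
  and real part.\<close>

lemma count_norm_real:
  assumes s: "z1^2 + nu * z2^2 \<noteq> 0"
  shows "(of_nat (card {u \<in> Lam. fst u * z1 - nu * snd u * z2 = be}) :: 'f) =
    (if be^2 = z1^2 + nu * z2^2 then 1 else 0)"
proof -
  let ?s = "z1^2 + nu * z2^2"
  let ?U = "{u \<in> Lam. fst u * z1 - nu * snd u * z2 = be}" and ?Y = "{y. be^2 + nu * y^2 = ?s}"
  \<comment> \<open>The product of \<open>u\<close> with z = (z1, z2) has real part
    \<open>be\<close>, and \<open>u\<close> is mapped to its imaginary part \<open>y\<close>. The
    inverse divides (be, y) by z, that is, multiplies by the conjugate of z over the norm
    \<open>?s\<close>. Afterwards y to -y leaves only \<open>y = 0\<close>.\<close>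
  have "bij_betw (\<lambda>u. fst u * z2 + snd u * z1) ?U ?Y"
  proof (rule bij_betwI[where g = "\<lambda>y. ((be * z1 + nu * y * z2) / ?s, (y * z1 - be * z2) / ?s)"])
    show "(\<lambda>u. fst u * z2 + snd u * z1) \<in> ?U \<rightarrow> ?Y"
    proof
      fix u assume u: "u \<in> ?U"
      then have "(fst u)^2 + nu * (snd u)^2 = 1" by (simp add: Lam_iff)
      moreover have "(fst u * z1 - nu * snd u * z2)^2 + nu * (fst u * z2 + snd u * z1)^2 =
          ((fst u)^2 + nu * (snd u)^2) * ?s" by (simp add: power2_eq_square algebra_simps)
      ultimately show "fst u * z2 + snd u * z1 \<in> ?Y" using u by simp
    qed
    show "(\<lambda>y. ((be * z1 + nu * y * z2) / ?s, (y * z1 - be * z2) / ?s)) \<in> ?Y \<rightarrow> ?U"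
    proof
      fix y assume y: "y \<in> ?Y"
      have "(be * z1 + nu * y * z2)^2 + nu * (y * z1 - be * z2)^2 = (be^2 + nu * y^2) * ?s"
        by (simp add: power2_eq_square algebra_simps)
      then have "((be * z1 + nu * y * z2) / ?s)^2 + nu * ((y * z1 - be * z2) / ?s)^2 = 1"
        using y s by (simp add: power_divide power2_eq_square flip: add_divide_distrib)
      moreover have "(be * z1 + nu * y * z2) * z1 - nu * (y * z1 - be * z2) * z2 = be * ?s"
        by (simp add: power2_eq_square algebra_simps)
      then have "(be * z1 + nu * y * z2) / ?s * z1 - nu * ((y * z1 - be * z2) / ?s) * z2 = be"
        using s by (simp add: diff_divide_eq_iff divide_eq_eq flip: diff_divide_distrib)
      ultimately show "((be * z1 + nu * y * z2) / ?s, (y * z1 - be * z2) / ?s) \<in> ?U"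
        by (simp add: Lam_iff)
    qed
    show "((be * z1 + nu * (fst u * z2 + snd u * z1) * z2) / ?s, ((fst u * z2 + snd u * z1) * z1 - be * z2) / ?s) = u"
      if "u \<in> ?U" for u
    proof -
      have b: "be = fst u * z1 - nu * snd u * z2" using that by simp
      have "be * z1 + nu * (fst u * z2 + snd u * z1) * z2 = fst u * ?s"
        "(fst u * z2 + snd u * z1) * z1 - be * z2 = snd u * ?s"
        unfolding b by (simp_all add: power2_eq_square algebra_simps)
      then show ?thesis using s by simp
    qed
    show "fst ((be * z1 + nu * y * z2) / ?s, (y * z1 - be * z2) / ?s) * z2 +
        snd ((be * z1 + nu * y * z2) / ?s, (y * z1 - be * z2) / ?s) * z1 = y" if "y \<in> ?Y" for y
    proof -
      have "(be * z1 + nu * y * z2) * z2 + (y * z1 - be * z2) * z1 = y * ?s"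
        by (simp add: power2_eq_square algebra_simps)
      then show ?thesis using s by (simp flip: add_divide_distrib)
    qed
  qed
  then have "card ?U = card ?Y" by (rule bij_betw_same_card)
  then have "(of_nat (card ?U) :: 'f) = (\<Sum>y\<in>?Y. 1)" by simp
  also have "\<dots> = (\<Sum>y\<in>{y \<in> ?Y. - y = y}. 1)"
    by (rule sum_involution[OF char2]) auto
  also have "{y \<in> ?Y. - y = y} = (if be^2 = ?s then {0} else {})" by auto
  finally show ?thesis by simp
qed

text \<open>Now z = (z1, z2) is a zero divisor, and norm one together with the condition on the real
  part becomes linear: \<open>2 * fst u * be * z1 = be^2 + z1^2\<close>. This has one solution if
  \<open>be \<noteq> 0\<close> and none otherwise.\<close>

lemma count_norm_isotropic:
  assumes s: "z1^2 + nu * z2^2 = 0" and z: "z1 \<noteq> 0 \<or> z2 \<noteq> 0"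
  shows "(of_nat (card {u \<in> Lam. fst u * z1 - nu * snd u * z2 = be}) :: 'f) = (if be = 0 then 0 else 1)"
proof -
  have z0: "z1 \<noteq> 0" "z2 \<noteq> 0" using s z by auto
  let ?U = "{u \<in> Lam. fst u * z1 - nu * snd u * z2 = be}"
  have eq: "2 * fst u * be * z1 = be^2 + z1^2" if "u \<in> ?U" for u
  proof -
    have "(fst u)^2 + nu * (snd u)^2 = 1" "fst u * z1 - nu * snd u * z2 = be" using that by (auto simp: Lam_iff)
    then show ?thesis using s by algebra
  qed
  show ?thesis
  proof (cases "be = 0")
    case True
    have "?U = {}" using eq z0 True by fastforce
    then have "card ?U = 0" by (simp only: card.empty)
    then show ?thesis using True by (simp only: of_nat_0 refl if_True)
  next
    case False
    define a where "a = (be^2 + z1^2) / (2 * be * z1)"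
    define e where "e = (a * z1 - be) / (nu * z2)"
    have a: "2 * a * be * z1 = be^2 + z1^2" using False z0 by (simp add: a_def)
    have e: "nu * e * z2 = a * z1 - be" using z0 by (simp add: e_def)
    have "(a * z1 - be)^2 = nu * e^2 * (nu * z2^2)" unfolding e[symmetric] by (simp add: power2_eq_square)
    also have "nu * z2^2 = - (z1^2)" using s by (simp add: add_eq_0_iff)
    finally have "(a^2 + nu * e^2) * z1^2 = 1 * z1^2" using a by (simp add: power2_eq_square algebra_simps)
    then have "a^2 + nu * e^2 = 1" using z0 by (metis mult_right_cancel power_not_zero)
    then have "(a, e) \<in> ?U" using e by (simp add: Lam_iff)
    moreover have "u = (a, e)" if u: "u \<in> ?U" for u
    proof -
      have "2 * be * z1 * fst u = 2 * be * z1 * a" using eq[OF u] a by (simp add: mult_ac)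
      then have fa: "fst u = a" using False z0 two by (simp add: mult_left_cancel)
      have "fst u * z1 - nu * snd u * z2 = be" using u by simp
      then have "nu * snd u * z2 = nu * e * z2" unfolding e fa by (simp only: diff_eq_eq eq_diff_eq add.commute)
      then have "snd u = e" using z0 by simp
      then show ?thesis using fa by (cases u) simp
    qed
    ultimately have "?U = {(a, e)}" by blast
    then show ?thesis using False by simp
  qed
qed

lemma Kk_pf_pinf:
  assumes "is_char \<theta>" "n \<noteq> 0"
  shows "Kk \<theta> (pf b (b^2 - n^2)) (pinf c) = trS \<theta> ((b - c) / n)"
    "Kk \<theta> (pinf c) (pf b (b^2 - n^2)) = trS \<theta> ((b - c) / n)"
proof -
  have "(b - c)^2 / n^2 = ((b - c) / n)^2" by (simp add: power_divide)
  then show "Kk \<theta> (pf b (b^2 - n^2)) (pinf c) = trS \<theta> ((b - c) / n)"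
    using assms by (simp add: Kk_def kern_power2)
  then show "Kk \<theta> (pinf c) (pf b (b^2 - n^2)) = trS \<theta> ((b - c) / n)"
    by (simp add: Kk_commute)
qed

lemma trS_eq_sum_Lam: "trS \<theta> a = (\<Sum>u\<in>Lam. if fst u = a then \<theta> u else 0)"
proof -
  have "(\<Sum>u\<in>Lam. if fst u = a then \<theta> u else 0) = sum \<theta> {u \<in> Lam. fst u = a}"
    by (rule sum.inter_filter[symmetric]) simp
  also have "\<dots> = trS \<theta> a" unfolding trS_def
    by (rule sum.reindex_bij_witness[of _ "\<lambda>e. (a, e)" snd]) auto
  finally show ?thesis ..
qed

text \<open>Between points \<open>pinf\<close> the kernel is 1 off the diagonal. As \<theta> has sum
  0 over \<open>Lam\<close>, only the correction for \<open>b + m * fst u = b'\<close> remains, and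
  this is a value of \<open>trS\<close>.\<close>

lemma mult_formula_pinf:
  assumes c: "is_char \<theta>" and m: "m \<noteq> 0"
  shows "Kk \<theta> (pinf b') (pf b (b^2 - m^2)) = (\<Sum>u\<in>Lam. \<theta> u * Kk \<theta> (pinf b') (pinf (b + m * fst u)))"
proof -
  have "(\<Sum>u\<in>Lam. \<theta> u * Kk \<theta> (pinf b') (pinf (b + m * fst u))) =
      (\<Sum>u\<in>Lam. \<theta> u + (if fst u = (b' - b) / m then \<theta> u else 0))"
  proof (rule sum.cong[OF refl])
    fix u :: "'k \<times> 'k"
    have "b' = b + m * fst u \<longleftrightarrow> fst u = (b' - b) / m" using m by (auto simp: field_simps)
    then show "\<theta> u * Kk \<theta> (pinf b') (pinf (b + m * fst u)) =
        \<theta> u + (if fst u = (b' - b) / m then \<theta> u else 0)"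
      using c by (simp add: Kk_def kern_1)
  qed
  also have "\<dots> = trS \<theta> ((b' - b) / m)"
    unfolding sum.distrib trS_eq_sum_Lam char_sum_Lam[OF c] by simp
  also have "\<dots> = trS \<theta> ((b - b') / m)"
    using trS_minus[OF c, of "(b' - b) / m"] by (simp only: minus_divide_left minus_diff_eq)
  finally show ?thesis using Kk_pf_pinf(2)[OF c m] by simp
qed

text \<open>The defect of the multiplication formula: the sum of \<theta> over the \<open>w\<close>
  for which m - n w is a nonzero element of norm zero. Neither \<open>b\<close> nor
  \<open>b'\<close> occurs in it.\<close>

definition Zv :: "('k \<times> 'k \<Rightarrow> 'f) \<Rightarrow> 'k \<Rightarrow> 'k \<Rightarrow> 'f" where
  "Zv \<theta> m n = (\<Sum>w\<in>Lam. if (m - n * fst w)^2 + nu * (n * snd w)^2 = 0 \<and> (m - n * fst w \<noteq> 0 \<or> n * snd w \<noteq> 0)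
     then \<theta> w else 0)"

text \<open>Writing \<open>trS\<close> as a sum over \<open>v\<close> and substituting w = u v
  leaves, for each \<open>w\<close>, a number of elements \<open>u\<close>: those for which the
  product of \<open>u\<close> with m - n times the conjugate of \<open>w\<close> has real part
  \<open>be\<close>.\<close>

lemma convolution_Lam:
  assumes c: "is_char \<theta>" and n: "n \<noteq> 0"
  shows "(\<Sum>u\<in>Lam. \<theta> u * trS \<theta> ((m * fst u - be) / n)) =
    (\<Sum>w\<in>Lam. \<theta> w * of_nat (card {u \<in> Lam. fst u * (m - n * fst w) - nu * snd u * (n * snd w) = be}))"
proof -
  have "(\<Sum>u\<in>Lam. \<theta> u * trS \<theta> ((m * fst u - be) / n)) =
      (\<Sum>u\<in>Lam. \<Sum>v\<in>Lam. if fst v = (m * fst u - be) / n then \<theta> u * \<theta> v else 0)"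
    unfolding trS_eq_sum_Lam sum_distrib_left by (intro sum.cong) auto
  also have "\<dots> = (\<Sum>u\<in>Lam. \<Sum>w\<in>Lam. if fst (lmul w (lcnj u)) = (m * fst u - be) / n then \<theta> w else 0)"
  proof (rule sum.cong[OF refl])
    fix u assume u: "u \<in> Lam"
    have uw: "lmul u (lmul w (lcnj u)) = w" "lmul (lmul u w) (lcnj u) = w" for w
      using lmul_cnj[OF u] by (metis lmul_1(2) lmul_assoc lmul_commute)+
    have "(\<Sum>v\<in>Lam. if fst v = (m * fst u - be) / n then \<theta> u * \<theta> v else 0) =
        (\<Sum>w\<in>Lam. if fst (lmul w (lcnj u)) = (m * fst u - be) / n then \<theta> u * \<theta> (lmul w (lcnj u)) else 0)"
      by (rule sum.reindex_bij_witness[of _ "\<lambda>w. lmul w (lcnj u)" "\<lambda>v. lmul u v"]) (use u uw in auto)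
    also have "\<dots> = (\<Sum>w\<in>Lam. if fst (lmul w (lcnj u)) = (m * fst u - be) / n then \<theta> w else 0)"
      using u uw by (intro sum.cong) (auto simp flip: char_mult[OF c])
    finally show "(\<Sum>v\<in>Lam. if fst v = (m * fst u - be) / n then \<theta> u * \<theta> v else 0) =
        (\<Sum>w\<in>Lam. if fst (lmul w (lcnj u)) = (m * fst u - be) / n then \<theta> w else 0)" .
  qed
  also have "\<dots> = (\<Sum>u\<in>Lam. \<Sum>w\<in>Lam.
      if fst u * (m - n * fst w) - nu * snd u * (n * snd w) = be then \<theta> w else 0)"
  proof -
    have "fst (lmul w (lcnj u)) = (m * fst u - be) / n \<longleftrightarrow>
        fst u * (m - n * fst w) - nu * snd u * (n * snd w) = be" for u w
    proof -
      have "fst (lmul w (lcnj u)) = fst w * fst u + nu * snd w * snd u" by (cases w; cases u) simp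
      then show ?thesis using n by (auto simp: eq_divide_eq algebra_simps)
    qed
    then show ?thesis by simp
  qed
  also have "\<dots> = (\<Sum>w\<in>Lam. \<Sum>u\<in>Lam.
      if fst u * (m - n * fst w) - nu * snd u * (n * snd w) = be then \<theta> w else 0)"
    by (rule sum.swap)
  also have "\<dots> = (\<Sum>w\<in>Lam. \<theta> w * of_nat (card {u \<in> Lam. fst u * (m - n * fst w) - nu * snd u * (n * snd w) = be}))"
  proof (rule sum.cong[OF refl])
    fix w
    show "(\<Sum>u\<in>Lam. if fst u * (m - n * fst w) - nu * snd u * (n * snd w) = be then \<theta> w else 0) =
      \<theta> w * of_nat (card {u \<in> Lam. fst u * (m - n * fst w) - nu * snd u * (n * snd w) = be})"
      by (subst sum.inter_filter[symmetric]) (simp_all add: mult.commute)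
  qed
  finally show ?thesis .
qed

text \<open>Both sides become sums over \<open>w\<close>. The left side selects the \<open>w\<close>
  for which the norm \<open>?s w\<close> is \<open>be^2\<close>, and for nonzero norm the parity of
  the count selects the same \<open>w\<close>. Nonzero elements of norm zero produce
  \<open>Zv\<close>. The zero element occurs only for \<open>m^2 = n^2\<close>; its count is 0 or
  the even number \<open>card Lam\<close>, and on the diagonal the left side is 0 by definition of
  \<open>Kk\<close>.\<close>

lemma mult_formula_pf:
  assumes c: "is_char \<theta>" and m: "m \<noteq> 0" and n: "n \<noteq> 0"
  shows "Kk \<theta> (pf b' (b'^2 - n^2)) (pf b (b^2 - m^2)) =
    (\<Sum>u\<in>Lam. \<theta> u * Kk \<theta> (pf b' (b'^2 - n^2)) (pinf (b + m * fst u))) + Zv \<theta> m n"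
proof -
  define be where "be = b' - b"
  let ?N = "\<lambda>w. of_nat (card {u \<in> Lam. fst u * (m - n * fst w) - nu * snd u * (n * snd w) = be}) :: 'f"
  let ?s = "\<lambda>w. (m - n * fst w)^2 + nu * (n * snd w)^2"
  let ?same = "be = 0 \<and> m^2 = n^2"
  have s: "?s w = m^2 + n^2 - 2 * m * n * fst w" if "w \<in> Lam" for w
  proof -
    have "?s w = m^2 - 2 * m * n * fst w + n^2 * ((fst w)^2 + nu * (snd w)^2)"
      by (simp add: power2_eq_square algebra_simps)
    then show ?thesis using that by (simp add: Lam_iff)
  qed
  have "(\<Sum>u\<in>Lam. \<theta> u * Kk \<theta> (pf b' (b'^2 - n^2)) (pinf (b + m * fst u))) =
      (\<Sum>u\<in>Lam. \<theta> u * trS \<theta> ((m * fst u - be) / n))"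
  proof (rule sum.cong[OF refl])
    fix u :: "'k \<times> 'k"
    have "- ((b' - (b + m * fst u)) / n) = (m * fst u - be) / n"
      unfolding minus_divide_left by (simp add: be_def algebra_simps)
    then show "\<theta> u * Kk \<theta> (pf b' (b'^2 - n^2)) (pinf (b + m * fst u)) = \<theta> u * trS \<theta> ((m * fst u - be) / n)"
      unfolding Kk_pf_pinf(1)[OF c n] using trS_minus[OF c] by metis
  qed
  also have "\<dots> = (\<Sum>w\<in>Lam. \<theta> w * ?N w)" by (rule convolution_Lam[OF c n])
  finally have 1: "(\<Sum>u\<in>Lam. \<theta> u * Kk \<theta> (pf b' (b'^2 - n^2)) (pinf (b + m * fst u))) = (\<Sum>w\<in>Lam. \<theta> w * ?N w)" .
  have same: "pf b' (b'^2 - n^2) = pf b (b^2 - m^2) \<longleftrightarrow> ?same"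
    by (auto simp: be_def)
  have 2: "Kk \<theta> (pf b' (b'^2 - n^2)) (pf b (b^2 - m^2)) =
      (\<Sum>w\<in>Lam. if \<not> ?same \<and> ?s w = be^2 then \<theta> w else 0)"
  proof -
    let ?c = "(m^2 + n^2 - be^2) / (2 * m * n)"
    have num: "2 * b' * b - (b'^2 - n^2) - (b^2 - m^2) = m^2 + n^2 - be^2"
      by (simp add: be_def power2_eq_square algebra_simps)
    have "rr (pf b' (b'^2 - n^2)) (pf b (b^2 - m^2)) = (m^2 + n^2 - be^2)^2 / (4 * n^2 * m^2)"
      unfolding rr_pf_pf num by simp
    also have "\<dots> = ?c^2" by (simp add: power_divide power_mult_distrib mult_ac)
    finally have "Kk \<theta> (pf b' (b'^2 - n^2)) (pf b (b^2 - m^2)) = (if ?same then 0 else trS \<theta> ?c)"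
      unfolding Kk_def same using c by (simp add: kern_power2)
    also have "\<dots> = (\<Sum>w\<in>Lam. if \<not> ?same \<and> ?s w = be^2 then \<theta> w else 0)"
    proof (cases ?same)
      case False
      have "trS \<theta> ?c = (\<Sum>w\<in>Lam. if ?s w = be^2 then \<theta> w else 0)"
        unfolding trS_eq_sum_Lam
      proof (rule sum.cong[OF refl])
        fix w assume "w \<in> Lam"
        moreover have "fst w = ?c \<longleftrightarrow> m^2 + n^2 - 2 * m * n * fst w = be^2"
          using m n by (auto simp: eq_divide_eq algebra_simps)
        ultimately show "(if fst w = ?c then \<theta> w else 0) = (if ?s w = be^2 then \<theta> w else 0)" using s by simp
      qed
      then show ?thesis using False by auto
    qed auto
    finally show ?thesis .
  qed
  have "Kk \<theta> (pf b' (b'^2 - n^2)) (pf b (b^2 - m^2)) + (\<Sum>w\<in>Lam. \<theta> w * ?N w) = Zv \<theta> m n"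
    unfolding 2 Zv_def sum.distrib[symmetric]
  proof (rule sum.cong[OF refl])
    fix w assume w: "w \<in> Lam"
    show "(if \<not> ?same \<and> ?s w = be^2 then \<theta> w else 0) + \<theta> w * ?N w =
      (if ?s w = 0 \<and> (m - n * fst w \<noteq> 0 \<or> n * snd w \<noteq> 0) then \<theta> w else 0)"
    proof (cases "?s w = 0")
      case False
      have "be^2 = ?s w \<Longrightarrow> \<not> ?same" using False by auto
      then show ?thesis unfolding count_norm_real[OF False] using False by auto
    next
      case s0: True
      show ?thesis
      proof (cases "m - n * fst w \<noteq> 0 \<or> n * snd w \<noteq> 0")
        case True
        have "\<not> ?same"
        proof
          assume same: ?same
          have "2 * (m * (m - n * fst w)) = m^2 + m^2 - 2 * m * n * fst w"
            by (simp add: power2_eq_square algebra_simps)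
          also have "\<dots> = ?s w" unfolding s[OF w] using same by simp
          finally have "2 * (m * (m - n * fst w)) = 0" unfolding s0 .
          then have "m - n * fst w = 0" using m by simp
          then show False using True s0 by simp
        qed
        then show ?thesis unfolding count_norm_isotropic[OF s0 True] using s0 True by auto
      next
        case False
        then have z: "m = n * fst w" "snd w = 0" using n by auto
        then have "(fst w)^2 = 1" using w by (simp add: Lam_iff)
        then have "m^2 = n^2" using z by (simp add: power_mult_distrib)
        moreover have "?N w = (if be = 0 then of_nat (card Lam) else 0)" using z by simp
        ultimately show ?thesis using False s0 z card_Lam_even by auto
      qed
    qed
  qed
  moreover have "x = y + z" if "x + y = z" for x y z :: 'f
    using that by (auto simp: add.left_commute)
  ultimately show ?thesis unfolding 1 by blast
qed

end

section \<open>The column spaces of the kernels and their simplicity\<close>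

locale conic_psi = conic_char2 nu ty
  for nu :: "'k::{field,finite}" and ty :: "'f::field itself" +
  fixes psi :: "'k \<Rightarrow> 'f"
  assumes psi_add: "psi (x + y) = psi x * psi y" and psi_0 [simp]: "psi 0 = 1" and psi_nontriv: "\<exists>x. psi x \<noteq> 1"
begin

lemma char2_two [simp]: "(2::'f) = 0"
proof -
  have "(2::'f) = 1 + 1" by (rule one_add_one[symmetric])
  then show ?thesis using char2 by (rule trans)
qed

lemma psi_sum: "(\<Sum>b\<in>UNIV. psi (x * b)) = (if x = 0 then 1 else 0)"
proof (cases "x = 0")
  case True
  then show ?thesis using odd by (simp add: char2_of_nat[OF char2])
next
  case False
  obtain c where c: "psi c \<noteq> 1" using psi_nontriv by blast
  have "(\<Sum>b\<in>UNIV. psi (x * b)) = (\<Sum>b\<in>UNIV. psi (x * (b + c / x)))"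
    by (rule sum.reindex_bij_witness[of _ "\<lambda>b. b + c / x" "\<lambda>b. b - c / x"]) auto
  also have "\<dots> = psi c * (\<Sum>b\<in>UNIV. psi (x * b))"
    using False unfolding sum_distrib_left by (intro sum.cong) (auto simp: distrib_left psi_add mult.commute)
  finally have "(psi c - 1) * (\<Sum>b\<in>UNIV. psi (x * b)) = 0" by (simp add: left_diff_distrib)
  then show ?thesis using c False by simp
qed

lemma psi_sum_nonzero: "(\<Sum>x | x \<noteq> 0. psi (- (x * b))) = (if b = 0 then 0 else 1)"
proof -
  have "(\<Sum>x\<in>UNIV. psi (- b * x)) = psi (- b * 0) + (\<Sum>x\<in>UNIV - {0}. psi (- b * x))"
    by (rule sum.remove) auto
  also have "UNIV - {0::'k} = {x. x \<noteq> 0}" by auto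
  finally have "1 + (\<Sum>x | x \<noteq> 0. psi (- (x * b))) = (if b = 0 then 1 else 0)"
    unfolding psi_sum by (simp add: mult.commute)
  moreover have "y = 1 + x" if "1 + y = x" for x y :: 'f using that by auto
  ultimately have "(\<Sum>x | x \<noteq> 0. psi (- (x * b))) = 1 + (if b = 0 then 1 else 0)" by blast
  then show ?thesis by simp
qed

abbreviation E :: "'k point set" where "E \<equiv> external_points"

definition yv :: "('k \<times> 'k \<Rightarrow> 'f) \<Rightarrow> 'k point \<Rightarrow> ('f, 'k) pvec" where
  "yv \<theta> Q = kcol (Kk \<theta>) Q"

definition Md :: "('k \<times> 'k \<Rightarrow> 'f) \<Rightarrow> ('f, 'k) pvec set" where
  "Md \<theta> = vec.span (yv \<theta> ` E)"

text \<open>The group of the \<open>unip b\<close> permutes the \<open>pinf b\<close> regularly; \<open>yx \<theta> x\<close> spans its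
  eigenspace for the character \<open>\<lambda>b. psi (x * b)\<close> in \<open>Md \<theta>\<close>, up to the sign of \<open>x\<close>.\<close>

definition unip :: "'k \<Rightarrow> 'k ^ 3 ^ 3" where
  "unip b = tau (mat2 1 b 0 1)"

text \<open>The projection onto the eigenspace of the unipotent group for the character \<lambda>b.
  \<open>psi (x * b)\<close>. The usual factor 1 / q is 1, since q is odd.\<close>

definition Px :: "'k \<Rightarrow> ('f, 'k) pvec \<Rightarrow> ('f, 'k) pvec" where
  "Px x v = (\<Sum>b\<in>UNIV. psi (- (x * b)) *s module_act v (unip b))"

definition yx :: "('k \<times> 'k \<Rightarrow> 'f) \<Rightarrow> 'k \<Rightarrow> ('f, 'k) pvec" where
  "yx \<theta> x = (\<Sum>b\<in>UNIV. psi (- (x * b)) *s yv \<theta> (pinf b))"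

lemma ext_points: "Q \<in> E \<Longrightarrow> Q \<in> points" using external_subset by blast

lemma yv_nth: "yv \<theta> Q $ R = (if R \<in> E then Kk \<theta> R Q else 0)"
  by (simp add: yv_def)

lemma module_act_yv:
  assumes "det A \<noteq> 0" "Q \<in> points"
  shows "module_act (yv \<theta> Q) (tau A) = yv \<theta> (point_act Q (tau A))"
  unfolding yv_def by (rule module_act_kcol[OF assms(1)]) (use assms ext_points in \<open>auto simp: invariantD\<close>)

lemma Md_act:
  assumes A: "det A \<noteq> 0" and v: "v \<in> Md \<theta>"
  shows "module_act v (tau A) \<in> Md \<theta>"
  using v unfolding Md_def
proof (induction rule: vec.span_induct_alt)
  case (step c x y)
  then obtain Q where "x = yv \<theta> Q" "Q \<in> E" by auto
  then have "module_act x (tau A) \<in> vec.span (yv \<theta> ` E)"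
    using A ext_points by (auto simp: module_act_yv intro: vec.span_base)
  then show ?case using step by (simp add: module_act_add module_act_scale vec.span_add vec.span_scale)
qed (simp add: vec.span_zero)

lemma Md_subspace: "vec.subspace (Md \<theta>)"
  by (simp add: Md_def)

lemma FH_Md: "FH_module (Md \<theta>)"
  unfolding Md_def
proof (rule FH_module_span)
  show "yv \<theta> P \<in> perm_space points" for P unfolding yv_def by (rule kcol_in_perm_space)
  show "module_act (yv \<theta> P) h \<in> vec.span (yv \<theta> ` E)" if PE: "P \<in> E" and hH: "h \<in> H" for P h
  proof -
    obtain A where A: "h = tau A" "det A = 1" using H_tauE[OF hH] .
    have "yv \<theta> P \<in> Md \<theta>" using PE by (auto simp: Md_def intro: vec.span_base)
    then show ?thesis using Md_act[of A "yv \<theta> P" \<theta>] A by (simp add: Md_def)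
  qed
qed

lemma Md_nth_notin: "v \<in> Md \<theta> \<Longrightarrow> R \<notin> E \<Longrightarrow> v $ R = 0"
  unfolding Md_def by (induction rule: vec.span_induct_alt) (auto simp: yv_nth)

lemma FH_moduleD:
  assumes "FH_module W"
  shows "vec.subspace W" "\<And>A v. det A = 1 \<Longrightarrow> v \<in> W \<Longrightarrow> module_act v (tau A) \<in> W"
  using assms by (auto simp: FH_module_def)

lemma Px_in:
  assumes "FH_module W" "v \<in> W"
  shows "Px x v \<in> W"
  unfolding Px_def using assms FH_moduleD[OF assms(1)]
  by (intro vec.subspace_sum vec.subspace_scale) (auto simp: unip_def)

lemma Px_add: "Px x (u + v) = Px x u + Px x v"
  by (simp add: Px_def module_act_add vec.scale_right_distrib sum.distrib)

lemma Px_scale: "Px x (c *s v) = c *s Px x v"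
  by (simp add: Px_def module_act_scale vec.scale_sum_right mult.commute)

lemma Px_0 [simp]: "Px x 0 = 0"
  by (simp add: Px_def)

lemma Px_sum: "Px x (\<Sum>i\<in>A. f i) = (\<Sum>i\<in>A. Px x (f i))"
  by (induction A rule: infinite_finite_induct) (simp_all add: Px_add)

lemma act_yv_Un: "module_act (yv \<theta> (pinf c)) (unip b) = yv \<theta> (pinf (c + b))"
  unfolding unip_def by (simp add: module_act_yv act_unip_pinf)

lemma Px_yv_pinf: "Px x (yv \<theta> (pinf c)) = psi (x * c) *s yx \<theta> x"
proof -
  have "Px x (yv \<theta> (pinf c)) = (\<Sum>b\<in>UNIV. psi (- (x * b)) *s yv \<theta> (pinf (c + b)))"
    by (simp add: Px_def act_yv_Un)
  also have "\<dots> = (\<Sum>b\<in>UNIV. psi (- (x * (b - c))) *s yv \<theta> (pinf b))"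
    by (rule sum.reindex_bij_witness[of _ "\<lambda>b. b - c" "\<lambda>b. c + b"]) auto
  also have "\<dots> = (\<Sum>b\<in>UNIV. psi (x * c) *s (psi (- (x * b)) *s yv \<theta> (pinf b)))"
    by (intro sum.cong) (auto simp: right_diff_distrib simp flip: psi_add)
  finally show ?thesis by (simp add: yx_def vec.scale_sum_right)
qed

text \<open>In characteristic two this is the difference between a column and the combination of
  columns \<open>pinf\<close> that the multiplication formula suggests. Its coordinates are 0 or
  values of \<open>Zv\<close>, so it does not depend on \<open>b\<close>; hence the unipotent group
  fixes it and \<open>Px x\<close> with \<open>x \<noteq> 0\<close> kills it.\<close>

definition Zvec :: "('k \<times> 'k \<Rightarrow> 'f) \<Rightarrow> 'k \<Rightarrow> 'k \<Rightarrow> ('f, 'k) pvec" where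
  "Zvec \<theta> m b = yv \<theta> (pf b (b^2 - m^2)) + (\<Sum>u\<in>Lam. \<theta> u *s yv \<theta> (pinf (b + m * fst u)))"

lemma Zvec_nth:
  assumes c: "is_char \<theta>" and m: "m \<noteq> 0"
  shows "Zvec \<theta> m b $ pinf b' = 0" "n \<noteq> 0 \<Longrightarrow> Zvec \<theta> m b $ pf b' (b'^2 - n^2) = Zv \<theta> m n"
    "R \<notin> E \<Longrightarrow> Zvec \<theta> m b $ R = 0"
proof -
  show "Zvec \<theta> m b $ pinf b' = 0"
    using mult_formula_pinf[OF c m, of b' b] by (simp add: Zvec_def yv_nth sum_component)
  show "Zvec \<theta> m b $ pf b' (b'^2 - n^2) = Zv \<theta> m n" if "n \<noteq> 0"
    using mult_formula_pf[OF c m that, of b' b] that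
    by (simp add: Zvec_def yv_nth sum_component add.commute)
  show "R \<notin> E \<Longrightarrow> Zvec \<theta> m b $ R = 0"
    by (simp add: Zvec_def yv_nth sum_component)
qed

lemma Zvec_indep:
  assumes c: "is_char \<theta>" and m: "m \<noteq> 0"
  shows "Zvec \<theta> m b = Zvec \<theta> m 0"
  unfolding vec_eq_iff
proof
  fix R show "Zvec \<theta> m b $ R = Zvec \<theta> m 0 $ R"
  proof (cases "R \<in> E")
    case True
    then show ?thesis by (cases rule: external_cases) (simp_all add: Zvec_nth[OF c m])
  qed (simp add: Zvec_nth[OF c m])
qed

lemma act_Zvec:
  assumes c: "is_char \<theta>" and m: "m \<noteq> 0"
  shows "module_act (Zvec \<theta> m 0) (unip t) = Zvec \<theta> m 0"
proof -
  have "module_act (Zvec \<theta> m 0) (unip t) = Zvec \<theta> m t"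
    unfolding Zvec_def module_act_add module_act_sum module_act_scale act_yv_Un
    by (simp add: unip_def module_act_yv act_unip_pf add.commute[of _ t] add.left_commute)
  then show ?thesis using Zvec_indep[OF c m] by simp
qed

lemma yv_pf:
  assumes c: "is_char \<theta>" and m: "m \<noteq> 0"
  shows "yv \<theta> (pf b (b^2 - m^2)) = Zvec \<theta> m 0 + (\<Sum>u\<in>Lam. \<theta> u *s yv \<theta> (pinf (b + m * fst u)))"
proof -
  have dblv: "v + v = 0" for v :: "('f, 'k) pvec" by (simp add: vec_eq_iff)
  have "yv \<theta> (pf b (b^2 - m^2)) = Zvec \<theta> m b + (\<Sum>u\<in>Lam. \<theta> u *s yv \<theta> (pinf (b + m * fst u)))"
    unfolding Zvec_def add.assoc dblv by simp
  then show ?thesis using Zvec_indep[OF c m] by simp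
qed

lemma Px_Zvec:
  assumes "is_char \<theta>" "m \<noteq> 0" "x \<noteq> 0"
  shows "Px x (Zvec \<theta> m 0) = 0"
proof -
  have "Px x (Zvec \<theta> m 0) = (\<Sum>b\<in>UNIV. psi (- x * b)) *s Zvec \<theta> m 0"
    by (simp add: Px_def act_Zvec assms vec.scale_sum_left)
  then show ?thesis using assms(3) unfolding psi_sum by simp
qed

lemma Px_Md:
  assumes c: "is_char \<theta>" and x: "x \<noteq> 0" and v: "v \<in> Md \<theta>"
  shows "\<exists>a. Px x v = a *s yx \<theta> x"
  using v unfolding Md_def
proof (induction rule: vec.span_induct_alt)
  case base
  then show ?case by (intro exI[of _ 0]) simp
next
  case (step d y v)
  then obtain a where a: "Px x v = a *s yx \<theta> x" by blast
  obtain Q where Q: "y = yv \<theta> Q" "Q \<in> E" using step by auto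
  have "\<exists>a. Px x y = a *s yx \<theta> x"
    using Q(2)
  proof (cases rule: external_cases)
    case (1 b)
    then show ?thesis using Q Px_yv_pinf by blast
  next
    case (2 b m)
    have "Px x y = (\<Sum>u\<in>Lam. (\<theta> u * psi (x * (b + m * fst u))) *s yx \<theta> x)"
      unfolding Q(1) 2(2) yv_pf[OF c 2(1)] Px_add Px_sum Px_scale Px_yv_pinf Px_Zvec[OF c 2(1) x] by simp
    then show ?thesis unfolding vec.scale_sum_left[symmetric] by blast
  qed
  then obtain a' where "Px x y = a' *s yx \<theta> x" by blast
  then have "Px x (d *s y + v) = (d * a' + a) *s yx \<theta> x"
    using a by (simp add: Px_add Px_scale vec.scale_left_distrib)
  then show ?case by blast
qed

lemma Tinf_Md:
  assumes c: "is_char \<theta>" and v: "v \<in> Md \<theta>"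
  shows "(\<Sum>b\<in>UNIV. v $ pinf b) = 0"
  using v unfolding Md_def
proof (induction rule: vec.span_induct_alt)
  case (step d y v)
  obtain Q where Q: "y = yv \<theta> Q" "Q \<in> E" using step by auto
  have "(\<Sum>b\<in>UNIV. y $ pinf b) = 0"
    using Q(2)
  proof (cases rule: external_cases)
    case (1 b')
    have "(\<Sum>b\<in>UNIV. y $ pinf b) = (\<Sum>b\<in>UNIV. 1 + (if b = b' then 1 else 0))"
      using c by (intro sum.cong) (auto simp: Q 1 yv_nth Kk_def kern_1)
    also have "\<dots> = of_nat (CARD('k)) + 1" by (simp add: sum.distrib)
    finally show ?thesis using odd by (simp add: char2_of_nat[OF char2])
  next
    case (2 b' m)
    have "(\<Sum>b\<in>UNIV. y $ pinf b) = (\<Sum>b\<in>UNIV. trS \<theta> ((b' - b) / m))"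
      using 2 Q c by (simp add: yv_nth Kk_pf_pinf)
    also have "\<dots> = (\<Sum>a\<in>UNIV. trS \<theta> a)"
      by (rule sum.reindex_bij_witness[of _ "\<lambda>a. b' - a * m" "\<lambda>b. (b' - b) / m"]) (use 2 in auto)
    finally show ?thesis using sum_trS[OF c] by simp
  qed
  then show ?case using step by (simp add: sum.distrib flip: sum_distrib_left)
qed simp

text \<open>Otherwise every \<open>Px x\<close> with \<open>x \<noteq> 0\<close> kills
  \<open>W\<close>. Adding these up at the coordinate \<open>pinf 0\<close> gives 0 for the sum of
  the coordinates of \<open>w\<close> at the \<open>pinf b\<close> with \<open>b \<noteq> 0\<close>.
  By \<open>Tinf_Md\<close> the sum over all \<open>b\<close> is 0 as well, so the coordinate at
  \<open>pinf 0\<close> vanishes, and by transitivity so do all others.\<close>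

lemma ex_yx_in:
  assumes c: "is_char \<theta>" and W: "FH_module W" "W \<subseteq> Md \<theta>" "W \<noteq> {0}"
  shows "\<exists>x. x \<noteq> 0 \<and> yx \<theta> x \<in> W"
proof (rule ccontr)
  assume no: "\<not> ?thesis"
  have sub: "vec.subspace W" using FH_moduleD[OF W(1)] by blast
  have P0: "Px x w = 0" if w: "w \<in> W" and x: "x \<noteq> 0" for w x
  proof (rule ccontr)
    assume "Px x w \<noteq> 0"
    moreover obtain a where a: "Px x w = a *s yx \<theta> x" using Px_Md[OF c x] w W(2) by blast
    ultimately have "a \<noteq> 0" by auto
    then have "yx \<theta> x = (1 / a) *s Px x w" using a by simp
    then have "yx \<theta> x \<in> W" using Px_in[OF W(1) w] sub by (simp add: vec.subspace_scale)
    then show False using no x by blast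
  qed
  have w0: "w $ pinf 0 = 0" if w: "w \<in> W" for w
  proof -
    have "(\<Sum>x | x \<noteq> 0. Px x w) = (\<Sum>b\<in>UNIV. (\<Sum>x | x \<noteq> 0. psi (- (x * b))) *s module_act w (unip b))"
      unfolding Px_def vec.scale_sum_left by (rule sum.swap)
    then have "0 = (\<Sum>b\<in>UNIV. (if b = 0 then 0 else 1) *s module_act w (unip b))"
      using P0[OF w] by (simp add: psi_sum_nonzero)
    then have "0 = (\<Sum>b\<in>UNIV. (if b = 0 then 0 else 1) *s module_act w (unip b)) $ pinf 0"
      by (metis zero_index)
    also have "\<dots> = (\<Sum>b\<in>UNIV. (if b = 0 then 0 else w $ pinf (- b)))"
    proof -
      have "module_act w (unip b) $ pinf 0 = w $ pinf (- b)" for b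
        using module_act_nth[of "mat2 1 b 0 1" "pinf (- b)" w] by (simp add: unip_def act_unip_pinf)
      then show ?thesis unfolding sum_component by (intro sum.cong) auto
    qed
    also have "\<dots> = (\<Sum>b\<in>UNIV. (if b = 0 then 0 else w $ pinf b))"
      by (rule sum.reindex_bij_witness[of _ uminus uminus]) auto
    also have "\<dots> = (\<Sum>b\<in>UNIV. w $ pinf b + (if b = 0 then w $ pinf 0 else 0))"
      by (intro sum.cong) auto
    also have "\<dots> = w $ pinf 0"
      unfolding sum.distrib using Tinf_Md[OF c] w W(2) by auto
    finally show ?thesis ..
  qed
  have "w = 0" if w: "w \<in> W" for w
    unfolding vec_eq_iff
  proof
    fix R show "w $ R = 0 $ R"
    proof (cases "R \<in> E")
      case True
      obtain A :: "'k ^ 2 ^ 2" where A: "det A = 1" "R = point_act (pinf 0) (tau A)"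
        using external_transitive[OF True] by blast
      then have A0: "det A \<noteq> 0" by simp
      obtain B where B: "det B = 1 / det A" "\<And>P. point_act (point_act P (tau A)) (tau B) = P"
        using point_act_inverse[OF A0] by metis
      have "module_act w (tau B) \<in> W" using FH_moduleD(2)[OF W(1)] A B w by simp
      then have "module_act w (tau B) $ pinf 0 = 0" by (rule w0)
      moreover have "module_act w (tau B) $ pinf 0 = w $ R"
        using module_act_nth[of B R w] A B ext_points[OF True] by simp
      ultimately show ?thesis by simp
    qed (use Md_nth_notin w W(2) in auto)
  qed
  then have "W = {0}" using vec.subspace_0[OF sub] by blast
  then show False using W(3) by blast
qed

lemma act_yx_scale:
  assumes "l \<noteq> 0"
  shows "module_act (yx \<theta> x) (tau (mat2 1 0 0 l)) = yx \<theta> (x / l)"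
proof -
  have "module_act (yx \<theta> x) (tau (mat2 1 0 0 l)) = (\<Sum>b\<in>UNIV. psi (- (x * b)) *s yv \<theta> (pinf (l * b)))"
    using assms by (simp add: yx_def module_act_sum module_act_scale module_act_yv act_scale_pinf)
  also have "\<dots> = yx \<theta> (x / l)"
    unfolding yx_def by (rule sum.reindex_bij_witness[of _ "\<lambda>b. b / l" "\<lambda>b. l * b"]) (use assms in auto)
  finally show ?thesis .
qed

lemma act_yx_torus:
  assumes "a \<noteq> 0"
  shows "module_act (yx \<theta> x) (tau (mat2 a 0 0 (1 / a))) = yx \<theta> (x * a^2)"
proof -
  have "module_act (yx \<theta> x) (tau (mat2 a 0 0 (1 / a))) = (\<Sum>b\<in>UNIV. psi (- (x * b)) *s yv \<theta> (pinf (b / a^2)))"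
    using assms by (simp add: yx_def module_act_sum module_act_scale module_act_yv act_torus_pinf)
  also have "\<dots> = yx \<theta> (x * a^2)"
    unfolding yx_def by (rule sum.reindex_bij_witness[of _ "\<lambda>b. a^2 * b" "\<lambda>b. b / a^2"]) (use assms in auto)
  finally show ?thesis .
qed

text \<open>The sum over one of the two orbits of the diagonal elements of SL(2, q) on the nonzero
  \<open>x\<close>; \<open>ynsq\<close> is the sum over the other. Together they give back the
  column at \<open>pinf 0\<close>, which \<open>w0\<close> fixes.\<close>

definition ysq :: "('k \<times> 'k \<Rightarrow> 'f) \<Rightarrow> ('f, 'k) pvec" where
  "ysq \<theta> = (\<Sum>x | is_sq x \<and> x \<noteq> 0. yx \<theta> x)"

definition ynsq :: "('k \<times> 'k \<Rightarrow> 'f) \<Rightarrow> ('f, 'k) pvec" where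
  "ynsq \<theta> = (\<Sum>x | \<not> is_sq x. yx \<theta> x)"

lemma sum_yv_pinf: "is_char \<theta> \<Longrightarrow> (\<Sum>b\<in>UNIV. yv \<theta> (pinf b)) = 0"
  unfolding vec_eq_iff
proof
  fix R assume c: "is_char \<theta>"
  show "(\<Sum>b\<in>UNIV. yv \<theta> (pinf b)) $ R = 0 $ R"
  proof (cases "R \<in> E")
    case True
    then have "(\<Sum>b\<in>UNIV. yv \<theta> (pinf b)) $ R = (\<Sum>b\<in>UNIV. yv \<theta> R $ pinf b)"
      by (simp add: sum_component yv_nth Kk_commute)
    also have "\<dots> = 0" using True by (intro Tinf_Md[OF c]) (auto simp: Md_def intro: vec.span_base)
    finally show ?thesis by simp
  qed (simp add: sum_component yv_nth)
qed

lemma ysq_ynsq: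
  assumes c: "is_char \<theta>"
  shows "ysq \<theta> + ynsq \<theta> = yv \<theta> (pinf 0)"
proof -
  have "ysq \<theta> + ynsq \<theta> = sum (yx \<theta>) ({x. is_sq x \<and> x \<noteq> 0} \<union> {x. \<not> is_sq x})"
    unfolding ysq_def ynsq_def by (rule sum.union_disjoint[symmetric]) auto
  also have "{x. is_sq x \<and> x \<noteq> 0} \<union> {x. \<not> is_sq x} = {x::'k. x \<noteq> 0}" by auto
  also have "sum (yx \<theta>) {x. x \<noteq> 0} = (\<Sum>b\<in>UNIV. (\<Sum>x | x \<noteq> 0. psi (- (x * b))) *s yv \<theta> (pinf b))"
    unfolding yx_def vec.scale_sum_left by (rule sum.swap)
  also have "\<dots> = (\<Sum>b\<in>UNIV. yv \<theta> (pinf b) + (if b = 0 then yv \<theta> (pinf 0) else 0))"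
    unfolding psi_sum_nonzero by (intro sum.cong) (auto simp: vec_eq_iff)
  also have "\<dots> = yv \<theta> (pinf 0)"
    unfolding sum.distrib sum_yv_pinf[OF c] by simp
  finally show ?thesis .
qed

lemma bij_betw_sq_nonsq:
  assumes l: "\<not> is_sq l"
  shows "bij_betw (\<lambda>x. x * l) {x. is_sq x \<and> x \<noteq> 0} {x::'k. \<not> is_sq x}"
    "bij_betw (\<lambda>x. x / l) {x. is_sq x \<and> x \<noteq> 0} {x::'k. \<not> is_sq x}"
    "bij_betw (\<lambda>x. x / l) {x. \<not> is_sq x} {x::'k. is_sq x \<and> x \<noteq> 0}"
proof -
  have l0: "l \<noteq> 0" using l by auto
  have ml: "is_sq (x * l) \<longleftrightarrow> x = 0 \<or> \<not> is_sq x" "is_sq (x / l) \<longleftrightarrow> x = 0 \<or> \<not> is_sq x" for x :: 'k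
    using nonsq_mult_iff[OF odd l, of x] by (simp_all add: is_sq_divide mult.commute)
  show "bij_betw (\<lambda>x. x * l) {x. is_sq x \<and> x \<noteq> 0} {x::'k. \<not> is_sq x}"
    by (rule bij_betwI[where g = "\<lambda>x. x / l"]) (use l0 ml in auto)
  show "bij_betw (\<lambda>x. x / l) {x. is_sq x \<and> x \<noteq> 0} {x::'k. \<not> is_sq x}"
    by (rule bij_betwI[where g = "\<lambda>x. x * l"]) (use l0 ml in auto)
  show "bij_betw (\<lambda>x. x / l) {x. \<not> is_sq x} {x::'k. is_sq x \<and> x \<noteq> 0}"
    by (rule bij_betwI[where g = "\<lambda>x. x * l"]) (use l0 ml in auto)
qed

lemma act_ysq_scale:
  assumes l: "\<not> is_sq l"
  shows "module_act (ysq \<theta>) (tau (mat2 1 0 0 l)) = ynsq \<theta>" "module_act (ynsq \<theta>) (tau (mat2 1 0 0 l)) = ysq \<theta>"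
proof -
  have l0: "l \<noteq> 0" using l by auto
  show "module_act (ysq \<theta>) (tau (mat2 1 0 0 l)) = ynsq \<theta>" "module_act (ynsq \<theta>) (tau (mat2 1 0 0 l)) = ysq \<theta>"
    unfolding ysq_def ynsq_def module_act_sum act_yx_scale[OF l0]
    by (rule sum.reindex_bij_betw[OF bij_betw_sq_nonsq(2)[OF l]],
        rule sum.reindex_bij_betw[OF bij_betw_sq_nonsq(3)[OF l]])
qed

abbreviation w0 :: "'k ^ 3 ^ 3" where "w0 \<equiv> tau (mat2 0 1 (- 1) 0)"

lemma act_w0_yv: "module_act (yv \<theta> (pinf 0)) w0 = yv \<theta> (pinf 0)"
  by (simp add: module_act_yv act_weyl_pinf_0)

definition nonreal :: "('k \<times> 'k \<Rightarrow> 'f) \<Rightarrow> bool" where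
  "nonreal \<theta> \<longleftrightarrow> (\<exists>u\<in>Lam. \<theta> u \<noteq> \<theta> (lcnj u))"

text \<open>A point \<open>R\<close> whose line to \<open>pinf 0\<close> carries a nonzero value of the kernel has the same images
  under \<open>w0\<close> and under a non-square scaling. An invariant \<open>ysq\<close> would thus agree with \<open>ynsq\<close> at \<open>R\<close>.\<close>

lemma ysq_not_invariant:
  assumes c: "is_char \<theta>" and nr: "nonreal \<theta>"
  shows "module_act (ysq \<theta>) w0 \<noteq> ysq \<theta>"
proof
  assume inv: "module_act (ysq \<theta>) w0 = ysq \<theta>"
  obtain u where u: "u \<in> Lam" "\<theta> u \<noteq> \<theta> (lcnj u)" using nr by (auto simp: nonreal_def)
  define a e where "a = fst u" and "e = snd u"
  have ae: "a^2 + nu * e^2 = 1" using u by (simp add: Lam_iff a_def e_def)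
  have e0: "e \<noteq> 0" using u(2) by (cases u) (auto simp: e_def)
  define k where "k = a^2 - 1"
  have k: "k = - (nu * e^2)" using ae by (simp add: k_def algebra_simps)
  then have k0: "k \<noteq> 0" using e0 by simp
  \<comment> \<open>Scaling by \<open>l\<close> sends \<open>pf a k\<close> to
    \<open>pf (l * a) (l^2 * k)\<close>; this value of \<open>l\<close> makes it the image
    \<open>pf (- a / k) (1 / k)\<close> under \<open>w0\<close>. It is a non-square because
    \<open>k = - (nu * e^2)\<close>.\<close>
  define l where "l = - (1 / k)"
  have "l = inverse (e^2 * nu)" by (simp add: l_def k inverse_eq_divide mult.commute)
  then have l: "\<not> is_sq l" using nonsq is_sq_power2_mult_iff[OF e0, of nu] by (simp only: is_sq_inverse) simp
  then have l0: "l \<noteq> 0" by auto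
  define R where "R = pf a (a^2 - 1^2)"
  have Rk: "R = pf a k" by (simp add: R_def k_def)
  have R: "R \<in> E" "R \<in> points" by (simp_all add: R_def)
  have same: "point_act R w0 = point_act R (tau (mat2 1 0 0 l))"
    unfolding Rk act_weyl_pf[OF k0] act_scale_pf using k0 by (simp add: l_def power2_eq_square)
  have "ysq \<theta> $ R = module_act (ysq \<theta>) w0 $ point_act R w0"
    using module_act_nth[of "mat2 0 1 (- 1) 0" R "ysq \<theta>"] R by simp
  also have "\<dots> = ysq \<theta> $ point_act R (tau (mat2 1 0 0 l))" unfolding inv same ..
  also have "\<dots> = module_act (ynsq \<theta>) (tau (mat2 1 0 0 l)) $ point_act R (tau (mat2 1 0 0 l))"
    unfolding act_ysq_scale[OF l] ..
  also have "\<dots> = ynsq \<theta> $ R"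
    using l0 R by (intro module_act_nth) simp_all
  finally have "(ysq \<theta> + ynsq \<theta>) $ R = 0" by simp
  then have "yv \<theta> (pinf 0) $ R = 0" unfolding ysq_ynsq[OF c] .
  then have "trS \<theta> a = 0" using R(1) Kk_pf_pinf(1)[OF c, of 1 a 0] by (simp add: yv_nth R_def)
  then have "tr \<theta> u = 0" using trS_eq_tr[OF u(1), of \<theta>] e0 by (simp add: a_def e_def)
  then show False using u(2) char2_eq_iff_add[OF char2] by (auto simp: tr_def)
qed

text \<open>As \<open>w0\<close> fixes \<open>ysq \<theta> + ynsq \<theta>\<close>, the changes of
  the two summands under \<open>w0\<close> are opposite. This common vector lies in both modules,
  and it is nonzero by \<open>ysq_not_invariant\<close>.\<close>

lemma ysq_ynsq_separated:
  assumes c: "is_char \<theta>" and nr: "nonreal \<theta>"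
    and A: "FH_module A" "ysq \<theta> \<in> A" and B: "FH_module B" "ynsq \<theta> \<in> B"
  shows "A \<inter> B \<noteq> {0}"
proof
  assume AB: "A \<inter> B = {0}"
  have d: "det (mat2 0 1 (- 1) (0::'k)) = 1" by simp
  let ?v = "module_act (ysq \<theta>) w0 - ysq \<theta>"
  have "module_act (ysq \<theta> + ynsq \<theta>) w0 = ysq \<theta> + ynsq \<theta>"
    unfolding ysq_ynsq[OF c] by (rule act_w0_yv)
  then have v: "?v = ynsq \<theta> - module_act (ynsq \<theta>) w0" by (simp add: module_act_add algebra_simps)
  have "?v \<in> A" using FH_moduleD[OF A(1)] A(2) d by (intro vec.subspace_diff) blast+
  moreover have "?v \<in> B" unfolding v using FH_moduleD[OF B(1)] B(2) d by (intro vec.subspace_diff) blast+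
  ultimately have "?v = 0" using AB by blast
  then show False using ysq_not_invariant[OF c nr] by simp
qed

lemma yx_class:
  assumes W: "FH_module W" "yx \<theta> x \<in> W" and y: "y \<noteq> 0" "x \<noteq> 0" "is_sq x \<longleftrightarrow> is_sq y"
  shows "yx \<theta> y \<in> W"
proof -
  have "is_sq (y / x)"
    unfolding is_sq_divide using y is_sq_mult nonsq_mult_nonsq[OF odd] by blast
  then obtain a where a: "y / x = a^2" by (auto simp: is_sq_def)
  then have a0: "a \<noteq> 0" using y by auto
  have "y = x * a^2" using a y by (simp flip: a)
  moreover have "module_act (yx \<theta> x) (tau (mat2 a 0 0 (1 / a))) \<in> W"
    using W a0 by (intro FH_moduleD(2)) simp_all
  ultimately show ?thesis using act_yx_torus[OF a0] by simp
qed

lemma ysq_in: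
  assumes W: "FH_module W" "yx \<theta> x \<in> W" "x \<noteq> 0"
  shows "is_sq x \<Longrightarrow> ysq \<theta> \<in> W" "\<not> is_sq x \<Longrightarrow> ynsq \<theta> \<in> W"
proof -
  have "vec.subspace W" using FH_moduleD[OF W(1)] by blast
  moreover have "y \<noteq> 0" if "\<not> is_sq y" for y :: 'k using that by auto
  ultimately show "is_sq x \<Longrightarrow> ysq \<theta> \<in> W" "\<not> is_sq x \<Longrightarrow> ynsq \<theta> \<in> W"
    unfolding ysq_def ynsq_def using yx_class[OF W(1,2)] W(3) by (auto intro!: vec.subspace_sum)
qed

text \<open>A nonzero submodule contains some \<open>yx \<theta> x\<close>, hence
  \<open>ysq \<theta>\<close> or \<open>ynsq \<theta>\<close>; both together generate everything. If
  \<open>W\<close> is proper, it meets its twist \<open>W'\<close> trivially, since a common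
  \<open>yx \<theta> x\<close> would put both classes into \<open>W\<close>. But if one of the two
  sums is in \<open>W\<close>, the other is in \<open>W'\<close>, which contradicts
  \<open>ysq_ynsq_separated\<close>.\<close>

lemma FH_simple_Md:
  assumes c: "is_char \<theta>" and nr: "nonreal \<theta>"
  shows "FH_simple (Md \<theta>)"
  unfolding FH_simple_def
proof (intro conjI allI impI FH_Md)
  have "yv \<theta> (pinf 0) \<noteq> 0"
  proof
    assume "yv \<theta> (pinf 0) = 0"
    then have "yv \<theta> (pinf 0) $ pinf 1 = 0" by simp
    then show False using c by (simp add: yv_nth Kk_def kern_1)
  qed
  moreover have "yv \<theta> (pinf 0) \<in> Md \<theta>" by (simp add: Md_def vec.span_base)
  ultimately show "Md \<theta> \<noteq> {0}" by blast
next
  fix W assume "FH_module W \<and> W \<subseteq> Md \<theta>"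
  then have W: "FH_module W" "W \<subseteq> Md \<theta>" by auto
  show "W = {0} \<or> W = Md \<theta>"
  proof (rule disjCI)
    assume ne: "W \<noteq> Md \<theta>"
    have full: False if both: "ysq \<theta> \<in> W" "ynsq \<theta> \<in> W"
    proof -
      have sub: "vec.subspace W" using FH_moduleD[OF W(1)] by blast
      have y0: "yv \<theta> (pinf 0) \<in> W" using vec.subspace_add[OF sub both] unfolding ysq_ynsq[OF c] .
      have "yv \<theta> Q \<in> W" if Q: "Q \<in> E" for Q
      proof -
        obtain A :: "'k ^ 2 ^ 2" where A: "det A = 1" "Q = point_act (pinf 0) (tau A)"
          using external_transitive[OF Q] by blast
        then show ?thesis using FH_moduleD(2)[OF W(1) A(1) y0] by (simp add: module_act_yv)
      qed
      then have "Md \<theta> \<subseteq> W" unfolding Md_def using sub by (intro vec.span_minimal) auto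
      then show False using ne W(2) by blast
    qed
    \<comment> \<open>This element has non-square determinant. It normalises \<open>H\<close>, so
      the preimage \<open>W'\<close> of \<open>W\<close> is again a submodule, and it exchanges
      \<open>ysq \<theta>\<close> and \<open>ynsq \<theta>\<close>.\<close>
    let ?d = "mat2 1 0 0 nu"
    have d0: "det ?d \<noteq> 0" by simp
    define W' where "W' = {v \<in> Md \<theta>. module_act v (tau ?d) \<in> W}"
    have W': "FH_module W'"
      unfolding FH_module_def
    proof (intro conjI ballI)
      show "W' \<subseteq> perm_space points" using FH_Md[of \<theta>] by (auto simp: W'_def FH_module_def)
      show "vec.subspace W'"
        using FH_moduleD(1)[OF W(1)] Md_subspace[of \<theta>]
        by (auto simp: W'_def vec.subspace_def module_act_add module_act_scale)
      fix h v assume h: "h \<in> (H :: ('k ^ 3 ^ 3) set)" and v: "v \<in> W'"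
      obtain A where A: "h = tau A" "det A = 1" using H_tauE[OF h] .
      then have A0: "det A \<noteq> 0" by simp
      obtain D where D: "?d ** D = mat 1" "det D = 1 / det ?d" using tau_inverse[OF d0] by blast
      have D0: "det D \<noteq> 0" using D by simp
      have "module_act (module_act v h) (tau ?d) = module_act v (tau (A ** ?d))"
        unfolding A(1) by (rule module_act_tau_tau[OF A0 d0])
      also have "A ** ?d = ?d ** (D ** A ** ?d)"
        using D(1) by (simp add: matrix_mul_assoc)
      also have "module_act v (tau (?d ** (D ** A ** ?d))) = module_act (module_act v (tau ?d)) (tau (D ** A ** ?d))"
        by (rule module_act_tau_tau[symmetric, OF d0]) (use A0 D0 d0 in \<open>simp add: det_mul\<close>)
      also have "\<dots> \<in> W"
      proof -
        have "det (D ** A ** ?d) = 1" using A D by (simp add: det_mul)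
        then show ?thesis using v FH_moduleD(2)[OF W(1)] by (simp add: W'_def del: det_mat2)
      qed
      finally show "module_act v h \<in> W'" using v Md_act[OF A0] A by (simp add: W'_def)
    qed
    have int: "W \<inter> W' = {0}"
    proof (rule ccontr)
      assume ne0: "W \<inter> W' \<noteq> {0}"
      have FH: "FH_module (W \<inter> W')"
        using W(1) W' unfolding FH_module_def by (simp add: vec.subspace_inter le_infI1)
      have "W \<inter> W' \<subseteq> Md \<theta>" using W(2) by (rule le_infI1)
      from ex_yx_in[OF c FH this ne0] obtain x where x: "x \<noteq> 0" "yx \<theta> x \<in> W" "yx \<theta> x \<in> W'"
        by (elim exE conjE IntE)
      then have x': "yx \<theta> (x / nu) \<in> W" by (simp add: W'_def act_yx_scale)
      have "is_sq (x / nu) \<longleftrightarrow> \<not> is_sq x"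
        using nonsq_mult_iff[OF odd nonsq, of x] x(1) by (simp add: is_sq_divide mult.commute)
      then have "ysq \<theta> \<in> W \<and> ynsq \<theta> \<in> W"
        using ysq_in[OF W(1) x(2,1)] ysq_in[OF W(1) x'] x(1) by (cases "is_sq x") auto
      then show False using full by blast
    qed
    have Mysq: "ysq \<theta> \<in> Md \<theta>" "ynsq \<theta> \<in> Md \<theta>"
      using Md_subspace[of \<theta>] unfolding ysq_def ynsq_def yx_def
      by (auto intro!: vec.subspace_sum vec.subspace_scale simp: Md_def intro: vec.span_base)
    show "W = {0}"
    proof (rule ccontr)
      assume "W \<noteq> {0}"
      then obtain x where x: "x \<noteq> 0" "yx \<theta> x \<in> W" using ex_yx_in[OF c W] by blast
      show False
      proof (cases "is_sq x")
        case True
        then have "ysq \<theta> \<in> W" using ysq_in(1)[OF W(1) x(2,1)] by blast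
        moreover from this have "ynsq \<theta> \<in> W'" using Mysq by (simp add: W'_def act_ysq_scale[OF nonsq])
        ultimately show False using ysq_ynsq_separated[OF c nr W(1) _ W'] int by blast
      next
        case False
        then have "ynsq \<theta> \<in> W" using ysq_in(2)[OF W(1) x(2,1)] by blast
        moreover from this have "ysq \<theta> \<in> W'" using Mysq by (simp add: W'_def act_ysq_scale[OF nonsq])
        ultimately show False using ysq_ynsq_separated[OF c nr W' _ W(1)] int by blast
      qed
    qed
  qed
qed

end

lemma dim_span_indexed:
  fixes g :: "'i \<Rightarrow> 'f::field ^ 'n"
  assumes J: "finite J" and indep: "\<And>c j. (\<Sum>j\<in>J. c j *s g j) = 0 \<Longrightarrow> j \<in> J \<Longrightarrow> c j = 0"
  shows "vec.dim (vec.span (g ` J)) = card J"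
proof -
  have inj: "inj_on g J"
  proof (rule inj_onI, rule ccontr)
    fix i j assume ij: "i \<in> J" "j \<in> J" "g i = g j" "i \<noteq> j"
    let ?c = "\<lambda>k. if k = i then 1 else if k = j then - 1 else (0::'f)"
    have "(\<Sum>k\<in>J. ?c k *s g k) = (\<Sum>k\<in>{i, j}. ?c k *s g k)"
      by (rule sum.mono_neutral_right) (use J ij in auto)
    also have "\<dots> = 0" using ij by simp
    finally have "?c i = 0" by (rule indep[OF _ ij(1)])
    then show False by simp
  qed
  have "vec.independent (g ` J)"
  proof
    assume "vec.dependent (g ` J)"
    then obtain u v where u: "v \<in> g ` J" "u v \<noteq> 0" "(\<Sum>v\<in>g ` J. u v *s v) = 0"
      using vec.dependent_finite[of "g ` J"] J by auto
    then have "(\<Sum>j\<in>J. u (g j) *s g j) = 0" by (simp add: sum.reindex[OF inj])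
    then show False using indep[of "\<lambda>j. u (g j)"] u by auto
  qed
  then have "vec.dim (vec.span (g ` J)) = card (g ` J)" by (simp add: vec.dim_eq_card_independent)
  then show ?thesis using card_image[OF inj] by simp
qed

section \<open>The kernels as operators on the images of the two maps\<close>

context conic_psi
begin

abbreviation I :: "'k point set" where "I \<equiv> internal_points"

definition Bcol :: "'k point \<Rightarrow> ('f, 'k) pvec" where "Bcol P = kcol Bk P"
definition Dcol :: "'k point \<Rightarrow> ('f, 'k) pvec" where "Dcol P = kcol Dk P"
definition bc :: "('k \<times> 'k \<Rightarrow> 'f) \<Rightarrow> 'k point \<Rightarrow> ('f, 'k) pvec" where "bc \<theta> P = kcol (Bt \<theta>) P"
definition Kop :: "('k \<times> 'k \<Rightarrow> 'f) \<Rightarrow> ('f, 'k) pvec \<Rightarrow> ('f, 'k) pvec" where "Kop \<theta> = lin_ext E (yv \<theta>)"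

lemma Im_phi_B_eq: "(Im_phi_B :: ('f, 'k) pvec set) = vec.span (Bcol ` I)"
proof -
  have "chi (E \<inter> perp P) = Bcol P" if "P \<in> I" for P
    unfolding vec_eq_iff Bcol_def using mem_perp_iff[OF odd _ that] by (auto simp: Bk_def)
  then have "(\<lambda>P. chi (E \<inter> perp P) :: ('f, 'k) pvec) ` I = Bcol ` I" by (intro image_cong) auto
  then show ?thesis unfolding Im_phi_B_def phi_B_def lin_ext_image by simp
qed

lemma Im_phi_D_eq: "(Im_phi_D :: ('f, 'k) pvec set) = vec.span (Dcol ` I)"
proof -
  have "N_PaE P \<subseteq> E" for P :: "'k point" by (auto simp: N_PaE_def)
  then have "chi (N_PaE P) = Dcol P" if "P \<in> I" for P
    unfolding vec_eq_iff Dcol_def using mem_N_PaE_iff_rr[OF odd _ that] by (auto simp: Dk_def)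
  then have "(\<lambda>P. chi (N_PaE P) :: ('f, 'k) pvec) ` I = Dcol ` I" by (intro image_cong) auto
  then show ?thesis unfolding Im_phi_D_def phi_D_def lin_ext_image by simp
qed

lemma int_points: "P \<in> I \<Longrightarrow> P \<in> points" using internal_subset by blast

lemma FH_span_kcol:
  assumes k: "invariant k"
  shows "FH_module (vec.span (kcol k ` I))"
proof (rule FH_module_span)
  show "module_act (kcol k P) h \<in> vec.span (kcol k ` I)" if PI: "P \<in> I" and hH: "h \<in> H" for P h
  proof -
    obtain A where A: "h = tau A" "det A = 1" using H_tauE[OF hH] .
    then have "module_act (kcol k P) h = kcol k (point_act P h)"
      unfolding A(1) using PI k by (intro module_act_kcol) (auto simp: invariantD ext_points int_points)
    moreover have "point_act P h \<in> I" using A PI int_points by simp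
    ultimately show ?thesis by (simp add: vec.span_base)
  qed
qed (rule kcol_in_perm_space)

lemma FH_Im_phi: "FH_module (Im_phi_B :: ('f, 'k) pvec set)" "FH_module (Im_phi_D :: ('f, 'k) pvec set)"
  unfolding Im_phi_B_eq Im_phi_D_eq using FH_span_kcol[of Bk] FH_span_kcol[of Dk]
  by (simp_all add: Bcol_def[abs_def] Dcol_def[abs_def])

lemma Kop_add: "Kop \<theta> (u + v) = Kop \<theta> u + Kop \<theta> v"
  and Kop_scale: "Kop \<theta> (a *s v) = a *s Kop \<theta> v"
  and Kop_0 [simp]: "Kop \<theta> 0 = 0"
  by (simp_all add: Kop_def lin_ext_add lin_ext_scale)

lemma Kop_in: "Kop \<theta> v \<in> Md \<theta>"
  unfolding Kop_def lin_ext_def Md_def by (intro vec.span_sum vec.span_scale vec.span_base) simp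

lemma Kop_kcol:
  assumes "\<And>R. R \<in> E \<Longrightarrow> (\<Sum>Q\<in>E. Kk \<theta> R Q * k Q P) = r R"
  shows "Kop \<theta> (kcol k P) = (\<chi> R. if R \<in> E then r R else 0)"
proof -
  have "(\<Sum>Q\<in>E. (if Q \<in> E then k Q P else 0) * Kk \<theta> R Q) = r R" if "R \<in> E" for R
    using assms[OF that] by (simp add: mult.commute)
  then show ?thesis by (simp add: vec_eq_iff Kop_def lin_ext_nth yv_nth)
qed

lemma Kop_Bcol: "is_char \<theta> \<Longrightarrow> P \<in> I \<Longrightarrow> Kop \<theta> (Bcol P) = bc \<theta> P"
  unfolding Bcol_def by (subst Kop_kcol[OF Kk_Bk]) (simp_all add: bc_def vec_eq_iff)

lemma Kop_Dcol: "is_char \<theta> \<Longrightarrow> P \<in> I \<Longrightarrow> Kop \<theta> (Dcol P) = 0"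
  unfolding Dcol_def by (subst Kop_kcol[OF Kk_Dk]) (simp_all add: vec_eq_iff)

lemma Kop_bc:
  assumes "odd_part L" "is_char \<theta>" "is_char \<theta>'" "P \<in> I"
  shows "Kop \<theta>' (bc \<theta> P) = ((\<Sum>u\<in>L. \<theta>' u * \<theta> u) + (\<Sum>u\<in>L. \<theta>' u * \<theta> (lcnj u))) *s bc \<theta> P"
  unfolding bc_def
  by (subst Kop_kcol[where k = "Bt \<theta>" and P = P and r = "\<lambda>R. _ * Bt \<theta> R P", OF Kk_Bt[OF assms(1-3) _ assms(4)]])
    (simp_all add: vec_eq_iff distrib_right)

lemma bc_eq_sum_Bcol:
  assumes "is_char \<theta>" "P \<in> I"
  shows "bc \<theta> P = (\<Sum>R\<in>I. Kk \<theta> R P *s Bcol R)"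
  using Bk_Kk[OF assms(1) _ assms(2)]
  by (auto simp: vec_eq_iff bc_def Bcol_def sum_component mult.commute)

lemma bc_in_Im_phi_B: "is_char \<theta> \<Longrightarrow> P \<in> I \<Longrightarrow> bc \<theta> P \<in> Im_phi_B"
  unfolding Im_phi_B_eq bc_eq_sum_Bcol by (intro vec.span_sum vec.span_scale vec.span_base) simp

lemma ex_bc_neq_0:
  assumes c: "is_char \<theta>" and nr: "nonreal \<theta>"
  shows "\<exists>P\<in>I. bc \<theta> P \<noteq> 0"
proof -
  obtain u where u: "u \<in> Lam" "\<theta> u \<noteq> \<theta> (lcnj u)" using nr by (auto simp: nonreal_def)
  \<comment> \<open>Then \<open>p^2 - h = nu\<close>, which makes the point internal, and
    \<open>rr (pinf 0) (pf p h) = p^2 / nu = nu * (snd u)^2\<close>, so that \<open>Bt\<close> takes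
    the trace of \<open>\<theta>\<close> at \<open>u\<close> as its value.\<close>
  define p h where "p = nu * snd u" and "h = p^2 - nu"
  have ph: "p^2 - h = nu" by (simp add: h_def)
  have P: "pf p h \<in> I" using nonsq by (simp add: ph)
  have "1 - rr (pinf 0) (pf p h) = 1 - nu * (snd u)^2"
    by (simp add: ph) (simp add: p_def power2_eq_square)
  also have "\<dots> = (fst u)^2" using u(1) unfolding Lam_iff by (simp add: algebra_simps)
  finally have "Bt \<theta> (pinf 0) (pf p h) = tr \<theta> u" unfolding Bt_def by (rule kern_eq_tr[OF c u(1)])
  also have "\<dots> \<noteq> 0" using u(2) char2_eq_iff_add[OF char2] by (auto simp: tr_def)
  finally have "bc \<theta> (pf p h) $ pinf 0 \<noteq> 0" by (simp add: bc_def)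
  then show ?thesis using P by (metis zero_index)
qed

text \<open>The right side is a nonzero submodule of the simple module on the left. Identities for
  the \<open>bc \<theta> P\<close> thereby extend to all of \<open>Md \<theta>\<close>.\<close>

lemma Md_eq_span_bc:
  assumes c: "is_char \<theta>" and nr: "nonreal \<theta>"
  shows "Md \<theta> = vec.span (bc \<theta> ` I)"
proof -
  have FH: "FH_module (vec.span (bc \<theta> ` I))"
    using FH_span_kcol[of "Bt \<theta>"] by (simp add: bc_def[abs_def])
  have "bc \<theta> ` I \<subseteq> Md \<theta>" using Kop_in Kop_Bcol[OF c] by (metis image_subsetI)
  then have sub: "vec.span (bc \<theta> ` I) \<subseteq> Md \<theta>" by (rule vec.span_minimal[OF _ Md_subspace])
  obtain P where P: "P \<in> I" "bc \<theta> P \<noteq> 0" using ex_bc_neq_0[OF c nr] by blast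
  then have "bc \<theta> P \<in> vec.span (bc \<theta> ` I)" by (intro vec.span_base) simp
  then have "vec.span (bc \<theta> ` I) \<noteq> {0}" using P(2) by blast
  then show ?thesis using FH_simple_Md[OF c nr] FH sub unfolding FH_simple_def by blast
qed

lemma Md_subset_Im_phi_B:
  assumes "is_char \<theta>" "nonreal \<theta>"
  shows "Md \<theta> \<subseteq> Im_phi_B"
proof -
  have "vec.subspace (Im_phi_B :: ('f, 'k) pvec set)" using FH_Im_phi FH_moduleD by blast
  moreover have "bc \<theta> ` I \<subseteq> Im_phi_B" using bc_in_Im_phi_B[OF assms(1)] by blast
  ultimately show ?thesis unfolding Md_eq_span_bc[OF assms] by (intro vec.span_minimal)
qed

subsection \<open>Non-isomorphic modules\<close>

lemma Px_yx: "x \<noteq> 0 \<Longrightarrow> Px x (yx \<theta> x) = yx \<theta> x"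
proof -
  have "Px x (yx \<theta> x) = (\<Sum>b\<in>(UNIV :: 'k set). yx \<theta> x)"
    unfolding yx_def[of \<theta> x] Px_sum Px_scale Px_yv_pinf
    by (simp flip: yx_def psi_add add: vec.scale_scale)
  also have "\<dots> = (\<Sum>b\<in>(UNIV :: 'k set). 1) *s yx \<theta> x"
    by (simp only: vec.scale_sum_left vec.scale_one)
  also have "(\<Sum>b\<in>(UNIV :: 'k set). 1) = (1::'f)" using odd by (simp add: char2_of_nat[OF char2])
  finally show ?thesis by simp
qed

lemma yx_in_Md: "yx \<theta> x \<in> Md \<theta>"
  unfolding yx_def Md_def by (intro vec.span_sum vec.span_scale vec.span_base) simp

text \<open>An isomorphism commutes with \<open>Px\<close>, so it sends \<open>yx \<theta> x\<close>
  to a multiple of \<open>yx \<theta>' x\<close>. The diagonal elements make the factor constant on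
  squares and on non-squares, and \<open>w0\<close> makes these two constants equal. Thus
  \<open>f\<close> sends each column of one kernel to the same multiple of the corresponding column
  of the other, and \<open>f (Kop \<theta> v) = a *s Kop \<theta>' v\<close>. At
  \<open>v = bc \<theta> P\<close> the left side is \<open>f v\<close>, the right side 0.\<close>

lemma not_isomorphic:
  assumes c: "is_char \<theta>" "is_char \<theta>'" and nr: "nonreal \<theta>" "nonreal \<theta>'"
    and orth: "\<And>P. P \<in> I \<Longrightarrow> Kop \<theta>' (bc \<theta> P) = 0"
    and idem: "\<And>P. P \<in> I \<Longrightarrow> Kop \<theta> (bc \<theta> P) = bc \<theta> P"
  shows "\<not> FH_isomorphic (Md \<theta>) (Md \<theta>')"
proof
  assume "FH_isomorphic (Md \<theta>) (Md \<theta>')"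
  then obtain f where f: "bij_betw f (Md \<theta>) (Md \<theta>')"
    "\<And>u v. u \<in> Md \<theta> \<Longrightarrow> v \<in> Md \<theta> \<Longrightarrow> f (u + v) = f u + f v"
    "\<And>a v. v \<in> Md \<theta> \<Longrightarrow> f (a *s v) = a *s f v"
    "\<And>h v. h \<in> H \<Longrightarrow> v \<in> Md \<theta> \<Longrightarrow> f (module_act v h) = module_act (f v) h"
    unfolding FH_isomorphic_def by blast
  have f0: "f 0 = 0" using f(3)[of 0 0] Md_subspace vec.subspace_0 by fastforce
  have fsum: "f (\<Sum>i\<in>A. g i) = (\<Sum>i\<in>A. f (g i))" if "\<And>i. i \<in> A \<Longrightarrow> g i \<in> Md \<theta>" "finite A"
    for A and g :: "'i \<Rightarrow> ('f, 'k) pvec"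
    using that(2,1)
  proof (induction A)
    case (insert x A)
    then have "sum g A \<in> Md \<theta>" using Md_subspace by (intro vec.subspace_sum) auto
    then show ?case using insert f(2) by simp
  qed (simp add: f0)
  have fP: "f (Px x v) = Px x (f v)" if v: "v \<in> Md \<theta>" for x v
  proof -
    have m: "module_act v (unip b) \<in> Md \<theta>" for b unfolding unip_def using v by (intro Md_act) simp_all
    have "f (Px x v) = (\<Sum>b\<in>UNIV. f (psi (- (x * b)) *s module_act v (unip b)))"
      unfolding Px_def by (intro fsum vec.subspace_scale[OF Md_subspace] m) simp
    also have "\<dots> = Px x (f v)"
      unfolding Px_def using m v f(3,4) by (intro sum.cong) (auto simp: unip_def)
    finally show ?thesis .
  qed
  have fM: "f v \<in> Md \<theta>'" if "v \<in> Md \<theta>" for v using f(1) that by (auto simp: bij_betw_def)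
  have ex: "\<exists>a. f (yx \<theta> x) = a *s yx \<theta>' x" if x: "x \<noteq> 0" for x
  proof -
    have "f (yx \<theta> x) = Px x (f (yx \<theta> x))" using fP[OF yx_in_Md] Px_yx[OF x] by metis
    then show ?thesis using Px_Md[OF c(2) x fM[OF yx_in_Md]] by metis
  qed
  have torus: "f (yx \<theta> y) = a *s yx \<theta>' y"
    if a: "f (yx \<theta> x) = a *s yx \<theta>' x" and xy: "x \<noteq> 0" "y \<noteq> 0" "is_sq x \<longleftrightarrow> is_sq y" for a x y
  proof -
    have "is_sq (y / x)" unfolding is_sq_divide using xy is_sq_mult nonsq_mult_nonsq[OF odd] by blast
    then obtain t where t: "y / x = t^2" by (auto simp: is_sq_def)
    then have t0: "t \<noteq> 0" using xy by auto
    have y: "y = x * t^2" using t xy by (simp flip: t)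
    let ?h = "tau (mat2 t 0 0 (1 / t))"
    have "?h \<in> H" using t0 by (intro tau_in_H) simp
    then have "f (yx \<theta> y) = module_act (f (yx \<theta> x)) ?h"
      unfolding y act_yx_torus[OF t0, symmetric] by (rule f(4)[OF _ yx_in_Md])
    also have "\<dots> = a *s yx \<theta>' y" unfolding a y module_act_scale act_yx_torus[OF t0] ..
    finally show ?thesis .
  qed
  obtain a where a: "f (yx \<theta> 1) = a *s yx \<theta>' 1" using ex[of 1] by auto
  obtain b where b: "f (yx \<theta> nu) = b *s yx \<theta>' nu" using ex[of nu] by auto
  have fs: "f (ysq \<theta>) = a *s ysq \<theta>'" "f (ynsq \<theta>) = b *s ynsq \<theta>'"
  proof -
    have "f (ysq \<theta>) = (\<Sum>x | is_sq x \<and> x \<noteq> 0. f (yx \<theta> x))"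
      unfolding ysq_def by (intro fsum yx_in_Md) simp
    then show "f (ysq \<theta>) = a *s ysq \<theta>'"
      unfolding ysq_def vec.scale_sum_right using torus[OF a] by (auto intro!: sum.cong)
    have "f (ynsq \<theta>) = (\<Sum>x | \<not> is_sq x. f (yx \<theta> x))"
      unfolding ynsq_def by (intro fsum yx_in_Md) simp
    moreover have "y \<noteq> 0" if "\<not> is_sq y" for y :: 'k using that by auto
    ultimately show "f (ynsq \<theta>) = b *s ynsq \<theta>'"
      unfolding ynsq_def vec.scale_sum_right using torus[OF b] nonsq by (auto intro!: sum.cong)
  qed
  have sMd: "ysq \<theta> \<in> Md \<theta>" "ynsq \<theta> \<in> Md \<theta>"
    unfolding ysq_def ynsq_def using Md_subspace yx_in_Md by (auto intro!: vec.subspace_sum)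
  have f_y0: "f (yv \<theta> (pinf 0)) = a *s ysq \<theta>' + b *s ynsq \<theta>'"
    unfolding ysq_ynsq[OF c(1), symmetric] f(2)[OF sMd] fs ..
  have w0H: "w0 \<in> H" by (intro tau_in_H) simp
  have yvM: "yv \<theta> Q \<in> Md \<theta>" if "Q \<in> E" for Q using that by (simp add: Md_def vec.span_base)
  have inv: "module_act (f (yv \<theta> (pinf 0))) w0 = f (yv \<theta> (pinf 0))"
    using f(4)[OF w0H yvM[OF pinf_ext], of 0] act_w0_yv by metis
  have ab: "a = b"
  \<comment> \<open>With different factors, the image of the column at \<open>pinf 0\<close> would
    be a combination of the \<open>w0\<close>-invariant \<open>yv \<theta>' (pinf 0)\<close> and a
    nonzero multiple of \<open>ysq \<theta>'\<close>. Being itself invariant, it would make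
    \<open>ysq \<theta>'\<close> invariant.\<close>
  proof (rule ccontr)
    assume ab: "a \<noteq> b"
    have "f (yv \<theta> (pinf 0)) = b *s yv \<theta>' (pinf 0) + (a - b) *s ysq \<theta>'"
      unfolding f_y0 ysq_ynsq[OF c(2), symmetric] by (simp add: vec_eq_iff algebra_simps)
    then have "(a - b) *s module_act (ysq \<theta>') w0 = (a - b) *s ysq \<theta>'"
      using inv by (simp only: module_act_add module_act_scale act_w0_yv add_left_cancel)
    then have "module_act (ysq \<theta>') w0 = ysq \<theta>'" unfolding vec.scale_cancel_left using ab by simp
    then show False using ysq_not_invariant[OF c(2) nr(2)] by blast
  qed
  then have "f (yv \<theta> (pinf 0)) = a *s yv \<theta>' (pinf 0)"
    unfolding f_y0 ysq_ynsq[OF c(2), symmetric] by (simp add: vec.scale_right_distrib)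
  then have fy: "f (yv \<theta> Q) = a *s yv \<theta>' Q" if Q: "Q \<in> E" for Q
  proof -
    obtain A :: "'k ^ 2 ^ 2" where A: "det A = 1" "Q = point_act (pinf 0) (tau A)"
      using external_transitive[OF Q] by blast
    have act: "module_act (yv t (pinf 0)) (tau A) = yv t Q" for t using A by (simp add: module_act_yv)
    show ?thesis
      using f(4)[OF tau_in_H[OF A(1)] yvM[OF pinf_ext], of 0] \<open>f (yv \<theta> (pinf 0)) = a *s yv \<theta>' (pinf 0)\<close>
      unfolding act by (simp add: module_act_scale act)
  qed
  have fK: "f (Kop \<theta> v) = a *s Kop \<theta>' v" for v
  proof -
    have "f (Kop \<theta> v) = (\<Sum>Q\<in>E. f (v $ Q *s yv \<theta> Q))"
      unfolding Kop_def lin_ext_def by (intro fsum vec.subspace_scale[OF Md_subspace] yvM) simp_all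
    also have "\<dots> = (\<Sum>Q\<in>E. a *s (v $ Q *s yv \<theta>' Q))"
      using fy yvM f(3) by (intro sum.cong) (auto simp: mult.commute)
    finally show ?thesis by (simp add: Kop_def lin_ext_def vec.scale_sum_right)
  qed
  obtain P where P: "P \<in> I" "bc \<theta> P \<noteq> 0" using ex_bc_neq_0[OF c(1) nr(1)] by blast
  have "f (bc \<theta> P) = f 0" using fK[of "bc \<theta> P"] orth[OF P(1)] idem[OF P(1)] f0 by simp
  moreover have "bc \<theta> P \<in> Md \<theta>" using Kop_in[of \<theta> "bc \<theta> P"] idem[OF P(1)] by simp
  moreover have "0 \<in> Md \<theta>" using Md_subspace vec.subspace_0 by blast
  ultimately have "bc \<theta> P = 0" using f(1) by (auto simp: bij_betw_def inj_on_def)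
  then show False using P(2) by blast
qed

subsection \<open>Dimensions\<close>

text \<open>The coordinate at \<open>pinf b'\<close> is the sum of all coefficients except
  \<open>d b'\<close>. At \<open>b' = 0\<close> nothing is omitted, and subtraction isolates each
  coefficient. The vector \<open>v\<close> leaves room for further basis vectors that vanish on the
  tangent.\<close>

lemma yv_pinf_independent:
  assumes c: "is_char \<theta>" and s: "(\<Sum>b | b \<noteq> 0. d b *s yv \<theta> (pinf b)) + v = 0"
    and v: "\<And>b. v $ pinf b = 0"
  shows "b \<noteq> 0 \<Longrightarrow> d b = 0"
proof -
  have 1: "(\<Sum>b | b \<noteq> 0 \<and> b \<noteq> b'. d b) = 0" for b'
  proof -
    have "0 = ((\<Sum>b | b \<noteq> 0. d b *s yv \<theta> (pinf b)) + v) $ pinf b'" unfolding s by simp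
    also have "\<dots> = (\<Sum>b | b \<noteq> 0. if b \<noteq> b' then d b else 0)"
      using v c by (auto simp: sum_component yv_nth Kk_def kern_1 intro!: sum.cong)
    also have "\<dots> = (\<Sum>b | b \<noteq> 0 \<and> b \<noteq> b'. d b)"
      by (subst sum.inter_filter[symmetric]) simp_all
    finally show ?thesis ..
  qed
  assume b: "b \<noteq> 0"
  have "(\<Sum>b | b \<noteq> 0. d b) = d b + (\<Sum>b'\<in>{b. b \<noteq> 0} - {b}. d b')"
    using b by (intro sum.remove) auto
  moreover have "{b. b \<noteq> 0} - {b} = {b'. b' \<noteq> 0 \<and> b' \<noteq> b}" by auto
  ultimately show "d b = 0" using 1[of 0] 1[of b] by simp
qed

lemma yv_pinf_0: "is_char \<theta> \<Longrightarrow> yv \<theta> (pinf 0) = (\<Sum>b | b \<noteq> 0. yv \<theta> (pinf b))"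
proof -
  assume c: "is_char \<theta>"
  have "yv \<theta> (pinf 0) + (\<Sum>b\<in>UNIV - {0}. yv \<theta> (pinf b)) = 0"
    using sum.remove[of UNIV "0::'k" "\<lambda>b. yv \<theta> (pinf b)"] sum_yv_pinf[OF c] by simp
  moreover have "UNIV - {0::'k} = {b. b \<noteq> 0}" by auto
  ultimately have "yv \<theta> (pinf 0) = - (\<Sum>b | b \<noteq> 0. yv \<theta> (pinf b))" by (simp add: eq_neg_iff_add_eq_0)
  moreover have "- v = v" for v :: "('f, 'k) pvec" by (simp add: vec_eq_iff)
  ultimately show ?thesis by simp
qed

lemma card_nonzero: "card {b::'k. b \<noteq> 0} = CARD('k) - 1"
proof -
  have "{b::'k. b \<noteq> 0} = UNIV - {0}" by auto
  then show ?thesis by (simp add: card_Diff_singleton)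
qed

text \<open>If -1 is a square, \<open>- nu\<close> is not, so the norm form is anisotropic and the
  sum in \<open>Zv\<close> has no nonzero terms.\<close>

lemma Zv_eq_0:
  assumes "is_sq (- 1 :: 'k)"
  shows "Zv \<theta> m n = 0"
proof -
  have iso: "x = 0 \<and> y = 0" if "x^2 + nu * y^2 = 0" for x y
  proof (rule ccontr)
    assume n: "\<not> (x = 0 \<and> y = 0)"
    then have y: "y \<noteq> 0" using that by auto
    have "x^2 + y^2 * nu = 0" using that by (simp add: mult.commute)
    then have "y^2 * nu = (- 1) * x^2" by (metis add_eq_0_iff mult_minus1)
    then have "is_sq (y^2 * nu)" using is_sq_mult[OF assms] by simp
    then show False using y nonsq by simp
  qed
  show ?thesis
    unfolding Zv_def
  proof (intro sum.neutral ballI)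
    fix w
    show "(if (m - n * fst w)^2 + nu * (n * snd w)^2 = 0 \<and> (m - n * fst w \<noteq> 0 \<or> n * snd w \<noteq> 0) then \<theta> w else 0) = 0"
      using iso[of "m - n * fst w" "n * snd w"] by meson
  qed
qed

lemma Md_eq_span_1:
  assumes c: "is_char \<theta>" and sq: "is_sq (- 1 :: 'k)"
  shows "Md \<theta> = vec.span ((\<lambda>b. yv \<theta> (pinf b)) ` {b. b \<noteq> 0})"
proof
  let ?S = "vec.span ((\<lambda>b. yv \<theta> (pinf b)) ` {b. b \<noteq> 0})"
  show "?S \<subseteq> Md \<theta>" unfolding Md_def by (intro vec.span_mono) auto
  have pinf: "yv \<theta> (pinf b) \<in> ?S" for b
  proof (cases "b = 0")
    case True
    show ?thesis unfolding True yv_pinf_0[OF c] by (intro vec.span_sum vec.span_base) auto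
  qed (auto intro: vec.span_base)
  have "yv \<theta> Q \<in> ?S" if "Q \<in> E" for Q
    using that
  proof (cases rule: external_cases)
    case (2 b m)
    have "Zvec \<theta> m 0 = 0"
      unfolding vec_eq_iff
    proof
      fix R show "Zvec \<theta> m 0 $ R = 0 $ R"
      proof (cases "R \<in> E")
        case True
        then show ?thesis by (cases rule: external_cases) (simp_all add: Zvec_nth[OF c 2(1)] Zv_eq_0[OF sq])
      qed (simp add: Zvec_nth[OF c 2(1)])
    qed
    then show ?thesis unfolding 2(2) yv_pf[OF c 2(1)] using pinf by (auto intro!: vec.span_sum vec.span_scale)
  qed (use pinf in simp)
  then show "Md \<theta> \<subseteq> ?S" unfolding Md_def by (intro vec.span_minimal) auto
qed

lemma dim_Md_1:
  assumes c: "is_char \<theta>" and sq: "is_sq (- 1 :: 'k)"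
  shows "vec.dim (Md \<theta>) = CARD('k) - 1"
  unfolding Md_eq_span_1[OF assms] card_nonzero[symmetric]
proof (rule dim_span_indexed)
  show "d b = 0" if "(\<Sum>b | b \<noteq> 0. d b *s yv \<theta> (pinf b)) = 0" "b \<in> {b. b \<noteq> 0}" for d b
    using yv_pinf_independent[OF c, of d 0 b] that by simp
qed simp

section \<open>The split norm-one group and the dimension q + 1\<close>

lemma lmul_nth:
  "fst (lmul u v) = fst u * fst v - nu * snd u * snd v" "snd (lmul u v) = fst u * snd v + fst v * snd u"
  by (cases u; cases v; simp)+

text \<open>For \<open>nu = - 1\<close> the norm form splits and \<open>lam\<close> parametrises the norm-one group by the nonzero
  elements of the field.\<close>

definition lam :: "'k \<Rightarrow> 'k \<times> 'k" where
  "lam x = ((x + 1 / x) / 2, (x - 1 / x) / 2)"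

lemma lam_fst_snd: "fst (lam x) + snd (lam x) = x" "fst (lam x) - snd (lam x) = 1 / x"
proof -
  have "x + 1 / x + (x - 1 / x) = 2 * x" "x + 1 / x - (x - 1 / x) = 2 * (1 / x)" by simp_all
  then show "fst (lam x) + snd (lam x) = x" "fst (lam x) - snd (lam x) = 1 / x"
    unfolding lam_def fst_conv snd_conv add_divide_distrib[symmetric] diff_divide_distrib[symmetric]
    by (simp_all only: nonzero_mult_div_cancel_left[OF two])
qed

lemma lam_minus: "lam (- x) = - lam x"
proof -
  have "- x + 1 / (- x) = - (x + 1 / x)" "- x - 1 / (- x) = - (x - 1 / x)" by simp_all
  then show ?thesis unfolding lam_def uminus_Pair by (simp only: minus_divide_left)
qed

lemma lam_inverse: "lam (1 / x) = lcnj (lam x)"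
proof -
  have "1 / x + 1 / (1 / x) = x + 1 / x" "1 / x - 1 / (1 / x) = - (x - 1 / x)" by simp_all
  then show ?thesis unfolding lam_def lcnj.simps by (simp only: minus_divide_left)
qed

context
  assumes nu: "nu = - 1"
begin

lemma lam_in [simp]: "x \<noteq> 0 \<Longrightarrow> lam x \<in> Lam"
proof -
  assume x: "x \<noteq> 0"
  have "(fst (lam x))^2 + nu * (snd (lam x))^2 = (fst (lam x) + snd (lam x)) * (fst (lam x) - snd (lam x))"
    by (simp add: nu power2_eq_square algebra_simps)
  also have "\<dots> = 1" unfolding lam_fst_snd using x by simp
  finally show ?thesis unfolding Lam_iff .
qed

lemma lam_surj:
  assumes "w \<in> Lam"
  shows "fst w + snd w \<noteq> 0" "w = lam (fst w + snd w)" "1 / (fst w + snd w) = fst w - snd w"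
proof -
  have "(fst w)^2 + nu * (snd w)^2 = 1" using assms by (simp only: Lam_iff)
  then have p: "(fst w + snd w) * (fst w - snd w) = 1"
    unfolding nu by (simp add: power2_eq_square algebra_simps)
  then show 0: "fst w + snd w \<noteq> 0" by auto
  show i: "1 / (fst w + snd w) = fst w - snd w"
    using p 0 by (simp add: divide_eq_eq mult.commute)
  have h: "u + u = 2 * u" for u :: 'k by simp
  show "w = lam (fst w + snd w)" unfolding lam_def i by (cases w) simp
qed

lemma lam_mult: "x \<noteq> 0 \<Longrightarrow> y \<noteq> 0 \<Longrightarrow> lmul (lam x) (lam y) = lam (x * y)"
proof -
  assume xy: "x \<noteq> 0" "y \<noteq> 0"
  let ?w = "lmul (lam x) (lam y)"
  have "fst ?w + snd ?w = (fst (lam x) + snd (lam x)) * (fst (lam y) + snd (lam y))"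
    unfolding lmul_nth by (simp add: nu algebra_simps)
  then have "fst ?w + snd ?w = x * y" unfolding lam_fst_snd .
  then show ?thesis using lam_surj(2)[of ?w] xy by simp
qed

text \<open>For \<open>w = lam x\<close> the norm of m - n w factors as (m - n x) (m - n / x), so it
  is zero for x = m / n and x = n / m. If \<open>m^2 = n^2\<close>, these coincide and m - n w
  itself is 0; then both sides vanish, the right one because its two terms are equal.\<close>

lemma Zv_eq:
  assumes c: "is_char \<theta>" and m: "m \<noteq> 0" and n: "n \<noteq> 0"
  shows "Zv \<theta> m n = \<theta> (lam (m / n)) + \<theta> (lam (n / m))"
proof -
  have fac: "(m - n * fst w)^2 + nu * (n * snd w)^2 =
      (m - n * (fst w + snd w)) * (m - n * (fst w - snd w))" for w
    by (simp add: nu power2_eq_square algebra_simps)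
  have iso: "(m - n * fst w)^2 + nu * (n * snd w)^2 = 0 \<longleftrightarrow> w = lam (m / n) \<or> w = lam (n / m)"
    if w: "w \<in> Lam" for w
  proof -
    have "m - n * (fst w + snd w) = 0 \<longleftrightarrow> w = lam (m / n)"
    proof
      assume "m - n * (fst w + snd w) = 0"
      then have "fst w + snd w = m / n" using n by (simp add: eq_divide_eq mult.commute)
      then show "w = lam (m / n)" using lam_surj(2)[OF w] by simp
    qed (use lam_fst_snd n in simp)
    moreover have "m - n * (fst w - snd w) = 0 \<longleftrightarrow> w = lam (n / m)"
    proof
      assume "m - n * (fst w - snd w) = 0"
      then have "1 / (fst w + snd w) = m / n" using n lam_surj(3)[OF w] by (simp add: eq_divide_eq mult.commute)
      then have "fst w + snd w = n / m" using lam_surj(1)[OF w] m n by (simp add: field_simps)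
      then show "w = lam (n / m)" using lam_surj(2)[OF w] by simp
    qed (use lam_fst_snd n m in simp)
    ultimately show ?thesis unfolding fac by simp
  qed
  show ?thesis
  proof (cases "m^2 = n^2")
    case True
    then have mn: "m = n \<or> m = - n" by (simp add: power2_eq_iff)
    have "Zv \<theta> m n = 0"
      unfolding Zv_def
    proof (intro sum.neutral ballI)
      fix w assume w: "w \<in> Lam"
      show "(if (m - n * fst w)^2 + nu * (n * snd w)^2 = 0 \<and> (m - n * fst w \<noteq> 0 \<or> n * snd w \<noteq> 0) then \<theta> w else 0) = 0"
      proof (cases "(m - n * fst w)^2 + nu * (n * snd w)^2 = 0")
        case True
        then have "w = lam (m / n)" using iso[OF w] mn n by auto
        moreover have "lam 1 = (1, 0)" "lam (- 1) = (- 1, 0)"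
          by (simp_all add: lam_def minus_divide_left[symmetric])
        ultimately have "m - n * fst w = 0 \<and> n * snd w = 0" using mn n by auto
        then show ?thesis by simp
      qed simp
    qed
    moreover have "m / n = n / m" using True m n by (simp add: frac_eq_eq power2_eq_square)
    ultimately show ?thesis by simp
  next
    case False
    have ne: "m / n \<noteq> n / m" using False m n by (simp add: frac_eq_eq power2_eq_square)
    have lne: "lam (m / n) \<noteq> lam (n / m)" using ne lam_fst_snd(1) by metis
    have "Zv \<theta> m n = (\<Sum>w\<in>Lam. if w = lam (m / n) \<or> w = lam (n / m) then \<theta> w else 0)"
      unfolding Zv_def
    proof (rule sum.cong[OF refl])
      fix w assume w: "w \<in> Lam"
      have "m - n * fst w \<noteq> 0 \<or> n * snd w \<noteq> 0"
      proof (rule ccontr)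
        assume "\<not> ?thesis"
        then have "m = n * fst w" "snd w = 0" using n by auto
        moreover from this have "(fst w)^2 = 1" using w by (simp add: Lam_iff)
        ultimately have "m^2 = n^2" by (simp add: power_mult_distrib)
        then show False using False by simp
      qed
      then show "(if (m - n * fst w)^2 + nu * (n * snd w)^2 = 0 \<and> (m - n * fst w \<noteq> 0 \<or> n * snd w \<noteq> 0) then \<theta> w else 0) =
          (if w = lam (m / n) \<or> w = lam (n / m) then \<theta> w else 0)" using iso[OF w] by simp
    qed
    also have "\<dots> = sum \<theta> {w \<in> Lam. w = lam (m / n) \<or> w = lam (n / m)}"
      by (rule sum.inter_filter[symmetric]) simp
    also have "{w \<in> Lam. w = lam (m / n) \<or> w = lam (n / m)} = {lam (m / n), lam (n / m)}"
      using m n by auto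
    finally show ?thesis using lne by simp
  qed
qed

text \<open>The coordinate of \<open>zt g\<close> at the point with parameters \<open>b + n\<close> and \<open>b - n\<close> is \<open>g n\<close>.\<close>

definition zt :: "('k \<Rightarrow> 'f) \<Rightarrow> ('f, 'k) pvec" where
  "zt g = (\<chi> R. if \<exists>b n. n \<noteq> 0 \<and> R = pf b (b^2 - n^2) then g (SOME n. \<exists>b. n \<noteq> 0 \<and> R = pf b (b^2 - n^2)) else 0)"

lemma zt_nth:
  assumes "\<And>x. g (- x) = g x"
  shows "n \<noteq> 0 \<Longrightarrow> zt g $ pf b (b^2 - n^2) = g n" "zt g $ pinf b = 0" "R \<notin> E \<Longrightarrow> zt g $ R = 0"
proof -
  show "zt g $ pf b (b^2 - n^2) = g n" if n: "n \<noteq> 0"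
  proof -
    let ?P = "\<lambda>n'. \<exists>b'. n' \<noteq> 0 \<and> pf b (b^2 - n^2) = pf b' (b'^2 - n'^2)"
    have "?P n" using n by blast
    then have "?P (SOME n'. ?P n')" by (rule someI)
    then have "(SOME n'. ?P n')^2 = n^2" by auto
    then have "g (SOME n'. ?P n') = g n" using assms by (auto simp: power2_eq_iff)
    then show ?thesis using n unfolding zt_def by auto
  qed
qed (auto simp: zt_def)

lemma lam_even: "is_char \<theta> \<Longrightarrow> \<theta> (lam (- x)) = \<theta> (lam x)"
proof -
  assume c: "is_char \<theta>"
  show ?thesis
  proof (cases "x = 0")
    case False
    then show ?thesis unfolding lam_minus by (intro char_minus[OF c]) simp
  qed simp
qed

text \<open>Multiplicativity of \<theta> separates \<open>m\<close> from the coordinate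
  \<open>n\<close> in \<open>Zv_eq\<close>. So the defects for all \<open>m\<close> lie in the span
  of two fixed vectors, which accounts for q + 1 = (q - 1) + 2.\<close>

lemma Zvec_eq_zt:
  assumes c: "is_char \<theta>" and m: "m \<noteq> 0"
  shows "Zvec \<theta> m 0 = \<theta> (lam m) *s zt (\<lambda>n. \<theta> (lam (1 / n))) + \<theta> (lam (1 / m)) *s zt (\<lambda>n. \<theta> (lam n))"
  unfolding vec_eq_iff
proof
  have e: "\<theta> (lam (1 / - n)) = \<theta> (lam (1 / n))" for n
    using lam_even[OF c, of "1 / n"] by simp
  note z = zt_nth[of "\<lambda>n. \<theta> (lam n)", OF lam_even[OF c]] zt_nth[of "\<lambda>n. \<theta> (lam (1 / n))", OF e]
  fix R
  show "Zvec \<theta> m 0 $ R = (\<theta> (lam m) *s zt (\<lambda>n. \<theta> (lam (1 / n))) + \<theta> (lam (1 / m)) *s zt (\<lambda>n. \<theta> (lam n))) $ R"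
  proof (cases "R \<in> E")
    case True
    then show ?thesis
    proof (cases rule: external_cases)
      case (2 b n)
      have "\<theta> (lam (m / n)) = \<theta> (lam m) * \<theta> (lam (1 / n))" "\<theta> (lam (n / m)) = \<theta> (lam (1 / m)) * \<theta> (lam n)"
        using char_mult[OF c, of "lam m" "lam (1 / n)"] char_mult[OF c, of "lam (1 / m)" "lam n"] m 2(1)
        by (simp_all add: lam_mult)
      then show ?thesis using 2 by (simp add: Zvec_nth[OF c m] z Zv_eq[OF c m])
    qed (simp add: Zvec_nth[OF c m] z)
  qed (simp add: Zvec_nth[OF c m] z)
qed

definition basis3 :: "('k \<times> 'k \<Rightarrow> 'f) \<Rightarrow> 'k + bool \<Rightarrow> ('f, 'k) pvec" where
  "basis3 \<theta> j = (case j of Inl b \<Rightarrow> yv \<theta> (pinf b)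
     | Inr s \<Rightarrow> if s then zt (\<lambda>n. \<theta> (lam n)) else zt (\<lambda>n. \<theta> (lam (1 / n))))"

lemma nonreal_lam:
  assumes "nonreal \<theta>"
  obtains m where "m \<noteq> 0" "\<theta> (lam m) \<noteq> \<theta> (lam (1 / m))"
proof -
  obtain u where u: "u \<in> Lam" "\<theta> u \<noteq> \<theta> (lcnj u)" using assms by (auto simp: nonreal_def)
  then show ?thesis using that[of "fst u + snd u"] lam_surj[OF u(1)] lam_inverse by metis
qed

lemma Md_eq_span_3:
  assumes c: "is_char \<theta>" and nr: "nonreal \<theta>"
  shows "Md \<theta> = vec.span (basis3 \<theta> ` ({b. b \<noteq> 0} <+> UNIV))"
proof
  let ?S = "vec.span (basis3 \<theta> ` ({b. b \<noteq> 0} <+> UNIV))"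
  let ?zp = "zt (\<lambda>n. \<theta> (lam n))" and ?zm = "zt (\<lambda>n. \<theta> (lam (1 / n)))"
  have base: "basis3 \<theta> j \<in> ?S" if "j \<in> {b. b \<noteq> 0} <+> UNIV" for j using that by (intro vec.span_base) blast
  have pinf: "yv \<theta> (pinf b) \<in> ?S" for b
  proof -
    have 1: "yv \<theta> (pinf b) \<in> ?S" if "b \<noteq> 0" for b using base[of "Inl b"] that by (simp add: basis3_def InlI)
    show ?thesis
    proof (cases "b = 0")
      case True
      show ?thesis unfolding True yv_pinf_0[OF c] using 1 by (intro vec.span_sum) auto
    qed (rule 1)
  qed
  have z: "?zp \<in> ?S" "?zm \<in> ?S"
    using base[of "Inr True"] base[of "Inr False"] by (simp_all add: basis3_def InrI)
  have "yv \<theta> Q \<in> ?S" if "Q \<in> E" for Q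
    using that
  proof (cases rule: external_cases)
    case (2 b m)
    then show ?thesis unfolding 2(2) yv_pf[OF c 2(1)] Zvec_eq_zt[OF c 2(1)] using pinf z
      by (auto intro!: vec.span_sum vec.span_scale vec.span_add)
  qed (use pinf in simp)
  then show "Md \<theta> \<subseteq> ?S" unfolding Md_def by (intro vec.span_minimal) auto
  have Zin: "Zvec \<theta> m 0 \<in> Md \<theta>" if "m \<noteq> 0" for m
    unfolding Zvec_def Md_def using that by (intro vec.span_add vec.span_sum vec.span_scale vec.span_base) simp_all
  have l1: "\<theta> (lam 1) = 1" using c by (simp add: lam_def char_1)
  obtain m where m: "m \<noteq> 0" "\<theta> (lam m) \<noteq> \<theta> (lam (1 / m))" using nonreal_lam[OF nr] .
  \<comment> \<open>The defect for 1 is the sum of the two vectors; the one for an \<open>m\<close>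
    with \<open>\<theta> (lam m) \<noteq> \<theta> (lam (1 / m))\<close> is not a multiple of this
    sum and separates them.\<close>
  have s1: "?zm + ?zp \<in> Md \<theta>" using Zin[of 1] Zvec_eq_zt[OF c, of 1] l1 by simp
  have "Zvec \<theta> m 0 - \<theta> (lam m) *s (?zm + ?zp) \<in> Md \<theta>"
    by (intro vec.subspace_diff[OF Md_subspace] vec.subspace_scale[OF Md_subspace] Zin[OF m(1)] s1)
  moreover have "Zvec \<theta> m 0 - \<theta> (lam m) *s (?zm + ?zp) = (\<theta> (lam (1 / m)) - \<theta> (lam m)) *s ?zp"
    unfolding Zvec_eq_zt[OF c m(1)] by (simp add: vec_eq_iff algebra_simps)
  ultimately have "(\<theta> (lam (1 / m)) - \<theta> (lam m)) *s ?zp \<in> Md \<theta>" by (simp only:)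
  then have "(1 / (\<theta> (lam (1 / m)) - \<theta> (lam m))) *s ((\<theta> (lam (1 / m)) - \<theta> (lam m)) *s ?zp) \<in> Md \<theta>"
    by (rule vec.subspace_scale[OF Md_subspace])
  moreover have "(1 / a) *s (a *s v) = v" if "a \<noteq> 0" for a and v :: "('f, 'k) pvec"
    using that by (simp add: vec_eq_iff)
  ultimately have zp: "?zp \<in> Md \<theta>" using m(2) by (metis eq_iff_diff_eq_0)
  have zm: "?zm \<in> Md \<theta>" using vec.subspace_diff[OF Md_subspace s1 zp] by simp
  have "basis3 \<theta> j \<in> Md \<theta>" for j
    using zp zm by (auto simp: basis3_def Md_def intro: vec.span_base split: sum.split)
  then show "?S \<subseteq> Md \<theta>" by (intro vec.span_minimal Md_subspace) auto
qed

lemma dim_Md_3: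
  assumes c: "is_char \<theta>" and nr: "nonreal \<theta>"
  shows "vec.dim (Md \<theta>) = CARD('k) + 1"
proof -
  let ?J = "{b::'k. b \<noteq> 0} <+> (UNIV :: bool set)"
  let ?zp = "zt (\<lambda>n. \<theta> (lam n))" and ?zm = "zt (\<lambda>n. \<theta> (lam (1 / n)))"
  have e: "\<theta> (lam (1 / - n)) = \<theta> (lam (1 / n))" for n using lam_even[OF c, of "1 / n"] by simp
  note z = zt_nth[of "\<lambda>n. \<theta> (lam n)", OF lam_even[OF c]] zt_nth[of "\<lambda>n. \<theta> (lam (1 / n))", OF e]
  have "vec.dim (vec.span (basis3 \<theta> ` ?J)) = card ?J"
  proof (rule dim_span_indexed)
    fix d j assume s: "(\<Sum>j\<in>?J. d j *s basis3 \<theta> j) = 0" and j: "j \<in> ?J"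
    have "(\<Sum>j\<in>?J. d j *s basis3 \<theta> j) = (\<Sum>b | b \<noteq> 0. d (Inl b) *s yv \<theta> (pinf b)) +
        (d (Inr False) *s ?zm + d (Inr True) *s ?zp)"
      by (simp add: sum.Plus basis3_def UNIV_bool)
    then have s: "(\<Sum>b | b \<noteq> 0. d (Inl b) *s yv \<theta> (pinf b)) + (d (Inr False) *s ?zm + d (Inr True) *s ?zp) = 0"
      using s by simp
    have d0: "d (Inl b) = 0" if "b \<noteq> 0" for b
      by (rule yv_pinf_independent[OF c s _ that]) (simp add: z)
    then have s': "d (Inr False) *s ?zm + d (Inr True) *s ?zp = 0" using s by simp
    have eq: "d (Inr False) * \<theta> (lam (1 / n)) + d (Inr True) * \<theta> (lam n) = 0" if "n \<noteq> 0" for n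
    proof -
      have "(d (Inr False) *s ?zm + d (Inr True) *s ?zp) $ pf 0 (0^2 - n^2) = 0" unfolding s' by simp
      then show ?thesis using z(1)[OF that, of 0] z(4)[OF that, of 0] by simp
    qed
    obtain m where m: "m \<noteq> 0" "\<theta> (lam m) \<noteq> \<theta> (lam (1 / m))" using nonreal_lam[OF nr] .
    have "d (Inr False) + d (Inr True) = 0" using eq[of 1] c by (simp add: lam_def char_1)
    then have dd: "d (Inr False) = d (Inr True)" using char2_eq_iff_add[OF char2] by metis
    then have "d (Inr True) * (\<theta> (lam (1 / m)) + \<theta> (lam m)) = 0" using eq[OF m(1)] by (simp add: distrib_left)
    moreover have "\<theta> (lam (1 / m)) + \<theta> (lam m) \<noteq> 0" using m(2) char2_eq_iff_add[OF char2] by metis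
    ultimately have dT: "d (Inr True) = 0" by simp
    show "d j = 0"
    proof (cases j)
      case (Inl b)
      then show ?thesis using d0 j by auto
    next
      case (Inr s)
      then show ?thesis using dT dd by (cases s) auto
    qed
  qed simp
  also have "card ?J = CARD('k) + 1"
    using odd by (simp add: card_Plus card_nonzero)
  finally show ?thesis unfolding Md_eq_span_3[OF c nr] .
qed

end

end

section \<open>Direct sums from orthogonal projections\<close>

lemma listset_iff: "xs \<in> listset Us \<longleftrightarrow> length xs = length Us \<and> (\<forall>i<length Us. xs ! i \<in> Us ! i)"
proof (induction Us arbitrary: xs)
  case (Cons A Us)
  show ?case
  proof (cases xs)
    case (Cons x ys)
    then show ?thesis using Cons.IH[of ys] by (auto simp: set_Cons_def All_less_Suc2)
  qed (auto simp: set_Cons_def)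
qed simp

text \<open>The list of the components \<open>pr i v\<close> inverts \<open>sum_list\<close>: it
  adds up to \<open>v\<close> by \<open>total\<close>, and \<open>orth\<close> recovers each entry
  of a list from its sum.\<close>

lemma bij_betw_sum_list_listset:
  fixes V :: "('f::field ^ 'n) set"
  assumes V: "vec.subspace V" and sub: "\<And>i. i < length Us \<Longrightarrow> Us ! i \<subseteq> V"
    and add: "\<And>i u v. pr i (u + v) = pr i u + pr i v"
    and total: "\<And>v. v \<in> V \<Longrightarrow> (\<Sum>i<length Us. pr i v) = v"
    and mem: "\<And>i v. i < length Us \<Longrightarrow> v \<in> V \<Longrightarrow> pr i v \<in> Us ! i"
    and orth: "\<And>i j u. i < length Us \<Longrightarrow> j < length Us \<Longrightarrow> u \<in> Us ! j \<Longrightarrow> pr i u = (if i = j then u else 0)"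
  shows "bij_betw sum_list (listset Us) V"
proof (rule bij_betwI[where g = "\<lambda>v. map (\<lambda>i. pr i v) [0..<length Us]"])
  have pr0: "pr i 0 = 0" for i using add[of i 0 0] by simp
  have pr_sum: "pr i (\<Sum>j\<in>A. f j) = (\<Sum>j\<in>A. pr i (f j))" for i A and f :: "nat \<Rightarrow> 'f ^ 'n"
    by (induction A rule: infinite_finite_induct) (simp_all add: pr0 add)
  have sl: "sum_list xs = (\<Sum>j<length Us. xs ! j)" if "xs \<in> listset Us" for xs
    using that by (simp add: sum_list_sum_nth listset_iff atLeast0LessThan)
  show "sum_list \<in> listset Us \<rightarrow> V"
  proof
    fix xs assume xs: "xs \<in> listset Us"
    then show "sum_list xs \<in> V" unfolding sl[OF xs] using sub
      by (intro vec.subspace_sum[OF V]) (auto simp: listset_iff)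
  qed
  show "(\<lambda>v. map (\<lambda>i. pr i v) [0..<length Us]) \<in> V \<rightarrow> listset Us"
    using mem by (auto simp: listset_iff)
  show "sum_list (map (\<lambda>i. pr i v) [0..<length Us]) = v" if "v \<in> V" for v
    using total[OF that] by (simp add: interv_sum_list_conv_sum_set_nat atLeast0LessThan)
  show "map (\<lambda>i. pr i (sum_list xs)) [0..<length Us] = xs" if xs: "xs \<in> listset Us" for xs
  proof (rule nth_equalityI)
    show "length (map (\<lambda>i. pr i (sum_list xs)) [0..<length Us]) = length xs" using xs by (simp add: listset_iff)
    fix i assume "i < length (map (\<lambda>i. pr i (sum_list xs)) [0..<length Us])"
    then have i: "i < length Us" by simp
    have "pr i (sum_list xs) = (\<Sum>j<length Us. pr i (xs ! j))" unfolding sl[OF xs] pr_sum ..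
    also have "\<dots> = (\<Sum>j<length Us. if i = j then xs ! j else 0)"
      using xs orth[OF i] by (intro sum.cong) (auto simp: listset_iff)
    also have "\<dots> = xs ! i" using i by simp
    finally show "map (\<lambda>i. pr i (sum_list xs)) [0..<length Us] ! i = xs ! i" using i by simp
  qed
qed

section \<open>The decomposition for a family of characters\<close>

context conic_psi
begin

lemma FH_trivial_one: "FH_trivial (vec.span {chi E :: ('f, 'k) pvec})"
proof -
  let ?o = "chi E :: ('f, 'k) pvec"
  have act: "module_act ?o h = ?o" if h: "h \<in> H" for h
  proof -
    obtain A where A: "h = tau A" "det A = 1" using H_tauE[OF h] .
    show ?thesis unfolding A(1) by (rule module_act_eqI) (use A external_subset in auto)
  qed
  have "?o $ pinf 0 \<noteq> 0" by simp
  then have o0: "?o \<noteq> 0" by (metis zero_index)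
  have act': "module_act v h = v" if "h \<in> H" "v \<in> vec.span {?o}" for h v
    using that act by (auto simp: vec.span_singleton module_act_scale)
  have "vec.span {?o} \<subseteq> perm_space points"
    using external_subset by (auto simp: vec.span_singleton perm_space_iff)
  then have "FH_module (vec.span {?o})" unfolding FH_module_def using act' by simp
  moreover have "vec.dim (vec.span {?o}) = 1"
    using o0 by (simp add: vec.dim_eq_card_independent)
  ultimately show ?thesis unfolding FH_trivial_def using act' by blast
qed

context
  fixes L and \<theta> :: "nat \<Rightarrow> 'k \<times> 'k \<Rightarrow> 'f" and N :: nat
  assumes L: "odd_part L"
    and char: "\<And>i. i \<in> {1..N} \<Longrightarrow> is_char (\<theta> i)" and nonreal: "\<And>i. i \<in> {1..N} \<Longrightarrow> nonreal (\<theta> i)"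
    and distinct: "\<And>i j. i \<in> {1..N} \<Longrightarrow> j \<in> {1..N} \<Longrightarrow> i \<noteq> j \<Longrightarrow>
        (\<exists>u\<in>Lam. \<theta> i u * \<theta> j u \<noteq> 1) \<and> (\<exists>u\<in>Lam. \<theta> i u * \<theta> j (lcnj u) \<noteq> 1)"
    and total: "\<And>u. u \<in> Lam \<Longrightarrow> snd u \<noteq> 0 \<Longrightarrow> (\<Sum>i = 1..N. tr (\<theta> i) u) = (1 :: 'f)"
begin

text \<open>The factor in \<open>Kop_bc\<close> consists of two character sums, for the product of
  the characters and for the product with the conjugate. If \<open>i = j\<close>, only the second
  product is trivial, because \<open>\<theta> i\<close> is not its own inverse; if
  \<open>i \<noteq> j\<close>, neither is.\<close>

lemma Kop_bc_family:
  assumes i: "i \<in> {1..N}" and j: "j \<in> {1..N}" and P: "P \<in> I"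
  shows "Kop (\<theta> i) (bc (\<theta> j) P) = (if i = j then bc (\<theta> j) P else 0)"
proof -
  have c1: "is_char (\<lambda>u. \<theta> i u * \<theta> j u)" "is_char (\<lambda>u. \<theta> i u * \<theta> j (lcnj u))"
    by (rule is_char_mult[OF char[OF i] char[OF j]], rule is_char_mult[OF char[OF i] is_char_cnj[OF char[OF j]]])
  note K = Kop_bc[OF L char[OF j] char[OF i] P, unfolded char_sum[OF L c1(1)] char_sum[OF L c1(2)]]
  show ?thesis
  proof (cases "i = j")
    case True
    obtain u where u: "u \<in> Lam" "\<theta> i u \<noteq> \<theta> i (lcnj u)" using nonreal[OF i] by (auto simp: nonreal_def)
    have "\<theta> i u * \<theta> i u \<noteq> 1" using u char_cnj[OF char[OF i] u(1)] by (metis mult_cancel_left mult_zero_left zero_neq_one)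
    then show ?thesis using K True u(1) char_cnj[OF char[OF i]] by auto
  next
    case False
    then show ?thesis using K distinct[OF i j False] by auto
  qed
qed

lemma Kop_Md:
  assumes i: "i \<in> {1..N}" and j: "j \<in> {1..N}" and v: "v \<in> Md (\<theta> j)"
  shows "Kop (\<theta> i) v = (if i = j then v else 0)"
  using v unfolding Md_eq_span_bc[OF char[OF j] nonreal[OF j]]
proof (induction rule: vec.span_induct_alt)
  case (step c x y)
  then show ?case using Kop_bc_family[OF i j] by (auto simp: Kop_add Kop_scale)
qed simp

lemma Md_not_isomorphic:
  assumes i: "i \<in> {1..N}" and j: "j \<in> {1..N}" and ij: "i \<noteq> j"
  shows "\<not> FH_isomorphic (Md (\<theta> i)) (Md (\<theta> j))"
proof (rule not_isomorphic)
  show "Kop (\<theta> j) (bc (\<theta> i) P) = 0" "Kop (\<theta> i) (bc (\<theta> i) P) = bc (\<theta> i) P" if "P \<in> I" for P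
    using Kop_bc_family that i j ij by auto
qed (use char nonreal i j in auto)

lemma Kop_Im_phi_D:
  assumes i: "i \<in> {1..N}" and v: "v \<in> Im_phi_D"
  shows "Kop (\<theta> i) v = 0"
  using v unfolding Im_phi_D_eq
proof (induction rule: vec.span_induct_alt)
  case (step c x y)
  then show ?case using Kop_Dcol[OF char[OF i]] by (auto simp: Kop_add Kop_scale)
qed simp

lemma sum_bc:
  assumes P: "P \<in> I"
  shows "(\<Sum>i = 1..N. bc (\<theta> i) P) = Bcol P + Dcol P + (if CARD('k) mod 4 = 1 then 0 else chi E)"
  using sum_Bt[of "{1..N}" \<theta>, OF char total _ P]
  by (auto simp: vec_eq_iff sum_component bc_def Bcol_def Dcol_def)

lemma dblv: "v + v = (0 :: ('f, 'k) pvec)"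
  by (simp add: vec_eq_iff)

lemma dblv_left: "v + (v + w) = (w :: ('f, 'k) pvec)"
  by (simp add: dblv flip: add.assoc)

lemma Dcol_eq:
  assumes P: "P \<in> I"
  shows "Dcol P = Bcol P + (\<Sum>i = 1..N. bc (\<theta> i) P) + (if CARD('k) mod 4 = 1 then 0 else chi E)"
  unfolding sum_bc[OF P] by (simp add: dblv dblv_left add_ac)

text \<open>The identity minus all projections, with the sign absorbed by characteristic two. By
  \<open>Dcol_eq\<close> it sends a column of \<open>Bk\<close> to that of \<open>Dk\<close>, up to
  the all-one vector if q is 3 modulo 4.\<close>

definition pD :: "('f, 'k) pvec \<Rightarrow> ('f, 'k) pvec" where
  "pD v = v + (\<Sum>i = 1..N. Kop (\<theta> i) v)"

lemma pD_add: "pD (u + v) = pD u + pD v" and pD_scale: "pD (c *s v) = c *s pD v" and pD_0: "pD 0 = 0"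
  by (simp_all add: pD_def Kop_add Kop_scale sum.distrib vec.scale_right_distrib vec.scale_sum_right)

lemma pD_Md: "j \<in> {1..N} \<Longrightarrow> v \<in> Md (\<theta> j) \<Longrightarrow> pD v = 0"
proof -
  assume j: "j \<in> {1..N}" and v: "v \<in> Md (\<theta> j)"
  have "(\<Sum>i = 1..N. Kop (\<theta> i) v) = (\<Sum>i = 1..N. if i = j then v else 0)"
    using Kop_Md[OF _ j v] by (intro sum.cong) auto
  then show ?thesis using j by (simp add: pD_def dblv)
qed

lemma pD_Im_phi_D: "v \<in> Im_phi_D \<Longrightarrow> pD v = v"
  using Kop_Im_phi_D by (simp add: pD_def)

lemma pD_Bcol: "P \<in> I \<Longrightarrow> pD (Bcol P) = Bcol P + (\<Sum>i = 1..N. bc (\<theta> i) P)"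
  unfolding pD_def by (intro arg_cong2[where f = "(+)"] sum.cong refl Kop_Bcol char)

lemma Im_phi_B_subspace: "vec.subspace (Im_phi_B :: ('f, 'k) pvec set)"
  and Im_phi_D_subspace: "vec.subspace (Im_phi_D :: ('f, 'k) pvec set)"
  using FH_Im_phi FH_moduleD by blast+

lemma Bcol_in: "P \<in> I \<Longrightarrow> Bcol P \<in> Im_phi_B" and Dcol_in: "P \<in> I \<Longrightarrow> Dcol P \<in> Im_phi_D"
  unfolding Im_phi_B_eq Im_phi_D_eq by (simp_all add: vec.span_base)

lemma direct_sum_1:
  assumes q: "CARD('k) mod 4 = 1"
  shows "FH_direct_sum (Im_phi_B :: ('f, 'k) pvec set) (Im_phi_D # map (\<lambda>i. Md (\<theta> i)) [1..<N + 1])"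
  unfolding FH_direct_sum_def
proof (intro conjI)
  let ?Us = "Im_phi_D # map (\<lambda>i. Md (\<theta> i)) [1..<N + 1]"
  \<comment> \<open>\<open>Im_phi_D\<close> occupies position 0 and the characters are numbered from
    1, so positions and characters match without a shift.\<close>
  let ?pr = "\<lambda>i. if i = 0 then pD else Kop (\<theta> i)"
  have len: "length ?Us = Suc N" by simp
  have nth: "?Us ! i = (if i = 0 then Im_phi_D else Md (\<theta> i))" if "i < Suc N" for i
    using that by (cases i) (auto simp del: upt_Suc)
  have "Dcol P \<in> Im_phi_B" if "P \<in> I" for P
    unfolding Dcol_eq[OF that] using q that
    by (auto intro!: vec.subspace_add[OF Im_phi_B_subspace] vec.subspace_sum[OF Im_phi_B_subspace] Bcol_in
        bc_in_Im_phi_B char)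
  then have DB: "(Im_phi_D :: ('f, 'k) pvec set) \<subseteq> Im_phi_B"
    unfolding Im_phi_D_eq by (intro vec.span_minimal Im_phi_B_subspace) auto
  have pDB: "pD v \<in> Im_phi_D" if "v \<in> Im_phi_B" for v
    using that unfolding Im_phi_B_eq
  proof (induction rule: vec.span_induct_alt)
    case (step c x y)
    then obtain P where P: "x = Bcol P" "P \<in> I" by auto
    have "pD x = Dcol P" unfolding P(1) pD_Bcol[OF P(2)] Dcol_eq[OF P(2)] using q by simp
    then have "pD x \<in> Im_phi_D" using Dcol_in P(2) by simp
    then show ?case using step unfolding pD_add pD_scale
      by (intro vec.subspace_add[OF Im_phi_D_subspace] vec.subspace_scale[OF Im_phi_D_subspace]) auto
  qed (simp add: pD_0 vec.subspace_0[OF Im_phi_D_subspace])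
  show "bij_betw sum_list (listset ?Us) (Im_phi_B :: ('f, 'k) pvec set)"
  proof (rule bij_betw_sum_list_listset[where pr = ?pr, OF Im_phi_B_subspace], unfold len)
    show "?Us ! i \<subseteq> Im_phi_B" if "i < Suc N" for i
      unfolding nth[OF that] using DB Md_subset_Im_phi_B char nonreal that by auto
    show "?pr i (u + v) = ?pr i u + ?pr i v" for i u v by (simp add: pD_add Kop_add)
    show "(\<Sum>i<Suc N. ?pr i v) = v" for v
    proof -
      have "(\<Sum>i<Suc N. ?pr i v) = pD v + (\<Sum>i<N. Kop (\<theta> (Suc i)) v)"
        by (simp add: sum.lessThan_Suc_shift del: sum.lessThan_Suc)
      also have "(\<Sum>i<N. Kop (\<theta> (Suc i)) v) = (\<Sum>i = 1..N. Kop (\<theta> i) v)"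
        by (rule sum.reindex_bij_witness[of _ "\<lambda>i. i - 1" Suc]) auto
      finally show ?thesis by (simp add: pD_def add.assoc dblv)
    qed
    show "?pr i v \<in> ?Us ! i" if "i < Suc N" "v \<in> Im_phi_B" for i v
      unfolding nth[OF that(1)] using pDB[OF that(2)] Kop_in by auto
    show "?pr i u = (if i = j then u else 0)" if ij: "i < Suc N" "j < Suc N" "u \<in> ?Us ! j" for i j u
      using ij(3) unfolding nth[OF ij(2)] using ij(1,2) pD_Md[of j u] pD_Im_phi_D[of u] Kop_Im_phi_D[of i u] Kop_Md[of i j u]
      by (cases "i = 0"; cases "j = 0") auto
  qed
qed (use FH_Im_phi FH_Md in auto)

context
  assumes q: "CARD('k) mod 4 = 3"
begin

text \<open>By \<open>sum_bc\<close> the all-one vector is \<open>Bcol P + Dcol P\<close> plus the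
  sum of the \<open>bc (\<theta> j) P\<close>. The operator sends the first term and the last sum to
  the same vector \<open>bc (\<theta> i) P\<close>, and the second term to 0.\<close>

lemma Kop_one: "i \<in> {1..N} \<Longrightarrow> Kop (\<theta> i) (chi E) = 0"
proof -
  assume i: "i \<in> {1..N}"
  obtain P where P: "P \<in> I" using ex_bc_neq_0[OF char[OF i] nonreal[OF i]] by blast
  have "Kop (\<theta> i) (\<Sum>j = 1..N. bc (\<theta> j) P) = (\<Sum>j = 1..N. Kop (\<theta> i) (bc (\<theta> j) P))"
    unfolding Kop_def by (rule lin_ext_sum)
  also have "\<dots> = (\<Sum>j = 1..N. if i = j then bc (\<theta> j) P else 0)"
    using Kop_bc_family[OF i _ P] by (intro sum.cong) auto
  also have "\<dots> = bc (\<theta> i) P" using i by simp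
  finally have "Kop (\<theta> i) (Bcol P + Dcol P + chi E) = bc (\<theta> i) P" unfolding sum_bc[OF P] using q by simp
  then show ?thesis using Kop_Bcol[OF char[OF i] P] Kop_Dcol[OF char[OF i] P] by (simp add: Kop_add)
qed

text \<open>The sum of the coordinates along the tangent at (0, 0, 1), without that point. It is 1
  on the all-one vector, as q is odd, and 0 on the other summands, so it gives the projection onto
  the constants.\<close>

definition Tinf :: "('f, 'k) pvec \<Rightarrow> 'f" where
  "Tinf v = (\<Sum>b\<in>UNIV. v $ pinf b)"

lemma Tinf_add: "Tinf (u + v) = Tinf u + Tinf v" and Tinf_scale: "Tinf (c *s v) = c * Tinf v" and Tinf_0: "Tinf 0 = 0"
  by (simp_all add: Tinf_def sum.distrib sum_distrib_left)

lemma Tinf_sum: "Tinf (\<Sum>i\<in>A. f i) = (\<Sum>i\<in>A. Tinf (f i))"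
  by (induction A rule: infinite_finite_induct) (simp_all add: Tinf_add Tinf_0)

lemma Tinf_one: "Tinf (chi E) = 1"
  using odd by (simp add: Tinf_def char2_of_nat[OF char2])

lemma Tinf_Md_0: "i \<in> {1..N} \<Longrightarrow> v \<in> Md (\<theta> i) \<Longrightarrow> Tinf v = 0"
  unfolding Tinf_def by (rule Tinf_Md[OF char])

lemma Tinf_Im_phi_D:
  assumes v: "v \<in> Im_phi_D"
  shows "Tinf v = 0"
  using v unfolding Im_phi_D_eq
proof (induction rule: vec.span_induct_alt)
  case (step c x y)
  then obtain P where P: "x = Dcol P" "P \<in> I" by auto
  then have "Tinf x = 0" using sum_Dk_pinf[OF q P(2)] by (simp add: Tinf_def Dcol_def)
  then show ?case using step by (simp add: Tinf_add Tinf_scale)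
qed (simp add: Tinf_0)

lemma Tinf_Bcol:
  assumes P: "P \<in> I"
  shows "Tinf (Bcol P) = 1"
proof -
  have "bc (\<theta> i) P \<in> Md (\<theta> i)" if "i \<in> {1..N}" for i
    unfolding Md_eq_span_bc[OF char[OF that] nonreal[OF that]] using P by (simp add: vec.span_base)
  then have "Tinf (\<Sum>i = 1..N. bc (\<theta> i) P) = 0"
    unfolding Tinf_sum using Tinf_Md_0 by (intro sum.neutral) blast
  then have "Tinf (Bcol P) + 0 + 1 = 0"
    unfolding sum_bc[OF P] using q Tinf_Im_phi_D[OF Dcol_in[OF P]] by (simp add: Tinf_add Tinf_one)
  then show ?thesis using char2_eq_iff_add[OF char2] by simp
qed

lemma one_in_Im_phi_B: "chi E \<in> (Im_phi_B :: ('f, 'k) pvec set)"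
proof -
  have "chi E = (\<Sum>R\<in>I. Bcol R)"
    using sum_Bk_internal[OF q] by (simp add: vec_eq_iff sum_component Bcol_def)
  then show ?thesis using Bcol_in by (auto intro: vec.subspace_sum[OF Im_phi_B_subspace])
qed

lemma direct_sum_3:
  "FH_direct_sum (Im_phi_B :: ('f, 'k) pvec set)
     (vec.span {chi E} # Im_phi_D # map (\<lambda>i. Md (\<theta> i)) [1..<N + 1])"
  unfolding FH_direct_sum_def
proof (intro conjI)
  let ?Us = "vec.span {chi E} # Im_phi_D # map (\<lambda>i. Md (\<theta> i)) [1..<N + 1]"
  \<comment> \<open>\<open>pD\<close> sends \<open>Bcol P\<close> to \<open>Dcol P + chi E\<close>;
    since \<open>Tinf (Bcol P) = 1\<close>, the correction removes the all-one vector. Two summands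
    now precede the modules of the characters, hence the shift \<open>i - 1\<close> below.\<close>
  let ?p1 = "\<lambda>v. pD v + Tinf v *s chi E"
  let ?pr = "\<lambda>i. if i = 0 then (\<lambda>v. Tinf v *s chi E) else if i = 1 then ?p1 else Kop (\<theta> (i - 1))"
  have len: "length ?Us = Suc (Suc N)" by simp
  have nth: "?Us ! i = (if i = 0 then vec.span {chi E} else if i = 1 then Im_phi_D else Md (\<theta> (i - 1)))"
    if "i < Suc (Suc N)" for i
    using that by (cases i; cases "i - 1") (auto simp del: upt_Suc)
  have "Dcol P \<in> Im_phi_B" if "P \<in> I" for P
    unfolding Dcol_eq[OF that] using q that one_in_Im_phi_B
    by (auto intro!: vec.subspace_add[OF Im_phi_B_subspace] vec.subspace_sum[OF Im_phi_B_subspace] Bcol_in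
        bc_in_Im_phi_B char)
  then have DB: "(Im_phi_D :: ('f, 'k) pvec set) \<subseteq> Im_phi_B"
    unfolding Im_phi_D_eq by (intro vec.span_minimal Im_phi_B_subspace) auto
  have MB: "Md (\<theta> j) \<subseteq> Im_phi_B" if "j \<in> {1..N}" for j
    using Md_subset_Im_phi_B char nonreal that by blast
  have oB: "vec.span {chi E} \<subseteq> (Im_phi_B :: ('f, 'k) pvec set)"
    using one_in_Im_phi_B by (intro vec.span_minimal Im_phi_B_subspace) auto
  have p1B: "?p1 v \<in> Im_phi_D" if "v \<in> Im_phi_B" for v
    using that unfolding Im_phi_B_eq
  proof (induction rule: vec.span_induct_alt)
    case (step c x y)
    then obtain P where P: "x = Bcol P" "P \<in> I" by auto
    have "?p1 x = Dcol P" unfolding P(1) pD_Bcol[OF P(2)] Dcol_eq[OF P(2)] Tinf_Bcol[OF P(2)] using q by simp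
    then have "?p1 x \<in> Im_phi_D" using Dcol_in P(2) by simp
    moreover have "?p1 (c *s x + y) = c *s ?p1 x + ?p1 y"
      by (simp add: pD_add pD_scale Tinf_add Tinf_scale vec.scale_right_distrib vec.scale_left_distrib)
    ultimately show ?case using step(2)
      by (simp only: vec.subspace_add[OF Im_phi_D_subspace] vec.subspace_scale[OF Im_phi_D_subspace])
  qed (simp add: pD_0 Tinf_0 vec.subspace_0[OF Im_phi_D_subspace])
  show "bij_betw sum_list (listset ?Us) (Im_phi_B :: ('f, 'k) pvec set)"
  proof (rule bij_betw_sum_list_listset[where pr = ?pr, OF Im_phi_B_subspace], unfold len)
    show "?Us ! i \<subseteq> Im_phi_B" if "i < Suc (Suc N)" for i
    proof -
      have "i = 0 \<or> i = 1 \<or> i \<noteq> 0 \<and> i \<noteq> 1 \<and> i - 1 \<in> {1..N}" using that by auto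
      then show ?thesis unfolding nth[OF that] using DB oB MB[of "i - 1"] by presburger
    qed
    show "?pr i (u + v) = ?pr i u + ?pr i v" for i u v
      by (simp add: pD_add Kop_add Tinf_add vec.scale_left_distrib)
    show "(\<Sum>i<Suc (Suc N). ?pr i v) = v" for v
    proof -
      have "(\<Sum>i<Suc (Suc N). ?pr i v) = Tinf v *s chi E + (?p1 v + (\<Sum>i<N. Kop (\<theta> (Suc i)) v))"
        by (simp add: sum.lessThan_Suc_shift del: sum.lessThan_Suc)
      also have "(\<Sum>i<N. Kop (\<theta> (Suc i)) v) = (\<Sum>i = 1..N. Kop (\<theta> i) v)"
        by (rule sum.reindex_bij_witness[of _ "\<lambda>i. i - 1" Suc]) auto
      finally show ?thesis by (simp add: pD_def add_ac dblv dblv_left)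
    qed
    show "?pr i v \<in> ?Us ! i" if "i < Suc (Suc N)" "v \<in> Im_phi_B" for i v
      unfolding nth[OF that(1)] using p1B[OF that(2)] Kop_in by (auto intro: vec.span_scale vec.span_base)
    show "?pr i u = (if i = j then u else 0)" if ij: "i < Suc (Suc N)" "j < Suc (Suc N)" "u \<in> ?Us ! j" for i j u
    proof -
      have iN: "i - 1 \<in> {1..N}" if "i \<noteq> 0" "i \<noteq> 1" using that ij(1) by auto
      consider "j = 0" "u \<in> vec.span {chi E}" | "j = 1" "u \<in> Im_phi_D" | "j \<ge> 2" "j - 1 \<in> {1..N}" "u \<in> Md (\<theta> (j - 1))"
      proof -
        have "j = 0 \<or> j = 1 \<or> j \<noteq> 0 \<and> j \<noteq> 1 \<and> j \<ge> 2 \<and> j - 1 \<in> {1..N}" using ij(2) by auto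
        then show ?thesis using that ij(3) unfolding nth[OF ij(2)] by presburger
      qed
      then show ?thesis
      proof cases
        case 1
        then obtain c where u: "u = c *s chi E" by (auto simp: vec.span_singleton)
        have "Kop (\<theta> k) u = 0" if "k \<in> {1..N}" for k unfolding u Kop_scale Kop_one[OF that] by simp
        moreover from this have "pD u = u" by (simp add: pD_def)
        moreover have "Tinf u = c" unfolding u Tinf_scale Tinf_one by simp
        ultimately show ?thesis using 1(1) iN u by (cases "i = 0"; cases "i = 1") (simp_all add: dblv)
      next
        case 2
        then show ?thesis using iN pD_Im_phi_D[OF 2(2)] Tinf_Im_phi_D[OF 2(2)] Kop_Im_phi_D[OF _ 2(2), of "i - 1"]
          by (cases "i = 0"; cases "i = 1") simp_all
      next
        case 3
        then show ?thesis using iN pD_Md[OF 3(2,3)] Tinf_Md_0[OF 3(2,3)] Kop_Md[OF _ 3(2,3), of "i - 1"]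
          by (cases "i = 0"; cases "i = 1") auto
      qed
    qed
  qed
qed (use FH_Im_phi FH_Md FH_trivial_one in \<open>auto simp: FH_trivial_def\<close>)

end

end

end

subsection \<open>Primitive roots of unity\<close>

lemma power_eq_1_gcd:
  fixes x :: "'a::field"
  assumes "x ^ m = 1" "x ^ n = 1" "m \<noteq> 0"
  shows "x ^ gcd m n = 1"
proof -
  obtain a b where "m * a = n * b + gcd m n" using bezout_nat[OF assms(3)] by blast
  then have "x ^ (m * a) = x ^ (n * b) * x ^ gcd m n" by (simp add: power_add)
  then show ?thesis using assms by (simp add: power_mult)
qed

text \<open>If p^k is the exact power of p in \<open>n\<close>, then \<open>x p\<close> raised to n
  / p^k has order p^k, and the product of these elements has order \<open>n\<close>. With a closed
  set \<open>S\<close> the argument covers finite multiplicative groups as well as a whole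
  field.\<close>

lemma exists_primitive:
  fixes S :: "'a::field set"
  assumes n: "n > 0" and S: "1 \<in> S" "\<And>x y. x \<in> S \<Longrightarrow> y \<in> S \<Longrightarrow> x * y \<in> S"
    and ex: "\<And>p. prime p \<Longrightarrow> p dvd n \<Longrightarrow> \<exists>x\<in>S. x ^ n = 1 \<and> x ^ (n div p) \<noteq> 1"
  obtains g where "g \<in> S" "g ^ n = 1" "\<And>d. 0 < d \<Longrightarrow> d < n \<Longrightarrow> g ^ d \<noteq> 1"
proof -
  have Spow: "x ^ k \<in> S" if "x \<in> S" for x k
    by (induction k) (use S that in auto)
  obtain x where x: "\<And>p. prime p \<Longrightarrow> p dvd n \<Longrightarrow> x p \<in> S \<and> x p ^ n = 1 \<and> x p ^ (n div p) \<noteq> 1"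
    using ex by metis
  let ?e = "\<lambda>p. n div p ^ multiplicity p n"
  define g where "g = (\<Prod>p\<in>prime_factors n. x p ^ ?e p)"
  have pf: "prime p" "p dvd n" if "p \<in> prime_factors n" for p using that by auto
  have gS: "g \<in> S"
  proof -
    have "(\<Prod>p\<in>F. x p ^ ?e p) \<in> S" if "finite F" "F \<subseteq> prime_factors n" for F
      using that
    proof (induction F)
      case (insert p F)
      then have "x p ^ ?e p \<in> S" using x pf Spow by blast
      then show ?case using insert S(2) by simp
    qed (simp add: S(1))
    then show ?thesis unfolding g_def by simp
  qed
  have gn: "g ^ n = 1"
    unfolding g_def prod_power_distrib
  proof (rule prod.neutral, rule ballI)
    fix p assume "p \<in> prime_factors n"
    then have "x p ^ n = 1" using x pf by blast
    then show "(x p ^ ?e p) ^ n = 1" by (metis power_commutes power_mult mult.commute power_one)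
  qed
  have gp: "g ^ (n div p) \<noteq> 1" if p: "prime p" "p dvd n" for p
  proof
    assume g1: "g ^ (n div p) = 1"
    have pin: "p \<in> prime_factors n" using p n by (simp add: prime_factors_dvd)
    \<comment> \<open>If R is the exact power of another prime in \<open>n\<close>, then R p divides
      \<open>n\<close>, so (n / R) (n / p) is a multiple of \<open>n\<close>.\<close>
    have other: "(x r ^ ?e r) ^ (n div p) = 1" if r: "r \<in> prime_factors n - {p}" for r
    proof -
      define R where "R = r ^ multiplicity r n"
      have pr: "prime r" "r \<noteq> p" using r pf(1)[of r] by auto
      have "coprime R p" unfolding R_def using primes_coprime[OF pr(1) p(1) pr(2)] by simp
      moreover have "R dvd n" unfolding R_def by (rule multiplicity_dvd)
      ultimately have "R * p dvd n" using p(2) by (simp add: divides_mult)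
      then obtain c where "n = R * p * c" by (elim dvdE)
      then have c: "n = R * (p * c)" by (simp only: mult.assoc)
      have "p \<noteq> 0" using p(1) by auto
      have "R \<noteq> 0" using pr(1) unfolding R_def by auto
      have "n div R = p * c" unfolding c using \<open>R \<noteq> 0\<close> by simp
      then have d1: "?e r = p * c" by (simp only: R_def)
      have d2: "n div p = R * c" unfolding c using \<open>p \<noteq> 0\<close> by simp
      have "?e r * (n div p) = R * (p * c) * c" by (simp only: d1 d2 mult_ac)
      also have "\<dots> = n * c" by (simp only: c[symmetric])
      finally have "?e r * (n div p) = n * c" .
      then have "(x r ^ ?e r) ^ (n div p) = (x r ^ n) ^ c" by (simp flip: power_mult)
      then show ?thesis using x[OF pf[of r]] r by simp
    qed
    have "g ^ (n div p) = (x p ^ ?e p) ^ (n div p) * (\<Prod>r\<in>prime_factors n - {p}. (x r ^ ?e r) ^ (n div p))"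
      unfolding g_def prod_power_distrib using pin by (intro prod.remove) auto
    also have "\<dots> = (x p ^ (n div p)) ^ ?e p"
      using other by (simp add: mult.commute flip: power_mult)
    finally have 1: "(x p ^ (n div p)) ^ ?e p = 1" using g1 by simp
    have 2: "(x p ^ (n div p)) ^ p = 1" using x[OF p] p(2) by (simp flip: power_mult)
    \<comment> \<open>Both \<open>p\<close> and \<open>?e p\<close> annihilate
      \<open>x p ^ (n div p)\<close>; as they are coprime, this power is 1, against the choice of
      \<open>x p\<close>.\<close>
    have "\<not> p dvd ?e p" using n p(1) by (intro multiplicity_decompose) (auto simp: prime_gt_1_nat)
    then have "gcd p (?e p) = 1" using p(1) by (simp add: prime_imp_coprime_nat coprime_iff_gcd_eq_1[symmetric])
    then have "x p ^ (n div p) = 1"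
      using power_eq_1_gcd[OF 2 1] p(1) by (simp add: prime_gt_0_nat)
    then show False using x[OF p] by blast
  qed
  have "g ^ d \<noteq> 1" if d: "0 < d" "d < n" for d
  proof
    assume "g ^ d = 1"
    then have e: "g ^ gcd d n = 1" using power_eq_1_gcd[OF _ gn] d by simp
    have "n div gcd d n \<noteq> 1"
    proof
      assume "n div gcd d n = 1"
      then have "n = gcd d n" by (metis dvd_mult_div_cancel gcd_dvd2 mult.right_neutral)
      then have "n dvd d" by (metis gcd_dvd1)
      then show False using d by (auto dest: dvd_imp_le)
    qed
    then obtain p where p: "prime p" "p dvd n div gcd d n" using prime_factor_nat by blast
    then obtain c where c: "n div gcd d n = p * c" by (elim dvdE)
    then have nc: "n = p * (c * gcd d n)" by (metis dvd_div_mult_self gcd_dvd2 mult.assoc)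
    then have "n div p = c * gcd d n" using p(1) by (metis nonzero_mult_div_cancel_left not_prime_0)
    then have "g ^ (n div p) = 1" using e by (simp add: mult.commute[of c] power_mult)
    moreover have "p dvd n" using nc by (metis dvd_triv_left)
    ultimately show False using gp[OF p(1)] by blast
  qed
  then show ?thesis using that gS gn by blast
qed

lemma card_power_roots:
  fixes S :: "'a::field set"
  assumes "m > 0"
  shows "finite {x::'a. x ^ m = 1}" "card {x::'a. x ^ m = 1} \<le> m"
proof -
  let ?p = "monom 1 m - 1 :: 'a poly"
  have d: "degree ?p = m"
    using assms degree_add_eq_left[of "- 1" "monom (1::'a) m"] by (simp add: degree_monom_eq)
  then have p0: "?p \<noteq> 0" using assms by auto
  have eq: "{x::'a. x ^ m = 1} = {x. poly ?p x = 0}" by (simp add: poly_monom)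
  show "finite {x::'a. x ^ m = 1}" unfolding eq by (rule poly_roots_finite[OF p0])
  show "card {x::'a. x ^ m = 1} \<le> m" unfolding eq using card_poly_roots_bound[OF p0] d by simp
qed

lemma power_card_subgroup:
  fixes S :: "'a::field set"
  assumes S: "finite S" "0 \<notin> S" "\<And>x y. x \<in> S \<Longrightarrow> y \<in> S \<Longrightarrow> x * y \<in> S" and x: "x \<in> S"
  shows "x ^ card S = 1"
proof -
  have x0: "x \<noteq> 0" using S x by blast
  have "(*) x ` S = S"
    using S x x0 by (intro card_subset_eq) (auto simp: card_image inj_on_def)
  then have "prod id S = prod id ((*) x ` S)" by simp
  also have "\<dots> = (\<Prod>y\<in>S. x * y)" using x0 by (subst prod.reindex) (auto simp: inj_on_def)
  also have "\<dots> = x ^ card S * prod id S" by (simp add: prod.distrib)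
  finally have "x ^ card S * prod id S = 1 * prod id S" by simp
  moreover have "prod id S \<noteq> 0" using S by (simp add: prod_zero_iff)
  ultimately show ?thesis by (metis mult_right_cancel)
qed

text \<open>If \<open>x ^ (card S div p) = 1\<close> held on all of \<open>S\<close>, a polynomial
  would have more roots than its degree.\<close>

lemma finite_subgroup_generator:
  fixes S :: "'a::field set"
  assumes S: "finite S" "0 \<notin> S" "1 \<in> S" "\<And>x y. x \<in> S \<Longrightarrow> y \<in> S \<Longrightarrow> x * y \<in> S"
  obtains g where "g \<in> S" "g ^ card S = 1" "\<And>d. 0 < d \<Longrightarrow> d < card S \<Longrightarrow> g ^ d \<noteq> 1"
proof -
  have n: "card S > 0" using S by (auto simp: card_gt_0_iff)
  have ex: "\<exists>x\<in>S. x ^ card S = 1 \<and> x ^ (card S div p) \<noteq> 1" if p: "prime p" "p dvd card S" for p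
  proof -
  have "p > 1" by (rule prime_gt_1_nat[OF p(1)])
  then have lt: "card S div p < card S" "card S div p > 0" using n p(2) by (auto simp: div_greater_zero_iff dvd_imp_le)
  have "\<not> S \<subseteq> {x. x ^ (card S div p) = 1}"
  proof
    assume "S \<subseteq> {x. x ^ (card S div p) = 1}"
    then have "card S \<le> card {x::'a. x ^ (card S div p) = 1}"
      using card_power_roots(1)[OF lt(2)] by (intro card_mono)
    then show False using card_power_roots(2)[OF lt(2), where 'a = 'a] lt(1) by simp
  qed
  then show ?thesis
    using power_card_subgroup[OF S(1,2,4)] by blast
  qed
  show ?thesis by (rule exists_primitive[OF n S(3,4) ex]) (assumption | rule that)+
qed

text \<open>A root of 1 + X + ... + X^(p-1) is a p-th root of unity, and it differs from 1 because
  the value at 1 is \<open>of_nat p\<close>.\<close>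

lemma exists_root_of_unity:
  assumes p: "p > 1" "of_nat p \<noteq> (0::'f::alg_closed_field)"
  obtains z :: "'f::alg_closed_field" where "z ^ p = 1" "z \<noteq> 1"
proof -
  let ?q = "\<Sum>i<p. monom (1::'f) i"
  have q: "poly ?q x = (\<Sum>i<p. x ^ i)" for x by (simp add: poly_sum poly_monom)
  have "coeff ?q (p - 1) = 1"
  proof -
    have "coeff ?q (p - 1) = (\<Sum>i<p. if i = p - 1 then 1 else 0)" by (simp add: coeff_sum)
    then show ?thesis using p(1) by simp
  qed
  then have "degree ?q \<ge> p - 1" by (intro le_degree) simp
  then have "degree ?q > 0" using p(1) by simp
  then obtain z where z: "poly ?q z = 0" using alg_closed_imp_poly_has_root by blast
  have "z ^ p - 1 = (z - 1) * (\<Sum>i<p. z ^ i)" by (rule power_diff_1_eq)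
  then have "z ^ p = 1" using z unfolding q by simp
  moreover have "z \<noteq> 1" using z p(2) unfolding q by auto
  ultimately show ?thesis using that by blast
qed

lemma exists_primitive_root_of_unity:
  assumes char2: "(1::'f::alg_closed_field) + 1 = 0" and n: "odd n"
  obtains w :: "'f::alg_closed_field" where "w ^ n = 1" "\<And>d. 0 < d \<Longrightarrow> d < n \<Longrightarrow> w ^ d \<noteq> 1"
proof -
  have n0: "n > 0" using n by (cases n) auto
  have ex: "\<exists>x\<in>UNIV. x ^ n = (1::'f) \<and> x ^ (n div p) \<noteq> 1" if p: "prime p" "p dvd n" for p
  proof -
  have "odd p" using p(2) n by auto
  then have "of_nat p \<noteq> (0::'f)" by (simp add: char2_of_nat[OF char2])
  then obtain z :: 'f where z: "z ^ p = 1" "z \<noteq> 1"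
    using exists_root_of_unity prime_gt_1_nat[OF p(1)] by blast
  have "n div p > 0" using p n0 by (auto simp: div_greater_zero_iff dvd_imp_le prime_gt_0_nat)
  \<comment> \<open>An (n / p)-th root of a nontrivial p-th root of unity has n-th power 1 while its
    (n / p)-th power is \<open>z\<close>.\<close>
  then obtain x where x: "x ^ (n div p) = z" using nth_root_exists by blast
  then have "x ^ n = 1" using z(1) p(2) by (metis dvd_div_mult_self power_mult)
  then show ?thesis using x z(2) by blast
  qed
  show ?thesis by (rule exists_primitive[OF n0 UNIV_I UNIV_I ex]) (assumption | rule that)+
qed

subsection \<open>A nontrivial additive character\<close>

text \<open>A maximal additive subgroup \<open>A\<close> without 1 is a complement of the prime
  field: each \<open>x\<close> is congruent modulo \<open>A\<close> to an integer j that is unique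
  modulo the characteristic. Then \<open>psi x = z ^ j\<close> for a nontrivial root of unity
  \<open>z\<close> whose order divides the characteristic.\<close>

lemma exists_additive_character:
  assumes odd: "odd CARD('k::{field,finite})" and char2: "(1::'f::alg_closed_field) + 1 = 0"
  obtains psi :: "'k::{field,finite} \<Rightarrow> 'f::alg_closed_field" where "\<And>x y. psi (x + y) = psi x * psi y" "psi 0 = 1" "\<exists>x. psi x \<noteq> 1"
proof -
  let ?p = "CHAR('k)"
  have two: "(2::'k) \<noteq> 0" by (rule odd_card_two_neq_0[OF odd])
  have p0: "?p > 0" by (rule finite_imp_CHAR_pos) simp
  have "?p \<noteq> 1"
  proof
    assume "?p = 1"
    then have "of_nat 1 = (0::'k)" by (metis of_nat_CHAR)
    then show False by simp
  qed
  then have p1: "?p > 1" using p0 by linarith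
  have "odd ?p"
  proof
    assume "even ?p"
    then obtain m where m: "?p = 2 * m" by (elim evenE)
    then have "2 * of_nat m = (0::'k)" by (metis of_nat_CHAR of_nat_mult of_nat_numeral)
    then have "of_nat m = (0::'k)" using two by simp
    then have "?p dvd m" by (simp add: of_nat_eq_0_iff_char_dvd)
    then show False using m p0 by (auto dest: dvd_imp_le)
  qed
  then have "of_nat ?p \<noteq> (0::'f)" by (simp add: char2_of_nat[OF char2])
  then obtain z :: 'f where z: "z ^ ?p = 1" "z \<noteq> 1" using exists_root_of_unity[OF p1] by blast
  let ?sub = "\<lambda>A::'k set. 0 \<in> A \<and> (\<forall>x\<in>A. \<forall>y\<in>A. x + y \<in> A) \<and> 1 \<notin> A"
  obtain A where A: "?sub A" and maxA: "\<And>B. ?sub B \<Longrightarrow> A \<subseteq> B \<Longrightarrow> A = B"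
  proof -
    have "?sub {0}" by simp
    then have "{A. ?sub A} \<noteq> {}" by blast
    then obtain A where "A \<in> {A. ?sub A}" "\<forall>B\<in>{A. ?sub A}. A \<subseteq> B \<longrightarrow> A = B"
      using finite_has_maximal[of "{A. ?sub A}"] by (elim bexE[rotated]) simp
    then show ?thesis by (intro that[of A]) simp_all
  qed
  have Amult: "of_nat j * x \<in> A" if "x \<in> A" for j x
    by (induction j) (use A that in \<open>auto simp: distrib_right\<close>)
  have inv: "\<exists>j'. of_nat j' * of_nat j = (1::'k)" if j: "of_nat j \<noteq> (0::'k)" for j
  proof -
    let ?S = "UNIV - {0::'k}"
    have "of_nat j ^ card ?S = (1::'k)" by (rule power_card_subgroup) (use j in auto)
    moreover have "(1::'k) \<in> ?S" by simp
    then have "card ?S > 0" unfolding card_gt_0_iff by (intro conjI finite) (erule ex_in_conv[THEN iffD1, OF exI])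
    then have "card ?S = Suc (card ?S - 1)" by (rule Suc_pred')
    ultimately have "of_nat (j ^ (card ?S - 1)) * of_nat j = (1::'k)" by (metis of_nat_power power_Suc2)
    then show ?thesis by blast
  qed
  have uniq: "?p dvd j" if "of_nat j \<in> A" for j
  proof (rule ccontr)
    assume "\<not> ?p dvd j"
    then obtain j' where "of_nat j' * of_nat j = (1::'k)" using inv of_nat_eq_0_iff_char_dvd by blast
    then show False using Amult[OF that] A by metis
  qed
  have negA: "- x \<in> A" if "x \<in> A" for x
  proof -
    have "of_nat (?p - 1) * x = - x" using p0 by (simp add: of_nat_diff left_diff_distrib)
    then show ?thesis using Amult[OF that] by metis
  qed
  have cover: "\<exists>j. x - of_nat j \<in> A" for x
  proof (rule ccontr)
    assume no: "\<nexists>j. x - of_nat j \<in> A"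
    \<comment> \<open>Adjoining \<open>x\<close> keeps the subgroup free of 1: from 1 = a + j x,
      dividing by j would make \<open>x\<close> congruent to an integer modulo \<open>A\<close>.
      Maximality then puts \<open>x\<close> into \<open>A\<close>, where 0 serves as the
      integer.\<close>
    let ?B = "{a + of_nat j * x | a j. a \<in> A}"
    have AB: "a \<in> ?B" if "a \<in> A" for a
    proof -
      have "a = a + of_nat 0 * x" by simp
      then show ?thesis using that by blast
    qed
    then have "0 \<in> ?B" using A by blast
    moreover have "u + v \<in> ?B" if "u \<in> ?B" "v \<in> ?B" for u v
    proof -
      from that obtain a j b l where uv: "u = a + of_nat j * x" "a \<in> A" "v = b + of_nat l * x" "b \<in> A" by blast
      then have "u + v = (a + b) + of_nat (j + l) * x" by (simp add: algebra_simps)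
      then show ?thesis using A uv by blast
    qed
    moreover have "1 \<notin> ?B"
    proof
      assume "1 \<in> ?B"
      then obtain a j where aj: "1 = a + of_nat j * x" "a \<in> A" by blast
      then have "of_nat j \<noteq> (0::'k)" using A by auto
      then obtain j' where j': "of_nat j' * of_nat j = (1::'k)" using inv by blast
      have "x = of_nat j' * (of_nat j * x)" using j' by (simp flip: mult.assoc)
      also have "of_nat j * x = 1 - a" using aj(1) by (simp add: algebra_simps)
      finally have "x - of_nat j' = - (of_nat j' * a)" by (simp add: algebra_simps)
      then show False using no Amult[OF aj(2)] negA by metis
    qed
    moreover have "A \<subseteq> ?B" using AB by blast
    ultimately have AeqB: "A = ?B" by (intro maxA conjI ballI)
    have "x = 0 + of_nat 1 * x" by simp
    then have "x \<in> ?B" using A by blast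
    then have "x - of_nat 0 \<in> A" unfolding AeqB[symmetric] by simp
    then show False using no by blast
  qed
  have zpow: "z ^ i = z ^ j" if "of_nat i - of_nat j \<in> A" for i j
  proof -
    have *: "z ^ i = z ^ j" if h: "of_nat i - of_nat j \<in> A" "j \<le> i" for i j
    proof -
      have "?p dvd i - j" using h by (intro uniq) (simp add: of_nat_diff)
      then obtain c where "i = j + ?p * c" using h(2) by (metis dvdE le_add_diff_inverse)
      then show ?thesis using z(1) by (simp add: power_add power_mult)
    qed
    show ?thesis
    proof (cases "j \<le> i")
      case False
      have "of_nat j - of_nat i \<in> A" using negA[OF that] by simp
      then show ?thesis using *[of j i] False by simp
    qed (use * that in blast)
  qed
  define J where "J x = (SOME j. x - of_nat j \<in> A)" for x
  have J: "x - of_nat (J x) \<in> A" for x unfolding J_def using cover by (rule someI_ex)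
  have psi: "z ^ J x = z ^ j" if "x - of_nat j \<in> A" for x j
  proof (rule zpow)
    have "of_nat (J x) - of_nat j = (x - of_nat j) + - (x - of_nat (J x))" by simp
    then show "of_nat (J x) - of_nat j \<in> A" using A that negA[OF J[of x]] by metis
  qed
  show ?thesis
  proof (rule that[of "\<lambda>x. z ^ J x"])
    fix x y
    have "x + y - of_nat (J x + J y) = (x - of_nat (J x)) + (y - of_nat (J y))" by simp
    then have "x + y - of_nat (J x + J y) \<in> A" using A J by metis
    then show "z ^ J (x + y) = z ^ J x * z ^ J y" using psi by (metis power_add)
  next
    show "z ^ J 0 = 1" using psi[of 0 0] A by simp
    have "z ^ J 1 = z ^ 1" by (rule psi) (use A in simp)
    then show "\<exists>x. z ^ J x \<noteq> 1" using z(2) by (intro exI[of _ 1]) simp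
  qed
qed

context conic_char2
begin

subsection \<open>The characters of the norm-one group\<close>

text \<open>Stereographic projection from (-1, 0): the slope \<open>s\<close> gives a point unless
  \<open>1 + nu * s^2 = 0\<close>. There are two such slopes if -1 is not a square and none if it
  is.\<close>

lemma card_Lam:
  "card Lam = (if is_sq (- 1 :: 'k) then CARD('k) + 1 else CARD('k) - 1)"
proof -
  let ?T = "{s::'k. 1 + nu * s^2 \<noteq> 0}"
  let ?f = "\<lambda>s. ((1 - nu * s^2) / (1 + nu * s^2), 2 * s / (1 + nu * s^2))"
  have "bij_betw ?f ?T (Lam - {(- 1, 0)})"
  proof (rule bij_betwI[where g = "\<lambda>u. snd u / (1 + fst u)"])
    show "?f \<in> ?T \<rightarrow> Lam - {(- 1, 0)}"
    proof
      fix s assume s: "s \<in> ?T"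
      have "(1 - nu * s^2)^2 + nu * (2 * s)^2 = (1 + nu * s^2)^2"
        by (simp add: power2_eq_square algebra_simps)
      then have "((1 - nu * s^2) / (1 + nu * s^2))^2 + nu * (2 * s / (1 + nu * s^2))^2 = 1"
        using s by (simp add: power_divide flip: add_divide_distrib)
      then have "?f s \<in> Lam" by (simp add: Lam_iff)
      moreover have "?f s \<noteq> (- 1, 0)"
      proof
        assume "?f s = (- 1, 0)"
        then have "s = 0" "(1 - nu * s^2) / (1 + nu * s^2) = - 1" using s by auto
        then have "(1::'k) = - 1" by simp
        then show False using neg_eq_self_iff[of 1] by simp
      qed
      ultimately show "?f s \<in> Lam - {(- 1, 0)}" by simp
    qed
    have a1: "1 + fst u \<noteq> 0" if u: "u \<in> Lam - {(- 1, 0)}" for u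
    proof
      assume "1 + fst u = 0"
      then have f: "fst u = - 1" by (simp add: add_eq_0_iff)
      then have "nu * (snd u)^2 = 0" using u by (simp add: Lam_iff)
      then have "u = (- 1, 0)" using f by (cases u) simp
      then show False using u by simp
    qed
    have key: "1 + nu * (snd u / (1 + fst u))^2 = 2 / (1 + fst u)" if u: "u \<in> Lam - {(- 1, 0)}" for u
    proof -
      have n: "(fst u)^2 + nu * (snd u)^2 = 1" using u by (simp add: Lam_iff)
      have "(1 + fst u)^2 + nu * (snd u)^2 = 1 + 2 * fst u + ((fst u)^2 + nu * (snd u)^2)"
        by (simp add: power2_eq_square algebra_simps)
      also have "\<dots> = 2 * (1 + fst u)" unfolding n by simp
      finally have k: "(1 + fst u)^2 + nu * (snd u)^2 = 2 * (1 + fst u)" .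
      have red: "2 * x / x^2 = 2 / x" if "x \<noteq> 0" for x :: 'k using that by (simp add: power2_eq_square)
      have "1 + nu * (snd u / (1 + fst u))^2 = ((1 + fst u)^2 + nu * (snd u)^2) / (1 + fst u)^2"
        using a1[OF u] by (simp add: power_divide add_divide_distrib)
      also have "((1 + fst u)^2 + nu * (snd u)^2) / (1 + fst u)^2 = 2 / (1 + fst u)"
        unfolding k using red[OF a1[OF u]] .
      finally show ?thesis .
    qed
    show "(\<lambda>u. snd u / (1 + fst u)) \<in> Lam - {(- 1, 0)} \<rightarrow> ?T"
      using key a1 by simp
    show "?f (snd u / (1 + fst u)) = u" if u: "u \<in> Lam - {(- 1, 0)}" for u
    proof -
      let ?s = "snd u / (1 + fst u)"
      have "1 - nu * ?s^2 = 2 - (1 + nu * ?s^2)" by simp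
      also have "\<dots> = 2 * fst u / (1 + fst u)" unfolding key[OF u] using a1[OF u] by (simp add: field_simps)
      finally have 1: "1 - nu * ?s^2 = 2 * fst u / (1 + fst u)" .
      show ?thesis unfolding 1 key[OF u] using a1[OF u] by (cases u) simp
    qed
    show "snd (?f s) / (1 + fst (?f s)) = s" if s: "s \<in> ?T" for s
    proof -
      have s0: "1 + nu * s^2 \<noteq> 0" using s by simp
      have "1 + (1 - nu * s^2) / (1 + nu * s^2) = ((1 + nu * s^2) + (1 - nu * s^2)) / (1 + nu * s^2)"
        unfolding add_divide_distrib[of "1 + nu * s^2"] using s0 by simp
      also have "(1 + nu * s^2) + (1 - nu * s^2) = 2" by simp
      finally show ?thesis using s0 by simp
    qed
  qed
  then have "card ?T = card (Lam - {(- 1, 0)})" by (rule bij_betw_same_card)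
  then have c: "card Lam = card ?T + 1" using card_Suc_Diff1[of Lam "(- 1, 0)"] by simp
  show ?thesis
  proof (cases "is_sq (- 1 :: 'k)")
    case True
    have "1 + nu * s^2 \<noteq> 0" for s
    proof
      assume h: "1 + nu * s^2 = 0"
      then have s: "s \<noteq> 0" by auto
      have "s^2 * nu = - 1" using h by (simp add: add_eq_0_iff mult.commute)
      then have "is_sq (s^2 * nu)" using True by simp
      then show False using s nonsq by simp
    qed
    then have "?T = UNIV" by blast
    then show ?thesis using c True by simp
  next
    case False
    have "is_sq (- 1 / nu)" using nonsq_mult_nonsq[OF odd False nonsq] by (simp only: is_sq_divide)
    then obtain r where r: "- 1 / nu = r^2" by (auto simp: is_sq_def)
    then have r0: "r \<noteq> 0" by auto
    have "1 + nu * s^2 = 0 \<longleftrightarrow> s^2 = r^2" for s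
    proof -
      have "1 + nu * s^2 = 0 \<longleftrightarrow> nu * s^2 = - 1" by (auto simp: add_eq_0_iff)
      also have "\<dots> \<longleftrightarrow> s^2 = - 1 / nu" unfolding eq_divide_eq by (simp add: mult.commute)
      finally show ?thesis unfolding r .
    qed
    then have "?T = UNIV - {r, - r}" by (auto simp: power2_eq_iff)
    moreover have "r \<noteq> - r" using r0 neg_eq_self_iff by metis
    ultimately have "card ?T = CARD('k) - 2" by (simp add: card_Diff_subset)
    moreover have "CARD('k) \<ge> 2" using card_mono[of UNIV "{0::'k, 1}"] by simp
    ultimately show ?thesis using c False by simp
  qed
qed

definition lpow :: "'k \<times> 'k \<Rightarrow> nat \<Rightarrow> 'k \<times> 'k" where
  "lpow g i = (lmul g ^^ i) (1, 0)"

lemma lpow_0 [simp]: "lpow g 0 = (1, 0)" and lpow_Suc: "lpow g (Suc i) = lmul g (lpow g i)"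
  by (simp_all add: lpow_def)

lemma lpow_add: "lpow g (i + j) = lmul (lpow g i) (lpow g j)"
  by (induction i) (simp_all add: lpow_Suc lmul_assoc)

lemma lpow_in: "g \<in> Lam \<Longrightarrow> lpow g i \<in> Lam"
  by (induction i) (simp_all add: lpow_Suc)

definition "lam_generator g \<longleftrightarrow> g \<in> Lam \<and> Lam = lpow g ` {..<card Lam} \<and> lpow g (card Lam) = (1, 0)"

text \<open>The norm-one group embeds into the multiplicative group of any field that contains a square
  root of \<open>-nu\<close>; hence it is cyclic.\<close>

lemma exists_lam_generator:
  fixes e :: "'k \<Rightarrow> 'l::field" and t :: 'l
  assumes e: "e 1 = 1" "\<And>x y. e (x + y) = e x + e y" "\<And>x y. e (x * y) = e x * e y" "inj e"
    and t: "t^2 = e (- nu)"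
  shows "\<exists>g. lam_generator g"
proof -
  define em where "em u = e (fst u) + t * e (snd u)" for u
  have "e 0 + e 0 = e 0 + 0" unfolding e(2)[symmetric] by simp
  then have e0: "e 0 = 0" unfolding add_left_cancel .
  have em: "e (- x) = - e x" for x using e(2)[of x "- x"] e0 by (simp add: add_eq_0_iff)
  have em_mult: "em (lmul u v) = em u * em v" for u v
  proof -
    have "em u * em v = e (fst u) * e (fst v) + t^2 * (e (snd u) * e (snd v)) + t * (e (fst u) * e (snd v) + e (fst v) * e (snd u))"
      by (simp add: em_def power2_eq_square algebra_simps)
    also have "\<dots> = em (lmul u v)"
      unfolding t em_def by (cases u; cases v) (simp add: e(2,3) em algebra_simps diff_conv_add_uminus del: add_uminus_conv_diff)
    finally show ?thesis ..
  qed
  have em1: "em (1, 0) = 1" by (simp add: em_def e e0)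
  have t0: "t \<noteq> 0"
  proof
    assume "t = 0"
    then have "e (- nu) = e 0" using t e0 by simp
    then show False using e(4) by (simp add: inj_eq)
  qed
  have e2: "e 2 \<noteq> 0"
  proof
    assume "e 2 = 0"
    then have "e 2 = e 0" using e0 by simp
    then show False using e(4) by (simp add: inj_eq)
  qed
  have two2: "(2::'l) \<noteq> 0" using e2 e(1) e(2)[of 1 1] by simp
  \<comment> \<open>On norm-one elements \<open>em (lcnj u)\<close> is the inverse of
    \<open>em u\<close>, so \<open>em u\<close> determines both their sum and their difference,
    hence the coordinates of \<open>u\<close>.\<close>
  have inj: "inj_on em Lam"
  proof (rule inj_onI)
    fix u v assume uv: "u \<in> Lam" "v \<in> Lam" "em u = em v"
    have "em u * em (lcnj u) = 1" "em v * em (lcnj v) = 1"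
      using lmul_cnj(1) uv em_mult em1 by metis+
    then have c: "em (lcnj u) = em (lcnj v)" using uv(3) by (metis mult_left_cancel mult_zero_left zero_neq_one)
    have s: "em u + em (lcnj u) = 2 * e (fst u)" "em u - em (lcnj u) = 2 * (t * e (snd u))" for u
      by (simp_all add: em_def lcnj_Pair em)
    have "2 * e (fst u) = 2 * e (fst v)" "2 * (t * e (snd u)) = 2 * (t * e (snd v))"
      using s[of u] s[of v] uv(3) c by metis+
    then have "e (fst u) = e (fst v)" "e (snd u) = e (snd v)" using two2 t0 by simp_all
    then show "u = v" using e(4) by (simp add: inj_eq prod_eq_iff)
  qed
  let ?S = "em ` Lam"
  have card: "card ?S = card Lam" by (rule card_image[OF inj])
  have "0 \<notin> ?S"
  proof
    assume "0 \<in> ?S"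
    then obtain u where "u \<in> Lam" "em u = 0" by auto
    then have "em (1, 0) = 0" using lmul_cnj(1) em_mult by (metis mult_zero_left)
    then show False using em1 by simp
  qed
  moreover have "1 \<in> ?S" using em1 Lam_1(1) by (metis imageI)
  moreover have "x * y \<in> ?S" if xy: "x \<in> ?S" "y \<in> ?S" for x y
  proof -
    obtain u v where "u \<in> Lam" "v \<in> Lam" "x = em u" "y = em v" using xy by blast
    then show ?thesis using em_mult Lam_mult by (metis imageI)
  qed
  ultimately obtain z where z: "z \<in> ?S" "z ^ card Lam = 1" "\<And>d. 0 < d \<Longrightarrow> d < card Lam \<Longrightarrow> z ^ d \<noteq> 1"
    using finite_subgroup_generator[of ?S] unfolding card by (metis finite finite_imageI)
  obtain g where g: "g \<in> Lam" "z = em g" using z(1) by blast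
  have ep: "em (lpow g i) = z ^ i" for i
    by (induction i) (simp_all add: em1 lpow_Suc em_mult g(2))
  have z0: "z \<noteq> 0" using z(1) \<open>0 \<notin> ?S\<close> by blast
  have inj2: "inj_on (lpow g) {..<card Lam}"
  proof (rule linorder_inj_onI')
    fix i j assume ij: "i \<in> {..<card Lam}" "j \<in> {..<card Lam}" "i < j"
    show "lpow g i \<noteq> lpow g j"
    proof
      assume "lpow g i = lpow g j"
      then have "z ^ i = z ^ j" using ep by metis
      moreover have "z ^ j = z ^ i * z ^ (j - i)" using ij by (simp flip: power_add)
      ultimately have "z ^ (j - i) = 1" using z0 by simp
      moreover have "0 < j - i" "j - i < card Lam" using ij by auto
      ultimately show False using z(3) by blast
    qed
  qed
  have "lpow g ` {..<card Lam} = Lam"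
    by (rule card_subset_eq) (use lpow_in[OF g(1)] card_image[OF inj2] in auto)
  moreover have "lpow g (card Lam) = (1, 0)"
    using inj lpow_in[OF g(1)] ep[of "card Lam"] z(2) em1 Lam_1(1) unfolding inj_on_def by metis
  ultimately show ?thesis using g(1) unfolding lam_generator_def by metis
qed

lemma lpow_mod:
  assumes "lam_generator g"
  shows "lpow g (i mod card Lam) = lpow g i"
proof -
  have "lpow g (card Lam * c) = (1, 0)" for c
    using assms by (induction c) (simp_all add: lpow_add lam_generator_def)
  then show ?thesis by (metis add.commute div_mult_mod_eq lmul_1(2) lpow_add mult.commute)
qed

lemma lpow_eq_iff:
  assumes g: "lam_generator g"
  shows "lpow g i = lpow g j \<longleftrightarrow> i mod card Lam = j mod card Lam"
proof
  have c: "card Lam > 0" using Lam_1(1) by (metis card_gt_0_iff empty_iff finite)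
  have "card (lpow g ` {..<card Lam}) = card {..<card Lam}" using g by (simp add: lam_generator_def)
  then have inj: "inj_on (lpow g) {..<card Lam}" by (intro eq_card_imp_inj_on) simp_all
  assume "lpow g i = lpow g j"
  then have "lpow g (i mod card Lam) = lpow g (j mod card Lam)" using lpow_mod[OF g] by simp
  then show "i mod card Lam = j mod card Lam" using inj c by (auto simp: inj_on_def)
next
  assume "i mod card Lam = j mod card Lam"
  then show "lpow g i = lpow g j" using lpow_mod[OF g] by metis
qed

text \<open>The character \<open>\<theta> i\<close> sends the j-th power of \<open>g\<close> to
  \<open>w ^ (i * j)\<close>. Its inverse has index n - i, so the indices up to (n - 1) / 2
  represent each inverse pair once. All traces together are z + ... + z^(n-1), which is 1 in
  characteristic two for an n-th root of unity \<open>z \<noteq> 1\<close>.\<close>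

lemma char_family:
  assumes g: "lam_generator g" and n: "card Lam = 2 * n" "odd n"
    and w: "w ^ n = (1::'f)" "\<And>d. 0 < d \<Longrightarrow> d < n \<Longrightarrow> w ^ d \<noteq> 1"
  obtains L \<theta> where "odd_part L"
    "\<And>i. i \<in> {1..(n - 1) div 2} \<Longrightarrow> is_char (\<theta> i)"
    "\<And>i. i \<in> {1..(n - 1) div 2} \<Longrightarrow> \<exists>u\<in>Lam. \<theta> i u \<noteq> \<theta> i (lcnj u)"
    "\<And>i j. i \<in> {1..(n - 1) div 2} \<Longrightarrow> j \<in> {1..(n - 1) div 2} \<Longrightarrow> i \<noteq> j \<Longrightarrow>
        (\<exists>u\<in>Lam. \<theta> i u * \<theta> j u \<noteq> 1) \<and> (\<exists>u\<in>Lam. \<theta> i u * \<theta> j (lcnj u) \<noteq> 1)"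
    "\<And>u. u \<in> Lam \<Longrightarrow> snd u \<noteq> 0 \<Longrightarrow> (\<Sum>i = 1..(n - 1) div 2. tr (\<theta> i) u) = (1 :: 'f)"
proof -
  let ?N = "(n - 1) div 2"
  have n0: "n > 0" using n(2) by (cases n) auto
  have w0: "w \<noteq> 0" using w(1) n0 by (metis power_0_left zero_neq_one less_numeral_extra(3))
  have gL: "g \<in> Lam" using g by (simp add: lam_generator_def)
  note eq = lpow_eq_iff[OF g, unfolded n(1)]
  have all: "\<exists>j. u = lpow g j" if "u \<in> Lam" for u using g that unfolding lam_generator_def by blast
  have wmod: "w ^ (i * j) = w ^ (i * k)" if "j mod (2 * n) = k mod (2 * n)" for i j k
  proof -
    have *: "w ^ (i * j) = w ^ (i * (j mod (2 * n)))" for j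
    proof -
      have "i * j = i * (j mod (2 * n)) + n * (2 * (j div (2 * n)) * i)"
        by (metis (no_types, lifting) add.commute distrib_left mult.assoc mult.commute mult_div_mod_eq)
      then have "w ^ (i * j) = w ^ (i * (j mod (2 * n))) * (w ^ n) ^ (2 * (j div (2 * n)) * i)"
        by (simp only: power_add power_mult)
      then show ?thesis using w(1) by simp
    qed
    show ?thesis using *[of j] *[of k] that by simp
  qed
  define \<theta> where "\<theta> i u = w ^ (i * (SOME j. u = lpow g j))" for i :: nat and u
  have th: "\<theta> i (lpow g j) = w ^ (i * j)" for i j
  proof -
    have "lpow g j = lpow g (SOME k. lpow g j = lpow g k)" by (rule someI[of _ j]) simp
    then show ?thesis unfolding \<theta>_def using wmod eq by metis
  qed
  \<comment> \<open>The square of -1 is 1, so its exponent is a multiple of \<open>n\<close>; an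
    even multiple would make -1 equal to 1.\<close>
  have m1: "(- 1, 0) = lpow g n"
  proof -
    obtain j where j: "(- 1, 0) = lpow g j" using all[OF Lam_1(2)] by blast
    have "lpow g (2 * j) = lmul (- 1, 0) (- 1, 0)" unfolding mult_2 lpow_add j ..
    then have "lpow g (2 * j) = lpow g 0" by simp
    then have "(2 * j) mod (2 * n) = 0 mod (2 * n)" unfolding eq .
    then have "2 * n dvd 2 * j" by (simp only: mod_0 mod_eq_0_iff_dvd)
    then obtain k where k: "j = n * k" by (auto elim: dvdE)
    have "odd k"
    proof
      assume "even k"
      then obtain l where "j = 2 * n * l" using k by (auto elim!: evenE)
      then have "lpow g j = lpow g 0" unfolding eq by simp
      then have "(1::'k) = - 1" using j by simp
      then show False using neg_eq_self_iff[of 1] by simp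
    qed
    then obtain l where "k = 2 * l + 1" by (elim oddE)
    then have "j = n + 2 * n * l" using k by (simp add: algebra_simps)
    then have "lpow g j = lpow g n" unfolding eq by simp
    then show ?thesis using j by simp
  qed
  have char: "is_char (\<theta> i)" for i
    unfolding is_char_def
  proof (intro conjI ballI)
    fix u v assume "u \<in> Lam" "v \<in> Lam"
    then obtain j k where "u = lpow g j" "v = lpow g k" using all by metis
    then show "\<theta> i (lmul u v) = \<theta> i u * \<theta> i v"
      by (simp add: th distrib_left power_add flip: lpow_add)
  next
    show "\<theta> i (1, 0) = 1" using th[of i 0] by simp
    show "\<theta> i (- 1, 0) = 1" unfolding m1 th using w(1) by (simp add: mult.commute[of i] power_mult)
  qed
  have cnj: "\<theta> i (lcnj u) = inverse (\<theta> i u)" if "u \<in> Lam" for i u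
    using char_cnj[OF char that] by (metis inverse_unique)
  have thg: "\<theta> i g = w ^ i" for i using th[of i 1] by (simp add: lpow_Suc)
  have pos: "w ^ d \<noteq> 1" if "0 < d" "d < n" for d using w(2) that by blast
  have half: "i + j < n" if "i \<in> {1..?N}" "j \<in> {1..?N}" for i j
    using that n0 by auto
  \<comment> \<open>The even powers form the subgroup of order \<open>n\<close>; since
    \<open>n\<close> is odd, -1 is not among them.\<close>
  define L where "L = (\<lambda>i. lpow g (2 * i)) ` {..<n}"
  have Liff: "lpow g j \<in> L \<longleftrightarrow> even j" for j
  proof
    assume "lpow g j \<in> L"
    then obtain i where "lpow g j = lpow g (2 * i)" by (auto simp: L_def)
    then have "j mod (2 * n) = (2 * i) mod (2 * n)" using eq by simp
    then show "even j" by (metis dvd_mod_iff dvd_triv_left)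
  next
    assume "even j"
    then obtain i where i: "j = 2 * i" by (elim evenE)
    have "lpow g j = lpow g (2 * (i mod n))" unfolding eq i by (simp only: mult_mod_right mod_mod_trivial)
    then show "lpow g j \<in> L" using n0 by (auto simp: L_def)
  qed
  have inv: "lcnj (lpow g j) = lpow g ((2 * n - 1) * j)" for j
  proof -
    have "j + (2 * n - 1) * j = 2 * n * j" using n0 by (cases n) (simp_all add: algebra_simps)
    then have "lmul (lpow g j) (lpow g ((2 * n - 1) * j)) = lpow g (2 * n * j)"
      unfolding lpow_add[symmetric] by simp
    also have "\<dots> = lpow g 0" unfolding eq by simp
    finally have "lmul (lcnj (lpow g j)) (lmul (lpow g j) (lpow g ((2 * n - 1) * j))) = lcnj (lpow g j)" by simp
    then show ?thesis using lmul_cnj(2)[OF lpow_in[OF gL, of j]] by (simp flip: lmul_assoc)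
  qed
  have "odd_part L"
    unfolding odd_part_def
  proof (intro conjI ballI)
    show "L \<subseteq> Lam" using lpow_in[OF gL] by (auto simp: L_def)
    show "(1, 0) \<in> L" using Liff[of 0] by simp
    show "(- 1, 0) \<notin> L" unfolding m1 Liff by (rule n(2))
    have "inj_on (\<lambda>i. lpow g (2 * i)) {..<n}" unfolding inj_on_def eq by simp
    then show "odd (card L)" unfolding L_def using n(2) by (simp add: card_image)
    fix u assume "u \<in> L"
    then obtain i where i: "u = lpow g (2 * i)" by (auto simp: L_def)
    show "lcnj u \<in> L" unfolding i inv Liff by simp
    fix v assume "v \<in> L"
    then obtain j where j: "v = lpow g (2 * j)" by (auto simp: L_def)
    show "lmul u v \<in> L" unfolding i j lpow_add[symmetric] Liff by simp
  next
    fix u assume "u \<in> Lam"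
    then obtain j where j: "u = lpow g j" using all by blast
    have "- u = lpow g (n + j)" unfolding j lpow_add m1[symmetric] lmul_m1 ..
    then show "u \<in> L \<or> - u \<in> L" using Liff j n(2) by auto
  qed
  moreover have "\<exists>u\<in>Lam. \<theta> i u \<noteq> \<theta> i (lcnj u)" if i: "i \<in> {1..?N}" for i
  proof
    show "\<theta> i g \<noteq> \<theta> i (lcnj g)"
    proof
      assume "\<theta> i g = \<theta> i (lcnj g)"
      then have "w ^ i * w ^ i = 1" using char_cnj[OF char gL, of i] thg by simp
      then have "w ^ (i + i) = 1" by (simp add: power_add)
      then show False using pos[of "i + i"] half[OF i i] i by simp
    qed
  qed (rule gL)
  moreover have "(\<exists>u\<in>Lam. \<theta> i u * \<theta> j u \<noteq> 1) \<and> (\<exists>u\<in>Lam. \<theta> i u * \<theta> j (lcnj u) \<noteq> 1)"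
    if i: "i \<in> {1..?N}" and j: "j \<in> {1..?N}" and ij: "i \<noteq> j" for i j
  proof (intro conjI bexI[of _ g] gL)
    have "w ^ (i + j) \<noteq> 1" using pos[of "i + j"] half[OF i j] i by simp
    then show "\<theta> i g * \<theta> j g \<noteq> 1" by (simp add: thg power_add)
    have ne: "w ^ a \<noteq> w ^ b" if "a < b" "a \<in> {1..?N}" "b \<in> {1..?N}" for a b
    proof
      assume e: "w ^ a = w ^ b"
      have "w ^ b = w ^ a * w ^ (b - a)" using that(1) by (simp flip: power_add)
      then have "w ^ (b - a) = 1" using e w0 by simp
      then show False using pos[of "b - a"] that half[OF that(2,3)] by simp
    qed
    have "w ^ i \<noteq> w ^ j" using ne[OF _ i j] ne[OF _ j i] ij by (metis linorder_neqE_nat)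
    moreover have "w ^ i = w ^ j" if "\<theta> i g * \<theta> j (lcnj g) = 1"
    proof -
      have "w ^ i * inverse (w ^ j) = 1" using that unfolding cnj[OF gL] thg .
      then show ?thesis using w0 by (simp add: field_simps)
    qed
    ultimately show "\<theta> i g * \<theta> j (lcnj g) \<noteq> 1" by blast
  qed
  moreover have "(\<Sum>i = 1..?N. tr (\<theta> i) u) = 1" if u: "u \<in> Lam" "snd u \<noteq> 0" for u
  proof -
    obtain j where j: "u = lpow g j" using all[OF u(1)] by blast
    define z where "z = w ^ j"
    have zth: "\<theta> i u = z ^ i" for i unfolding j th z_def by (simp add: mult.commute flip: power_mult)
    have zn: "z ^ n = 1" unfolding z_def using w(1) by (metis mult.commute power_mult power_one)
    have z0: "z \<noteq> 0" using w0 by (simp add: z_def)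
    \<comment> \<open>Otherwise \<open>n\<close> divides the exponent of \<open>u\<close>, so
      \<open>u\<close> is a power of -1 and its second coordinate is 0.\<close>
    have "z \<noteq> 1"
    proof
      assume "z = 1"
      have "w ^ (j mod n) = 1"
      proof -
        have "w ^ j = (w ^ n) ^ (j div n) * w ^ (j mod n)" by (metis mult_div_mod_eq power_add power_mult)
        then show ?thesis using \<open>z = 1\<close> w(1) by (simp add: z_def)
      qed
      then have "j mod n = 0" using pos[of "j mod n"] n0 by auto
      then obtain k where k: "j = n * k" by (metis mod_0_imp_dvd dvdE)
      have "snd (lpow g (n * k)) = 0" for k
      proof (induction k)
        case (Suc k)
        have "lpow g (n * Suc k) = - lpow g (n * k)" unfolding mult_Suc_right lpow_add m1[symmetric] lmul_m1 ..
        then show ?case using Suc by simp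
      qed simp
      then show False using u(2) j k by simp
    qed
    have "(\<Sum>i = 1..?N. tr (\<theta> i) u) = (\<Sum>i = 1..?N. z ^ i) + (\<Sum>i = 1..?N. z ^ (n - i))"
      unfolding sum.distrib[symmetric]
    proof (rule sum.cong[OF refl])
      fix i assume i: "i \<in> {1..?N}"
      then have "i \<le> n" using half[OF i i] by simp
      then have "z ^ i * z ^ (n - i) = 1" using zn by (simp flip: power_add)
      then have "inverse (z ^ i) = z ^ (n - i)" by (rule inverse_unique)
      then show "tr (\<theta> i) u = z ^ i + z ^ (n - i)" unfolding tr_def cnj[OF u(1)] zth by simp
    qed
    also have "(\<Sum>i = 1..?N. z ^ (n - i)) = (\<Sum>i = ?N + 1..n - 1. z ^ i)"
    proof (rule sum.reindex_bij_witness[of _ "\<lambda>i. n - i" "\<lambda>i. n - i"])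
      obtain k where k: "n = 2 * k + 1" using n(2) by (elim oddE)
      fix i show "i \<in> {1..?N} \<Longrightarrow> n - i \<in> {?N + 1..n - 1}" "i \<in> {?N + 1..n - 1} \<Longrightarrow> n - i \<in> {1..?N}"
        "i \<in> {1..?N} \<Longrightarrow> n - (n - i) = i" "i \<in> {?N + 1..n - 1} \<Longrightarrow> n - (n - i) = i"
        unfolding k by auto
    qed simp
    also have "(\<Sum>i = 1..?N. z ^ i) + (\<Sum>i = ?N + 1..n - 1. z ^ i) = (\<Sum>i\<in>{1..?N} \<union> {?N + 1..n - 1}. z ^ i)"
      by (rule sum.union_disjoint[symmetric]) auto
    also have "{1..?N} \<union> {?N + 1..n - 1} = {..<n} - {0}"
      using n0 by auto
    also have "(\<Sum>i\<in>{..<n} - {0}. z ^ i) = 1 + (\<Sum>i<n. z ^ i)"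
    proof -
      have "(\<Sum>i<n. z ^ i) = z ^ 0 + (\<Sum>i\<in>{..<n} - {0}. z ^ i)"
        using n0 by (intro sum.remove) auto
      then show ?thesis by simp
    qed
    also have "(\<Sum>i<n. z ^ i) = 0"
    proof -
      have "(z - 1) * (\<Sum>i<n. z ^ i) = 0" unfolding power_diff_1_eq[symmetric] zn by simp
      then show ?thesis using \<open>z \<noteq> 1\<close> by simp
    qed
    finally show ?thesis by simp
  qed
  ultimately show ?thesis using that char by blast
qed

end

subsection \<open>A quadratic extension of a finite field\<close>

text \<open>The map \<open>x \<mapsto> x\<^sup>2 - x\<close> identifies \<open>0\<close> and \<open>1\<close>, so it is not onto and \<open>X\<^sup>2 - X - c\<close>
  is irreducible for some \<open>c\<close>. In this form the extension exists in every characteristic, so that it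
  can be an instance of the class \<open>field\<close>.\<close>

lemma ex_artin_schreier: "\<exists>c::'k::{field,finite}. \<forall>x. x^2 - x \<noteq> c"
proof (rule ccontr)
  assume "\<not> ?thesis"
  then have "\<exists>x. c = x^2 - x" for c :: 'k by metis
  then have "surj (\<lambda>x::'k. x^2 - x)" unfolding surj_def by blast
  then have "inj (\<lambda>x::'k. x^2 - x)" by (rule finite_UNIV_surj_inj[OF finite])
  then have "(0::'k) = 1" by (rule injD) simp
  then show False by simp
qed

definition qc :: "'k::{field,finite}" where
  "qc = (SOME c. \<forall>x. x^2 - x \<noteq> c)"

lemma qc: "x^2 - x \<noteq> qc"
  using someI_ex[OF ex_artin_schreier] unfolding qc_def by blast

datatype 'k quad = Quad (q1: 'k) (q2: 'k)

text \<open>\<open>Quad x y\<close> stands for x + y X with X^2 = X + \<open>qc\<close>. The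
  conjugate of X is 1 - X, and the product with the conjugate is this norm.\<close>

definition qnorm :: "'k::{field,finite} quad \<Rightarrow> 'k" where
  "qnorm x = q1 x ^ 2 + q1 x * q2 x - qc * q2 x ^ 2"

lemma qnorm_eq_0: "qnorm x = 0 \<longleftrightarrow> q1 x = 0 \<and> q2 x = 0"
proof (cases "q2 x = 0")
  case False
  have "qnorm x = q2 x ^ 2 * ((- q1 x / q2 x) ^ 2 - (- q1 x / q2 x) - qc)"
    using False by (simp add: qnorm_def field_simps power2_eq_square)
  then show ?thesis using False qc[of "- q1 x / q2 x"] by (simp del: power_minus_even power2_minus)
qed (simp add: qnorm_def)

instantiation quad :: ("{field,finite}") field
begin

definition zero_quad :: "'a quad" where "0 = Quad 0 0"
definition one_quad :: "'a quad" where "1 = Quad 1 0"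
definition plus_quad :: "'a quad \<Rightarrow> 'a quad \<Rightarrow> 'a quad" where
  "x + y = Quad (q1 x + q1 y) (q2 x + q2 y)"
definition minus_quad :: "'a quad \<Rightarrow> 'a quad \<Rightarrow> 'a quad" where
  "x - y = Quad (q1 x - q1 y) (q2 x - q2 y)"
definition uminus_quad :: "'a quad \<Rightarrow> 'a quad" where
  "- x = Quad (- q1 x) (- q2 x)"
definition times_quad :: "'a quad \<Rightarrow> 'a quad \<Rightarrow> 'a quad" where
  "x * y = Quad (q1 x * q1 y + qc * q2 x * q2 y) (q1 x * q2 y + q2 x * q1 y + q2 x * q2 y)"
definition inverse_quad :: "'a quad \<Rightarrow> 'a quad" where
  "inverse x = Quad ((q1 x + q2 x) / qnorm x) (- q2 x / qnorm x)"
definition divide_quad :: "'a quad \<Rightarrow> 'a quad \<Rightarrow> 'a quad" where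
  "divide_quad x y = x * inverse y"

instance
proof
  fix x :: "'a quad"
  assume "x \<noteq> 0"
  then have n: "qnorm x \<noteq> 0" by (auto simp: qnorm_eq_0 zero_quad_def quad.expand)
  have "(q1 x + q2 x) * q1 x + qc * (- q2 x) * q2 x = qnorm x"
    by (simp add: qnorm_def algebra_simps power2_eq_square)
  moreover have "(q1 x + q2 x) * q2 x + (- q2 x) * q1 x + (- q2 x) * q2 x = 0"
    by (simp add: algebra_simps)
  ultimately show "inverse x * x = 1" using n
    by (simp add: inverse_quad_def times_quad_def one_quad_def flip: add_divide_distrib diff_divide_distrib)
qed (auto simp: zero_quad_def one_quad_def plus_quad_def minus_quad_def uminus_quad_def times_quad_def
    divide_quad_def inverse_quad_def quad.expand algebra_simps)

end

context conic_char2
begin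

lemma ex_lam_generator: "\<exists>g. lam_generator g"
proof -
  have "\<exists>t. t^2 = Quad (- nu) 0"
  proof (cases "is_sq (- nu)")
    case True
    then obtain r where "- nu = r^2" by (auto simp: is_sq_def)
    then have "(Quad r 0)^2 = Quad (- nu) 0" by (simp add: power2_eq_square times_quad_def)
    then show ?thesis ..
  next
    case False
    \<comment> \<open>The discriminant of X^2 - X - \<open>qc\<close>. It is a non-square because
      the polynomial has no root, and \<open>- nu\<close> is then \<open>?D\<close> times a square.
      Its square root in the extension is 2 X - 1, so \<open>Quad (- s) (2 * s)\<close> below is s
      (2 X - 1).\<close>
    let ?D = "1 + 4 * qc :: 'k"
    have two: "(2::'k) \<noteq> 0" by (rule odd_card_two_neq_0[OF odd])
    have four: "(4::'k) \<noteq> 0" by (rule odd_card_four_neq_0[OF odd])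
    have D: "\<not> is_sq ?D"
    proof
      assume "is_sq ?D"
      then obtain y where y: "?D = y^2" by (auto simp: is_sq_def)
      define x where "x = (1 + y) / 2"
      have "2 * x = 1 + y" using two unfolding x_def by (simp only: nonzero_mult_div_cancel_left times_divide_eq_right not_False_eq_True)
      then have "y = 2 * x - 1" by simp
      then have "1 + 4 * qc = (2 * x - 1)^2" using y by (simp only:)
      then have "4 * (x^2 - x) = 4 * qc" by (simp add: power2_eq_square algebra_simps)
      then have "x^2 - x = qc" unfolding mult_left_cancel[OF four] .
      then show False using qc[of x] by simp
    qed
    then have D0: "?D \<noteq> 0" by (metis is_sq_0)
    obtain r where r: "- nu * ?D = r^2"
      using nonsq_mult_nonsq[OF odd False D] by (auto simp: is_sq_def)
    have "d \<noteq> 0 \<Longrightarrow> x * d = r^2 \<Longrightarrow> x = (r / d)^2 * d" for d x :: 'k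
      by (simp add: power2_eq_square field_simps)
    from this[OF D0 r] have "- nu = (r / ?D)^2 * ?D" .
    moreover have "(Quad (- s) (2 * s))^2 = Quad (s^2 * ?D) 0" for s :: 'k
      by (simp add: power2_eq_square times_quad_def algebra_simps)
    ultimately show ?thesis by metis
  qed
  then obtain t where t: "t^2 = Quad (- nu) 0" ..
  show ?thesis
    by (rule exists_lam_generator[of "\<lambda>x. Quad x 0" t])
      (auto simp: t one_quad_def plus_quad_def times_quad_def inj_def)
qed

end

section \<open>Assembly of the two cases\<close>

context conic_psi
begin

text \<open>The two dimension clauses are conditional because the congruence classes call for
  different \<open>nu\<close>: an arbitrary non-square if -1 is a square, and
  \<open>nu = - 1\<close> otherwise.\<close>

lemma decomposition:
  defines "q \<equiv> CARD('k)"
  assumes n: "card Lam = 2 * n" "odd n" and w: "w ^ n = (1::'f)" "\<And>d. 0 < d \<Longrightarrow> d < n \<Longrightarrow> w ^ d \<noteq> 1"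
  defines "N \<equiv> (n - 1) div 2"
  shows "\<exists>M :: nat \<Rightarrow> ('f, 'k) pvec set.
    (\<forall>i\<in>{1..N}. FH_simple (M i) \<and> (is_sq (- 1 :: 'k) \<longrightarrow> vec.dim (M i) = q - 1) \<and>
        (nu = - 1 \<longrightarrow> vec.dim (M i) = q + 1)) \<and>
    (\<forall>i\<in>{1..N}. \<forall>j\<in>{1..N}. i \<noteq> j \<longrightarrow> \<not> FH_isomorphic (M i) (M j)) \<and>
    (q mod 4 = 1 \<longrightarrow> FH_direct_sum Im_phi_B (Im_phi_D # map M [1..<N + 1])) \<and>
    (q mod 4 = 3 \<longrightarrow> FH_direct_sum Im_phi_B (vec.span {chi E} # Im_phi_D # map M [1..<N + 1]))"
proof -
  obtain g where g: "lam_generator g" using ex_lam_generator by blast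
  show ?thesis
  proof (rule char_family[OF g n w, folded N_def])
    fix L and \<theta> :: "nat \<Rightarrow> 'k \<times> 'k \<Rightarrow> 'f"
    assume L: "odd_part L" and char: "\<And>i. i \<in> {1..N} \<Longrightarrow> is_char (\<theta> i)"
      and *: "\<And>i. i \<in> {1..N} \<Longrightarrow> \<exists>u\<in>Lam. \<theta> i u \<noteq> \<theta> i (lcnj u)"
      and distinct: "\<And>i j. i \<in> {1..N} \<Longrightarrow> j \<in> {1..N} \<Longrightarrow> i \<noteq> j \<Longrightarrow>
          (\<exists>u\<in>Lam. \<theta> i u * \<theta> j u \<noteq> 1) \<and> (\<exists>u\<in>Lam. \<theta> i u * \<theta> j (lcnj u) \<noteq> 1)"
      and total: "\<And>u. u \<in> Lam \<Longrightarrow> snd u \<noteq> 0 \<Longrightarrow> (\<Sum>i = 1..N. tr (\<theta> i) u) = 1"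
    have nonreal: "nonreal (\<theta> i)" if "i \<in> {1..N}" for i
      using *[OF that] by (simp add: nonreal_def)
    note fam = L char nonreal distinct total
    show ?thesis
    proof (intro exI[of _ "\<lambda>i. Md (\<theta> i)"] conjI ballI impI)
      fix i assume i: "i \<in> {1..N}"
      show "FH_simple (Md (\<theta> i))" by (rule FH_simple_Md[OF char[OF i] nonreal[OF i]])
      show "vec.dim (Md (\<theta> i)) = q - 1" if "is_sq (- 1 :: 'k)"
        unfolding q_def by (rule dim_Md_1[OF char[OF i] that])
      show "vec.dim (Md (\<theta> i)) = q + 1" if "nu = - 1"
        unfolding q_def by (rule dim_Md_3[OF that char[OF i] nonreal[OF i]])
      show "\<not> FH_isomorphic (Md (\<theta> i)) (Md (\<theta> j))" if "j \<in> {1..N}" "i \<noteq> j" for j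
        by (rule Md_not_isomorphic[OF fam i that])
    next
      show "FH_direct_sum Im_phi_B (Im_phi_D # map (\<lambda>i. Md (\<theta> i)) [1..<N + 1])" if "q mod 4 = 1"
        by (rule direct_sum_1[OF fam that[unfolded q_def]])
      show "FH_direct_sum Im_phi_B (vec.span {chi E} # Im_phi_D # map (\<lambda>i. Md (\<theta> i)) [1..<N + 1])"
        if "q mod 4 = 3"
        by (rule direct_sum_3[OF fam that[unfolded q_def]])
    qed
  qed assumption
qed

end

theorem theorem6p1:
  fixes q :: nat and \<iota> :: "bit \<Rightarrow> 'f::alg_closed_field"
  assumes q: "q = CARD('k::{field,finite})" and "odd q"
    and F: "is_algebraic_closure \<iota>"
  shows
    "(q mod 4 = 1 \<longrightarrow>
       (\<exists>M :: nat \<Rightarrow> ('f, 'k) pvec set.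
          FH_direct_sum (Im_phi_B :: ('f, 'k) pvec set)
            (Im_phi_D # map M [1..<(q - 1) div 4 + 1]) \<and>
          (\<forall>s\<in>{1..(q - 1) div 4}. FH_simple (M s) \<and> vec.dim (M s) = q - 1) \<and>
          (\<forall>s\<in>{1..(q - 1) div 4}. \<forall>t\<in>{1..(q - 1) div 4}.
             s \<noteq> t \<longrightarrow> \<not> FH_isomorphic (M s) (M t)))) \<and>
     (q mod 4 = 3 \<longrightarrow>
       FH_trivial (vec.span {chi external_points :: ('f, 'k) pvec}) \<and>
       (\<exists>M :: nat \<Rightarrow> ('f, 'k) pvec set.
          FH_direct_sum (Im_phi_B :: ('f, 'k) pvec set)
            (vec.span {chi external_points} # Im_phi_D # map M [1..<(q - 3) div 4 + 1]) \<and>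
          (\<forall>r\<in>{1..(q - 3) div 4}. FH_simple (M r) \<and> vec.dim (M r) = q + 1) \<and>
          (\<forall>r\<in>{1..(q - 3) div 4}. \<forall>t\<in>{1..(q - 3) div 4}.
             r \<noteq> t \<longrightarrow> \<not> FH_isomorphic (M r) (M t))))"
proof -
  have odd: "odd CARD('k)" using assms(1,2) by simp
  have add: "\<iota> (x + y) = \<iota> x + \<iota> y" for x y using F by (simp add: is_algebraic_closure_def)
  \<comment> \<open>\<open>\<iota>\<close> preserves 0, so it carries the equation 1 + 1 = 0 from
    \<open>bit\<close> to \<open>'f\<close>.\<close>
  have "\<iota> 0 + \<iota> 0 = \<iota> 0 + 0" unfolding add[symmetric] by simp
  then have "\<iota> 0 = 0" unfolding add_left_cancel .
  moreover have "\<iota> 1 = 1" using F by (simp add: is_algebraic_closure_def)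
  ultimately have char2: "(1::'f) + 1 = 0" using add[of 1 1] by simp
  obtain psi :: "'k \<Rightarrow> 'f" where psi: "\<And>x y. psi (x + y) = psi x * psi y" "psi 0 = 1" "\<exists>x. psi x \<noteq> 1"
    using exists_additive_character[OF odd char2] by blast
  have sq: "is_sq (- 1 :: 'k) \<longleftrightarrow> q mod 4 = 1" using is_sq_neg_1[OF odd] q by simp
  show ?thesis
  proof (intro conjI impI)
    assume q1: "q mod 4 = 1"
    obtain nu :: 'k where nu: "\<not> is_sq nu" using ex_nonsq[OF odd] by blast
    interpret conic_psi nu "TYPE('f)" psi
      by unfold_locales (use odd nu char2 psi in auto)
    define k where "k = q div 4"
    have k: "q = 4 * k + 1" using mult_div_mod_eq[of 4 q] q1 by (simp add: k_def)
    \<comment> \<open>Since q + 1 = 2 (2 k + 1), the order of \<open>Lam\<close> is twice an odd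
      number, and (n - 1) / 2 = k = (q - 1) / 4.\<close>
    define n where "n = 2 * k + 1"
    have "q + 1 = 2 * n" "odd n" and N: "(n - 1) div 2 = (q - 1) div 4"
      unfolding n_def k by simp_all
    then have n: "card Lam = 2 * n" "odd n" using card_Lam sq q1 q by simp_all
    obtain w :: 'f where w: "w ^ n = 1" "\<And>d. 0 < d \<Longrightarrow> d < n \<Longrightarrow> w ^ d \<noteq> 1"
      by (rule exists_primitive_root_of_unity[OF char2 n(2)]) (rule that; blast)
    note dec = decomposition[OF n w, folded q, unfolded N]
    show "\<exists>M :: nat \<Rightarrow> ('f, 'k) pvec set.
          FH_direct_sum (Im_phi_B :: ('f, 'k) pvec set)
            (Im_phi_D # map M [1..<(q - 1) div 4 + 1]) \<and>
          (\<forall>s\<in>{1..(q - 1) div 4}. FH_simple (M s) \<and> vec.dim (M s) = q - 1) \<and>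
          (\<forall>s\<in>{1..(q - 1) div 4}. \<forall>t\<in>{1..(q - 1) div 4}.
             s \<noteq> t \<longrightarrow> \<not> FH_isomorphic (M s) (M t))"
      using dec sq q1 by metis
  next
    assume q3: "q mod 4 = 3"
    have nu: "\<not> is_sq (- 1 :: 'k)" using sq q3 by simp
    interpret conic_psi "- 1" "TYPE('f)" psi
      by unfold_locales (use odd nu char2 psi in auto)
    define k where "k = q div 4"
    have k: "q = 4 * k + 3" using mult_div_mod_eq[of 4 q] q3 by (simp add: k_def)
    \<comment> \<open>Here \<open>Lam\<close> is split and q - 1 = 2 (2 k + 1), so again (n - 1) / 2
      = k, now equal to (q - 3) / 4.\<close>
    define n where "n = 2 * k + 1"
    have "q - 1 = 2 * n" "odd n" and N: "(n - 1) div 2 = (q - 3) div 4"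
      unfolding n_def k by simp_all
    then have n: "card Lam = 2 * n" "odd n" using card_Lam sq q3 q by simp_all
    obtain w :: 'f where w: "w ^ n = 1" "\<And>d. 0 < d \<Longrightarrow> d < n \<Longrightarrow> w ^ d \<noteq> 1"
      by (rule exists_primitive_root_of_unity[OF char2 n(2)]) (rule that; blast)
    note dec = decomposition[OF n w, folded q, unfolded N]
    show "FH_trivial (vec.span {chi external_points :: ('f, 'k) pvec})" by (rule FH_trivial_one)
    show "\<exists>M :: nat \<Rightarrow> ('f, 'k) pvec set.
          FH_direct_sum (Im_phi_B :: ('f, 'k) pvec set)
            (vec.span {chi external_points} # Im_phi_D # map M [1..<(q - 3) div 4 + 1]) \<and>
          (\<forall>r\<in>{1..(q - 3) div 4}. FH_simple (M r) \<and> vec.dim (M r) = q + 1) \<and>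
          (\<forall>r\<in>{1..(q - 3) div 4}. \<forall>t\<in>{1..(q - 3) div 4}.
             r \<noteq> t \<longrightarrow> \<not> FH_isomorphic (M r) (M t))"
      using dec q3 by metis
  qed
qed

end
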